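(* Let $\mathfrak g$ be of type $C_n$, let $1<i\le n$, let $V=V(\boldsymbol\omega_{i,1})$, and let $0\le r\le i$ with $r\equiv i\bmod2$. Then $$\mathrm{wt}_\ell(V_{\omega_r})=\{\boldsymbol\pi_r(\mathbf j):\mathbf j\in\mathbf J_r\}\qquad\text{and}\qquad \dim V_{\boldsymbol\pi_r(\mathbf j)}=1\ \text{ for all }\mathbf j\in\mathbf J_r.$$
   Context: **Lie algebra data.** $\mathfrak g$ is a complex simple Lie algebra of type $C_n$, Dynkin diagram labeled as in Bourbaki, $I=\{1,\dots,n\}$, Cartan matrix $A=(a_{ij})$, fundamental weights $\omega_i$, $\omega_0:=0$, weight lattice $P$. $d_i$ are the minimal positive integers with $d_ia_{ij}=d_ja_{ji}$. $q\in\mathbb C^\times$ is not a root of unity, $q_i=q^{d_i}$, $[m]_i=\frac{q_i^m-q_i^{-m}}{q_i-q_i^{-1}}$, with the corresponding $q_i$-binomials. **$\ell$-weight lattice.** $\mathcal P_q$ is the multiplicative subgroup of $(\mathbb C(u)^{\times})^n$ generated (freely) by $\boldsymbol\omega_{i,a}$ ($i\in I$, $a\in\mathbb C^\times$), the $n$-tuple with $i$-th entry $1-au$ and all other entries $1$; $\boldsymbol\omega_{0,a}:=1$. **Quantum loop algebra.** $\mathbf U_q$ is the algebra with generators $x^\pm_{i,r}$ ($r\in\mathbb Z$), $K_i^{\pm1}$, $h_{i,r}$ ($r\in\mathbb Z\setminus\{0\}$), $i\in I$, and relations: $K_iK_i^{-1}=K_i^{-1}K_i=1$, $K_iK_j=K_jK_i$,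 $K_ih_{j,r}=h_{j,r}K_i$, $K_ix^\pm_{j,r}K_i^{-1}=q_i^{\pm a_{ij}}x^\pm_{j,r}$, $[h_{i,r},h_{j,s}]=0$, $[h_{i,r},x^\pm_{j,s}]=\pm\frac1r[ra_{ij}]_ix^\pm_{j,r+s}$, $x^\pm_{i,r+1}x^\pm_{j,s}-q_i^{\pm a_{ij}}x^\pm_{j,s}x^\pm_{i,r+1}=q_i^{\pm a_{ij}}x^\pm_{i,r}x^\pm_{j,s+1}-x^\pm_{j,s+1}x^\pm_{i,r}$, $[x^+_{i,r},x^-_{j,s}]=\delta_{ij}\frac{\psi^+_{i,r+s}-\psi^-_{i,r+s}}{q_i-q_i^{-1}}$, and for $i\ne j$, $m=1-a_{ij}$, and all integers $r_1,\dots,r_m,s$, $\sum_{\pi\in\Sigma_m}\sum_{k=0}^m(-1)^k\binom{m}{k}_{q_i}x^\pm_{i,r_{\pi(1)}}\cdots x^\pm_{i,r_{\pi(k)}}x^\pm_{j,s}x^\pm_{i,r_{\pi(k+1)}}\cdots x^\pm_{i,r_{\pi(m)}}=0$ ($q_i$-binomial); here $\sum_{r\ge0}\psi^\pm_{i,\pm r}u^{\pm r}=K_i^{\pm1}\exp\big(\pm(q_i-q_i^{-1})\sum_{s\ge1}h_{i,\pm s}u^{\pm s}\big)$ and $\psi^\pm_{i,\mp r}=0$ for $r>0$. Define $P_{i,\pm k}$ by $P^\pm_i(u)=\sum_{k\ge0}P_{i,\pm k}u^k=\exp\big(-\sum_{k\ge1}\frac{q^{\pm k}h_{i,\pm k}}{[k]_i}u^k\big)$.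 **Modules.** All modules are finite-dimensional of type 1: $V=\bigoplus_{\mu\in P}V_\mu$, $V_\mu=\{v:K_iv=q_i^{\mu_i}v\ \forall i\}$ for $\mu=\sum\mu_i\omega_i$. For $\boldsymbol\varpi=(\varpi_1,\dots,\varpi_n)\in\mathcal P_q$ put $\varpi_i^+=\varpi_i$ and let $\varpi_i^-$ be $u^{\deg\varpi_i}\varpi_i(u^{-1})$ divided by its value at $u=0$ (degree = degree of numerator minus degree of denominator); $(\varpi_i^\pm)_r$ is the coefficient of $u^r$ in the power series expansion. $V_{\boldsymbol\varpi}$ is the space of $v\in V$ such that for all $i,r$, $(P_{i,\pm r}-(\varpi_i^\pm)_r)^Nv=0$ for some $N$. $\mathrm{wt}_\ell(V_\mu)$ is the set of $\boldsymbol\varpi$ with $V_{\boldsymbol\varpi}\cap V_\mu\neq0$. $V(\boldsymbol\omega_{i,a})$ is the finite-dimensional irreducible module generated by a nonzero $v$ with $x^+_{j,r}v=0$, $P_j^\pm(u)v=(\boldsymbol\omega_{i,a})_j^\pm v$, $K_jv=q_j^{\delta_{ij}}v$ for all $j\in I$, $r\in\mathbb Z$. **Partitions and $\boldsymbol\pi_r$.** Put $M=(i-r)/2$. $\mathbf J_r$ is the set of integer sequences $\mathbf j=(r<j_1<\cdots<j_M\le n)$ with $j_s\le n-i+r+2s-1$ for $1\le s\le M$ (only the empty sequence if $M=0$). $\boldsymbol\pi_r(j,s)=\boldsymbol\omega^{-1}_{j,q^{i+j-2s-2r}}\boldsymbol\omega_{j,q^{2n+2-i-j+2s}}$ and $\boldsymbol\pi_r(\mathbf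 j)=\boldsymbol\omega_{r,q^{i-r}}\prod_{s=1}^M\boldsymbol\pi_r(j_s-1,s-1)\boldsymbol\pi_r(j_s,s)^{-1}$. *)

theory Defs
  imports
    Complex_Main
    "HOL-Library.Poly_Mapping"
    "HOL-Combinatorics.Permutations"
    "HOL-Computational_Algebra.Fraction_Field"
    "HOL-Computational_Algebra.Polynomial_FPS"
    "HOL-Algebra.QuotRing"
begin

section \<open>Cartan data of type \<open>C\<^sub>n\<close> and quantum integers\<close>

text \<open>
  Nodes are \<open>1, \<dots>, n\<close>, labelled as in Bourbaki, so that \<open>\<alpha>\<^sub>n\<close> is the long simple root.  The
  convention is \<open>a\<^sub>i\<^sub>j = 2 (\<alpha>\<^sub>i, \<alpha>\<^sub>j) / (\<alpha>\<^sub>i, \<alpha>\<^sub>i)\<close>, as forced by the Serre relations with exponent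
  \<open>1 - a\<^sub>i\<^sub>j\<close> in the generators of node \<open>i\<close>.
\<close>

definition cartan :: "nat \<Rightarrow> nat \<Rightarrow> nat \<Rightarrow> int" where
  "cartan n i j =
     (if i = j then 2
      else if i = n - 1 \<and> j = n then - 2
      else if i = j + 1 \<or> j = i + 1 then - 1
      else 0)"

definition symm_d :: "nat \<Rightarrow> nat \<Rightarrow> nat" where
  "symm_d n i = (if i = n then 2 else 1)"

lemma symm_d_symmetrizes:
  assumes "2 \<le> n" "i \<in> {1..n}" "j \<in> {1..n}"
  shows "int (symm_d n i) * cartan n i j = int (symm_d n j) * cartan n j i"
  using assms by (auto simp: symm_d_def cartan_def)

lemma symm_d_minimal:
  fixes d :: "nat \<Rightarrow> nat"
  assumes n: "2 \<le> n" and i: "i \<in> {1..n}"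
    and pos: "\<And>k. k \<in> {1..n} \<Longrightarrow> 0 < d k"
    and symm: "\<And>k l. k \<in> {1..n} \<Longrightarrow> l \<in> {1..n} \<Longrightarrow>
                 int (d k) * cartan n k l = int (d l) * cartan n l k"
  shows "symm_d n i \<le> d i"
proof (cases "i = n")
  case True
  have "n - 1 \<in> {1..n}" "n \<in> {1..n}" using n by auto
  moreover have "cartan n (n - 1) n = - 2" "cartan n n (n - 1) = - 1"
    using n by (auto simp: cartan_def)
  ultimately have "int (d (n - 1)) * (- 2) = int (d n) * (- 1)"
    using symm[of "n - 1" n] by simp
  with pos[OF \<open>n - 1 \<in> {1..n}\<close>] show ?thesis by (simp add: True symm_d_def)
next
  case False
  then show ?thesis using pos[OF i] by (simp add: symm_d_def)
qed

definition qi :: "nat \<Rightarrow> complex \<Rightarrow> nat \<Rightarrow> complex" where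
  "qi n q i = q ^ symm_d n i"

definition qint :: "complex \<Rightarrow> int \<Rightarrow> complex" where
  "qint p m = (p powi m - p powi (- m)) / (p - inverse p)"

definition qfact :: "complex \<Rightarrow> nat \<Rightarrow> complex" where
  "qfact p m = (\<Prod>k = 1..m. qint p (int k))"

definition qbinom :: "complex \<Rightarrow> nat \<Rightarrow> nat \<Rightarrow> complex" where
  "qbinom p m k = qfact p m / (qfact p k * qfact p (m - k))"


section \<open>The free algebra on the Drinfeld generators\<close>

datatype sign = Plus | Minus

fun sg :: "sign \<Rightarrow> int" where
  "sg Plus = 1"
| "sg Minus = - 1"

text \<open>\<open>Gen_x e i r\<close>, \<open>Gen_K e i\<close>, \<open>Gen_h i r\<close> stand for \<open>x\<^sup>e\<^sub>i\<^sub>,\<^sub>r\<close>, \<open>K\<^sub>i\<^sup>e\<^sup>1\<close>, \<open>h\<^sub>i\<^sub>,\<^sub>r\<close>, where \<open>e\<close> is a sign.\<close>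

datatype uq_gen = Gen_x sign nat int | Gen_K sign nat | Gen_h nat int

definition uq_gens :: "nat \<Rightarrow> uq_gen set" where
  "uq_gens n = {Gen_x e i r | e i r. i \<in> {1..n}} \<union> {Gen_K e i | e i. i \<in> {1..n}}
     \<union> {Gen_h i r | i r. i \<in> {1..n} \<and> r \<noteq> 0}"

text \<open>
  Words form the free monoid on the generators.  It is written additively so that the
  convolution product on \<^typ>\<open>'a \<Rightarrow>\<^sub>0 'b\<close> is the product of the free algebra.
\<close>

datatype uq_word = Word (letters: "uq_gen list")

instantiation uq_word :: monoid_add
begin
definition zero_uq_word :: uq_word where "zero_uq_word = Word []"
definition plus_uq_word :: "uq_word \<Rightarrow> uq_word \<Rightarrow> uq_word" where
  "plus_uq_word v w = Word (letters v @ letters w)"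
instance by standard (simp_all add: zero_uq_word_def plus_uq_word_def)
end

type_synonym uq_free = "uq_word \<Rightarrow>\<^sub>0 complex"

definition free_alg :: "nat \<Rightarrow> uq_free ring" where
  "free_alg n =
     \<lparr>carrier = {f. \<forall>w \<in> Poly_Mapping.keys f. set (letters w) \<subseteq> uq_gens n},
      mult = (*), one = 1, zero = 0, add = (+)\<rparr>"

definition sc :: "complex \<Rightarrow> uq_free" where
  "sc c = Poly_Mapping.single 0 c"

definition gen :: "uq_gen \<Rightarrow> uq_free" where
  "gen g = Poly_Mapping.single (Word [g]) 1"

abbreviation gx :: "sign \<Rightarrow> nat \<Rightarrow> int \<Rightarrow> uq_free" where
  "gx e i r \<equiv> gen (Gen_x e i r)"

abbreviation gK :: "sign \<Rightarrow> nat \<Rightarrow> uq_free" where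
  "gK e i \<equiv> gen (Gen_K e i)"

abbreviation gh :: "nat \<Rightarrow> int \<Rightarrow> uq_free" where
  "gh i r \<equiv> gen (Gen_h i r)"

text \<open>The exponential of a power series with zero constant term.\<close>

definition exp_series :: "uq_free fps \<Rightarrow> uq_free fps" where
  "exp_series F = fps_compose (Abs_fps (\<lambda>m. sc (1 / fact m))) F"

text \<open>
  \<open>psi_series n q e i\<close> is the series \<open>\<psi>\<^sup>e\<^sub>i\<close> in the variable \<open>u\<close> for \<open>e = Plus\<close> and in the
  variable \<open>u\<^sup>-\<^sup>1\<close> for \<open>e = Minus\<close>.
\<close>

definition psi_series :: "nat \<Rightarrow> complex \<Rightarrow> sign \<Rightarrow> nat \<Rightarrow> uq_free fps" where
  "psi_series n q e i =
     fps_const (gK e i) *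
     exp_series (Abs_fps (\<lambda>s. if s = 0 then 0
        else sc (of_int (sg e) * (qi n q i - inverse (qi n q i))) * gh i (sg e * int s)))"

definition psi :: "nat \<Rightarrow> complex \<Rightarrow> sign \<Rightarrow> nat \<Rightarrow> int \<Rightarrow> uq_free" where
  "psi n q e i r =
     (if sg e * r < 0 then 0 else fps_nth (psi_series n q e i) (nat (sg e * r)))"

text \<open>\<open>P_elt n q e i k\<close> is \<open>P\<^sub>i\<^sub>,\<^sub>k\<close> for \<open>e = Plus\<close> and \<open>P\<^sub>i\<^sub>,\<^sub>-\<^sub>k\<close> for \<open>e = Minus\<close>.\<close>

definition P_elt :: "nat \<Rightarrow> complex \<Rightarrow> sign \<Rightarrow> nat \<Rightarrow> nat \<Rightarrow> uq_free" where
  "P_elt n q e i k =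
     fps_nth (exp_series (Abs_fps (\<lambda>k. if k = 0 then 0
        else - (sc (q powi (sg e * int k) / qint (qi n q i) (int k)) * gh i (sg e * int k))))) k"


lemma carrier_free_alg:
  "f \<in> carrier (free_alg n) \<longleftrightarrow> (\<forall>w \<in> Poly_Mapping.keys f. set (letters w) \<subseteq> uq_gens n)"
  by (simp add: free_alg_def)

lemma free_alg_simps [simp]:
  "mult (free_alg n) = (*)" "one (free_alg n) = 1" "zero (free_alg n) = 0" "add (free_alg n) = (+)"
  by (simp_all add: free_alg_def)

lemma free_alg_0 [intro]: "0 \<in> carrier (free_alg n)"
  by (simp add: carrier_free_alg)

lemma free_alg_sc [intro]: "sc c \<in> carrier (free_alg n)"
  by (simp add: carrier_free_alg sc_def zero_uq_word_def)

lemma free_alg_1 [intro]: "1 \<in> carrier (free_alg n)"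
  using free_alg_sc[of 1 n] by (simp add: sc_def)

lemma free_alg_gen: "g \<in> uq_gens n \<Longrightarrow> gen g \<in> carrier (free_alg n)"
  by (simp add: carrier_free_alg gen_def)

lemma free_alg_add [intro]:
  "f \<in> carrier (free_alg n) \<Longrightarrow> g \<in> carrier (free_alg n) \<Longrightarrow> f + g \<in> carrier (free_alg n)"
  using keys_add[of f g] by (auto simp: carrier_free_alg)

lemma free_alg_uminus [intro]: "f \<in> carrier (free_alg n) \<Longrightarrow> - f \<in> carrier (free_alg n)"
  by (auto simp: carrier_free_alg in_keys_iff)

lemma free_alg_diff [intro]:
  "f \<in> carrier (free_alg n) \<Longrightarrow> g \<in> carrier (free_alg n) \<Longrightarrow> f - g \<in> carrier (free_alg n)"
  using free_alg_add[of f n "- g"] by auto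

lemma free_alg_mult [intro]:
  assumes "f \<in> carrier (free_alg n)" "g \<in> carrier (free_alg n)"
  shows "f * g \<in> carrier (free_alg n)"
  using assms keys_mult[of f g] by (fastforce simp: carrier_free_alg plus_uq_word_def)

lemma free_alg_sum [intro]:
  "(\<And>x. x \<in> A \<Longrightarrow> f x \<in> carrier (free_alg n)) \<Longrightarrow> sum f A \<in> carrier (free_alg n)"
  by (induction A rule: infinite_finite_induct) auto

lemma free_alg_prod_list:
  "(\<And>x. x \<in> set xs \<Longrightarrow> x \<in> carrier (free_alg n)) \<Longrightarrow> prod_list xs \<in> carrier (free_alg n)"
  by (induction xs) auto

lemma ring_free_alg: "ring (free_alg n)"
proof (intro ringI abelian_groupI monoid.intro)
  fix x assume "x \<in> carrier (free_alg n)"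
  then show "\<exists>y \<in> carrier (free_alg n). y \<oplus>\<^bsub>free_alg n\<^esub> x = \<zero>\<^bsub>free_alg n\<^esub>"
    by (intro bexI[of _ "- x"]) auto
qed (auto simp: algebra_simps)

lemma free_alg_fps_power:
  "(\<And>k. fps_nth F k \<in> carrier (free_alg n)) \<Longrightarrow> fps_nth (F ^ m) k \<in> carrier (free_alg n)"
  by (induction m arbitrary: k) (auto simp: fps_mult_nth)

lemma free_alg_exp_series:
  "(\<And>k. fps_nth F k \<in> carrier (free_alg n)) \<Longrightarrow>
     fps_nth (exp_series F) k \<in> carrier (free_alg n)"
  by (auto simp: exp_series_def fps_compose_def intro!: free_alg_fps_power free_alg_sum)

lemma free_alg_gens:
  "i \<in> {1..n} \<Longrightarrow> gx e i r \<in> carrier (free_alg n)"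
  "i \<in> {1..n} \<Longrightarrow> gK e i \<in> carrier (free_alg n)"
  "i \<in> {1..n} \<Longrightarrow> r \<noteq> 0 \<Longrightarrow> gh i r \<in> carrier (free_alg n)"
  by (auto intro!: free_alg_gen simp: uq_gens_def)

lemma sg_nonzero [simp]: "sg e \<noteq> 0"
  by (cases e) auto

lemma free_alg_psi: "i \<in> {1..n} \<Longrightarrow> psi n q e i r \<in> carrier (free_alg n)"
  unfolding psi_def psi_series_def
  by (auto simp: fps_mult_left_const_nth intro!: free_alg_exp_series free_alg_gens free_alg_mult)

lemma free_alg_P_elt: "i \<in> {1..n} \<Longrightarrow> P_elt n q e i k \<in> carrier (free_alg n)"
  unfolding P_elt_def
  by (auto intro!: free_alg_exp_series free_alg_gens free_alg_mult free_alg_uminus)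


section \<open>The quantum loop algebra\<close>

text \<open>A relation \<open>a = b\<close> is recorded as the element \<open>a - b\<close> of the free algebra.\<close>

inductive_set uq_rels :: "nat \<Rightarrow> complex \<Rightarrow> uq_free set" for n :: nat and q :: complex where
  K_right_inv: "i \<in> {1..n} \<Longrightarrow> gK Plus i * gK Minus i - 1 \<in> uq_rels n q"
| K_left_inv: "i \<in> {1..n} \<Longrightarrow> gK Minus i * gK Plus i - 1 \<in> uq_rels n q"
| K_K: "i \<in> {1..n} \<Longrightarrow> j \<in> {1..n} \<Longrightarrow>
    gK Plus i * gK Plus j - gK Plus j * gK Plus i \<in> uq_rels n q"
| K_h: "i \<in> {1..n} \<Longrightarrow> j \<in> {1..n} \<Longrightarrow> r \<noteq> 0 \<Longrightarrow>
    gK Plus i * gh j r - gh j r * gK Plus i \<in> uq_rels n q"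
| K_x: "i \<in> {1..n} \<Longrightarrow> j \<in> {1..n} \<Longrightarrow>
    gK Plus i * gx e j r * gK Minus i - sc (qi n q i powi (sg e * cartan n i j)) * gx e j r
      \<in> uq_rels n q"
| h_h: "i \<in> {1..n} \<Longrightarrow> j \<in> {1..n} \<Longrightarrow> r \<noteq> 0 \<Longrightarrow> s \<noteq> 0 \<Longrightarrow>
    gh i r * gh j s - gh j s * gh i r \<in> uq_rels n q"
| h_x: "i \<in> {1..n} \<Longrightarrow> j \<in> {1..n} \<Longrightarrow> r \<noteq> 0 \<Longrightarrow>
    gh i r * gx e j s - gx e j s * gh i r
      - sc (of_int (sg e) * (1 / of_int r) * qint (qi n q i) (r * cartan n i j)) * gx e j (r + s)
      \<in> uq_rels n q"
| x_x: "i \<in> {1..n} \<Longrightarrow> j \<in> {1..n} \<Longrightarrow>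
    (gx e i (r + 1) * gx e j s
       - sc (qi n q i powi (sg e * cartan n i j)) * gx e j s * gx e i (r + 1))
    - (sc (qi n q i powi (sg e * cartan n i j)) * gx e i r * gx e j (s + 1)
       - gx e j (s + 1) * gx e i r)
      \<in> uq_rels n q"
| x_plus_x_minus: "i \<in> {1..n} \<Longrightarrow> j \<in> {1..n} \<Longrightarrow>
    gx Plus i r * gx Minus j s - gx Minus j s * gx Plus i r
      - (if i = j
         then sc (1 / (qi n q i - inverse (qi n q i)))
                * (psi n q Plus i (r + s) - psi n q Minus i (r + s))
         else 0)
      \<in> uq_rels n q"
| serre: "i \<in> {1..n} \<Longrightarrow> j \<in> {1..n} \<Longrightarrow> i \<noteq> j \<Longrightarrow> int m = 1 - cartan n i j \<Longrightarrow>
    (\<Sum>p | p permutes {1..m}. \<Sum>k = 0..m.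
       sc ((- 1) ^ k * qbinom (qi n q i) m k)
         * prod_list (map (\<lambda>t. gx e i (r (p t))) [1..<k + 1])
         * gx e j s
         * prod_list (map (\<lambda>t. gx e i (r (p t))) [k + 1..<m + 1]))
      \<in> uq_rels n q"

lemma uq_rels_carrier: "uq_rels n q \<subseteq> carrier (free_alg n)"
proof
  fix f assume "f \<in> uq_rels n q"
  then show "f \<in> carrier (free_alg n)"
    by cases (auto intro!: free_alg_diff free_alg_mult free_alg_sum free_alg_prod_list
        free_alg_gens free_alg_psi)
qed

text \<open>\<^const>\<open>genideal\<close> is the two-sided ideal generated by a subset of the carrier.\<close>

definition uq_ideal :: "nat \<Rightarrow> complex \<Rightarrow> uq_free set" where
  "uq_ideal n q = genideal (free_alg n) (uq_rels n q)"

definition Uq :: "nat \<Rightarrow> complex \<Rightarrow> uq_free set ring" where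
  "Uq n q = FactRing (free_alg n) (uq_ideal n q)"

lemma ideal_uq_ideal: "ideal (uq_ideal n q) (free_alg n)"
  unfolding uq_ideal_def by (rule ring.genideal_ideal[OF ring_free_alg uq_rels_carrier])

lemma ring_Uq: "ring (Uq n q)"
  unfolding Uq_def by (rule ideal.quotient_is_ring[OF ideal_uq_ideal])

definition cls :: "nat \<Rightarrow> complex \<Rightarrow> uq_free \<Rightarrow> uq_free set" where
  "cls n q a = a_r_coset (free_alg n) (uq_ideal n q) a"


section \<open>The \<open>\<ell>\<close>-weight lattice\<close>

text \<open>
  An \<open>n\<close>-tuple of rational functions is a function on \<^typ>\<open>nat\<close> which takes the value \<open>1\<close>
  outside \<open>{1..n}\<close>.  For \<open>i = 0\<close> one gets the trivial tuple.
\<close>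

type_synonym ratfun = "complex poly fract"

definition ell_fund :: "nat \<Rightarrow> complex \<Rightarrow> nat \<Rightarrow> ratfun" where
  "ell_fund i a = (\<lambda>k. if k = i \<and> i \<noteq> 0 then Fraction_Field.Fract [:1, - a:] 1 else 1)"

inductive_set ell_lattice :: "nat \<Rightarrow> (nat \<Rightarrow> ratfun) set" for n :: nat where
  one: "(\<lambda>_. 1) \<in> ell_lattice n"
| fund: "i \<in> {1..n} \<Longrightarrow> a \<noteq> 0 \<Longrightarrow> ell_fund i a \<in> ell_lattice n"
| mult: "f \<in> ell_lattice n \<Longrightarrow> g \<in> ell_lattice n \<Longrightarrow> (\<lambda>k. f k * g k) \<in> ell_lattice n"
| inv: "f \<in> ell_lattice n \<Longrightarrow> (\<lambda>k. inverse (f k)) \<in> ell_lattice n"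

text \<open>The power series expansion at \<open>u = 0\<close> of a rational function without pole there.\<close>

definition ratfun_series :: "ratfun \<Rightarrow> complex fps" where
  "ratfun_series f =
     (THE F. \<exists>a b. b \<noteq> 0 \<and> f = Fraction_Field.Fract a b \<and> F * fps_of_poly b = fps_of_poly a)"

lemma ratfun_series_Fract:
  assumes "coeff b 0 \<noteq> 0"
  shows "ratfun_series (Fraction_Field.Fract a b) = fps_of_poly a / fps_of_poly b"
proof -
  have b: "b \<noteq> 0" using assms by auto
  have unit: "fps_nth (fps_of_poly b) 0 \<noteq> 0" using assms by simp
  have eq: "(fps_of_poly a / fps_of_poly b) * fps_of_poly b = fps_of_poly a"
    using unit by (intro dvd_div_mult_self) (simp add: fps_is_unit_iff unit_imp_dvd)
  show ?thesis unfolding ratfun_series_def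
  proof (rule the_equality)
    show "\<exists>c d. d \<noteq> 0 \<and> Fraction_Field.Fract a b = Fraction_Field.Fract c d \<and>
        fps_of_poly a / fps_of_poly b * fps_of_poly d = fps_of_poly c"
      using b eq by blast
  next
    fix F assume "\<exists>c d. d \<noteq> 0 \<and> Fraction_Field.Fract a b = Fraction_Field.Fract c d \<and>
        F * fps_of_poly d = fps_of_poly c"
    then obtain c d where d: "d \<noteq> 0" and "Fraction_Field.Fract a b = Fraction_Field.Fract c d"
      and F: "F * fps_of_poly d = fps_of_poly c" by blast
    then have "a * d = c * b" using b by (simp add: eq_fract)
    then have "fps_of_poly a * fps_of_poly d = fps_of_poly c * fps_of_poly b"
      by (metis fps_of_poly_mult)
    then have "fps_of_poly a * fps_of_poly d = (F * fps_of_poly b) * fps_of_poly d"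
      by (simp add: F [symmetric] ac_simps)
    then have "F * fps_of_poly b = fps_of_poly a" using d by simp
    then have "F * fps_of_poly b = (fps_of_poly a / fps_of_poly b) * fps_of_poly b"
      by (simp only: eq)
    then show "F = fps_of_poly a / fps_of_poly b" using b by simp
  qed
qed

text \<open>
  \<open>ratfun_reflect f\<close> is \<open>u\<^bsup>deg f\<^esup> f(u\<^sup>-\<^sup>1)\<close>; recall that \<^term>\<open>reflect_poly a\<close> is
  \<open>u\<^bsup>deg a\<^esup> a(u\<^sup>-\<^sup>1)\<close> for \<open>a \<noteq> 0\<close>.
\<close>

definition ratfun_reflect :: "ratfun \<Rightarrow> ratfun" where
  "ratfun_reflect f =
     (THE g. \<exists>a b. b \<noteq> 0 \<and> f = Fraction_Field.Fract a b \<and>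
        g = Fraction_Field.Fract (reflect_poly a) (reflect_poly b))"

lemma ratfun_reflect_Fract:
  assumes "b \<noteq> 0"
  shows "ratfun_reflect (Fraction_Field.Fract a b) = Fraction_Field.Fract (reflect_poly a) (reflect_poly b)"
  unfolding ratfun_reflect_def
proof (rule the_equality)
  show "\<exists>c d. d \<noteq> 0 \<and> Fraction_Field.Fract a b = Fraction_Field.Fract c d \<and>
      Fraction_Field.Fract (reflect_poly a) (reflect_poly b) = Fraction_Field.Fract (reflect_poly c) (reflect_poly d)"
    using assms by blast
next
  fix g assume "\<exists>c d. d \<noteq> 0 \<and> Fraction_Field.Fract a b = Fraction_Field.Fract c d \<and>
        g = Fraction_Field.Fract (reflect_poly c) (reflect_poly d)"
  then obtain c d where d: "d \<noteq> 0" and "Fraction_Field.Fract a b = Fraction_Field.Fract c d"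
    and g: "g = Fraction_Field.Fract (reflect_poly c) (reflect_poly d)" by blast
  then have "a * d = c * b" using assms by (simp add: eq_fract)
  then have "reflect_poly a * reflect_poly d = reflect_poly c * reflect_poly b"
    by (metis reflect_poly_mult)
  then show "g = Fraction_Field.Fract (reflect_poly a) (reflect_poly b)"
    using assms d by (simp add: g eq_fract)
qed

text \<open>\<open>ell_coeff e f r\<close> is the coefficient of \<open>u\<^sup>r\<close> in \<open>f\<^sup>+\<close> or \<open>f\<^sup>-\<close>.\<close>

fun ell_coeff :: "sign \<Rightarrow> ratfun \<Rightarrow> nat \<Rightarrow> complex" where
  "ell_coeff Plus f r = fps_nth (ratfun_series f) r"
| "ell_coeff Minus f r =
     fps_nth (ratfun_series (ratfun_reflect f)) r / fps_nth (ratfun_series (ratfun_reflect f)) 0"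


section \<open>Modules\<close>

definition uq_module ::
  "nat \<Rightarrow> complex \<Rightarrow> (complex \<Rightarrow> 'v \<Rightarrow> 'v) \<Rightarrow> (uq_free set \<Rightarrow> 'v \<Rightarrow> 'v::ab_group_add) \<Rightarrow> bool" where
  "uq_module n q scale act \<longleftrightarrow>
     vector_space scale \<and>
     (\<forall>a \<in> carrier (Uq n q). Vector_Spaces.linear scale scale (act a)) \<and>
     (\<forall>a \<in> carrier (Uq n q). \<forall>b \<in> carrier (Uq n q). \<forall>v.
        act (a \<oplus>\<^bsub>Uq n q\<^esub> b) v = act a v + act b v \<and>
        act (a \<otimes>\<^bsub>Uq n q\<^esub> b) v = act a (act b v)) \<and>
     (\<forall>c v. act (cls n q (sc c)) v = scale c v)"

text \<open>Weights are given by their coordinates with respect to the fundamental weights.\<close>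

definition weight_lattice :: "nat \<Rightarrow> (nat \<Rightarrow> int) set" where
  "weight_lattice n = {\<mu>. \<forall>i. i \<notin> {1..n} \<longrightarrow> \<mu> i = 0}"

definition fund_weight :: "nat \<Rightarrow> nat \<Rightarrow> int" where
  "fund_weight r = (\<lambda>i. if i = r \<and> r \<noteq> 0 then 1 else 0)"

definition weight_space ::
  "nat \<Rightarrow> complex \<Rightarrow> (complex \<Rightarrow> 'v \<Rightarrow> 'v) \<Rightarrow> (uq_free set \<Rightarrow> 'v \<Rightarrow> 'v) \<Rightarrow> (nat \<Rightarrow> int) \<Rightarrow> 'v set" where
  "weight_space n q scale act \<mu> =
     {v. \<forall>i \<in> {1..n}. act (cls n q (gK Plus i)) v = scale (qi n q i powi \<mu> i) v}"

text \<open>Type 1: the module is the direct sum of its weight spaces.\<close>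

definition type_one ::
  "nat \<Rightarrow> complex \<Rightarrow> (complex \<Rightarrow> 'v \<Rightarrow> 'v) \<Rightarrow> (uq_free set \<Rightarrow> 'v \<Rightarrow> 'v::ab_group_add) \<Rightarrow> bool" where
  "type_one n q scale act \<longleftrightarrow>
     (\<forall>v. \<exists>!c. finite {\<mu>. c \<mu> \<noteq> 0} \<and> {\<mu>. c \<mu> \<noteq> 0} \<subseteq> weight_lattice n \<and>
        (\<forall>\<mu>. c \<mu> \<in> weight_space n q scale act \<mu>) \<and> v = (\<Sum>\<mu> | c \<mu> \<noteq> 0. c \<mu>))"

definition fin_dim :: "(complex \<Rightarrow> 'v \<Rightarrow> 'v::ab_group_add) \<Rightarrow> bool" where
  "fin_dim scale \<longleftrightarrow> (\<exists>B. finite_dimensional_vector_space scale B)"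

definition uq_irreducible ::
  "nat \<Rightarrow> complex \<Rightarrow> (complex \<Rightarrow> 'v \<Rightarrow> 'v) \<Rightarrow> (uq_free set \<Rightarrow> 'v \<Rightarrow> 'v::ab_group_add) \<Rightarrow> bool" where
  "uq_irreducible n q scale act \<longleftrightarrow>
     (UNIV :: 'v set) \<noteq> {0} \<and>
     (\<forall>W. module.subspace scale W \<and> (\<forall>a \<in> carrier (Uq n q). \<forall>w \<in> W. act a w \<in> W)
        \<longrightarrow> W = {0} \<or> W = UNIV)"

definition ell_weight_space ::
  "nat \<Rightarrow> complex \<Rightarrow> (complex \<Rightarrow> 'v \<Rightarrow> 'v) \<Rightarrow> (uq_free set \<Rightarrow> 'v \<Rightarrow> 'v::ab_group_add) \<Rightarrow>
     (nat \<Rightarrow> ratfun) \<Rightarrow> 'v set" where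
  "ell_weight_space n q scale act \<omega> =
     {v. \<forall>i \<in> {1..n}. \<forall>r e. \<exists>N.
        ((\<lambda>w. act (cls n q (P_elt n q e i r)) w - scale (ell_coeff e (\<omega> i) r) w) ^^ N) v = 0}"

definition wt_ell ::
  "nat \<Rightarrow> complex \<Rightarrow> (complex \<Rightarrow> 'v \<Rightarrow> 'v) \<Rightarrow> (uq_free set \<Rightarrow> 'v \<Rightarrow> 'v::ab_group_add) \<Rightarrow>
     'v set \<Rightarrow> (nat \<Rightarrow> ratfun) set" where
  "wt_ell n q scale act W =
     {\<omega> \<in> ell_lattice n. ell_weight_space n q scale act \<omega> \<inter> W \<noteq> {0}}"

text \<open>\<open>is_fund_module n q i a scale act\<close>: the module is (a copy of) \<open>V(\<omega>\<^sub>i\<^sub>,\<^sub>a)\<close>.\<close>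

definition is_fund_module ::
  "nat \<Rightarrow> complex \<Rightarrow> nat \<Rightarrow> complex \<Rightarrow> (complex \<Rightarrow> 'v \<Rightarrow> 'v) \<Rightarrow>
     (uq_free set \<Rightarrow> 'v \<Rightarrow> 'v::ab_group_add) \<Rightarrow> bool" where
  "is_fund_module n q i a scale act \<longleftrightarrow>
     uq_module n q scale act \<and> fin_dim scale \<and> type_one n q scale act \<and>
     uq_irreducible n q scale act \<and>
     (\<exists>v. v \<noteq> 0 \<and>
        {act b v | b. b \<in> carrier (Uq n q)} = UNIV \<and>
        (\<forall>j \<in> {1..n}.
           (\<forall>r. act (cls n q (gx Plus j r)) v = 0) \<and>
           (\<forall>e k. act (cls n q (P_elt n q e j k)) v = scale (ell_coeff e (ell_fund i a j) k) v) \<and>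
           act (cls n q (gK Plus j)) v = scale (qi n q j powi (if j = i then 1 else 0)) v))"


section \<open>The index set and the \<open>\<ell>\<close>-weights\<close>

definition MM :: "nat \<Rightarrow> nat \<Rightarrow> nat" where
  "MM i r = (i - r) div 2"

text \<open>A sequence is a list; its entry \<open>j\<^sub>s\<close>, for \<open>1 \<le> s \<le> M\<close>, is \<^term>\<open>js ! (s - 1)\<close>.\<close>

definition J_set :: "nat \<Rightarrow> nat \<Rightarrow> nat \<Rightarrow> nat list set" where
  "J_set n i r =
     {js. length js = MM i r \<and> sorted_wrt (<) (r # js) \<and> (\<forall>j \<in> set js. j \<le> n) \<and>
        (\<forall>s \<in> {1..MM i r}. int (js ! (s - 1)) \<le> int n - int i + int r + 2 * int s - 1)}"

definition pi_step :: "nat \<Rightarrow> complex \<Rightarrow> nat \<Rightarrow> nat \<Rightarrow> nat \<Rightarrow> nat \<Rightarrow> nat \<Rightarrow> ratfun" where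
  "pi_step n q i r j s = (\<lambda>k.
     inverse (ell_fund j (q powi (int i + int j - 2 * int s - 2 * int r)) k) *
     ell_fund j (q powi (2 * int n + 2 - int i - int j + 2 * int s)) k)"

definition pi_ell :: "nat \<Rightarrow> complex \<Rightarrow> nat \<Rightarrow> nat \<Rightarrow> nat list \<Rightarrow> nat \<Rightarrow> ratfun" where
  "pi_ell n q i r js = (\<lambda>k.
     ell_fund r (q powi (int i - int r)) k *
     (\<Prod>s = 1..MM i r.
        pi_step n q i r (js ! (s - 1) - 1) (s - 1) k *
        inverse (pi_step n q i r (js ! (s - 1)) s k)))"

end

theory Submission
  imports Defs
begin

text \<open>
  An irreducible module has no vector below its highest weight that is killed by all \<open>x\<^sup>+\<^sub>j\<^sub>,\<^sub>r\<close>.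
  Hence two vectors of equal lower weight coincide as soon as all \<open>x\<^sup>+\<^sub>j\<^sub>,\<^sub>r\<close> agree on them, and a
  combinatorial model of the module can be transported into \<open>V\<close> by induction on the depth: one only
  has to know that the model satisfies the relations between \<open>K\<close>, \<open>h\<close> and \<open>x\<^sup>\<plusminus>\<close> and those between
  \<open>x\<^sup>+\<close> and \<open>x\<^sup>-\<close>.  The Serre relations never enter.

  For \<open>V(\<omega>\<^sub>i\<^sub>,\<^sub>1)\<close> in type \<open>C\<^sub>n\<close> the model has one basis vector for each admissible column of
  height \<open>i\<close>.  The operators \<open>x\<^sup>\<plusminus>\<^sub>j\<^sub>,\<^sub>r\<close> change one letter, with a coefficient that is \<open>1\<close> or a
  ratio of quantum integers read off from the number of large letters in the column; the
  relation between \<open>x\<^sup>+\<close> and \<open>x\<^sup>-\<close> becomes the partial fraction expansion of the eigenvalue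
  of \<open>\<psi>\<close>.  Different columns have different \<open>\<ell>\<close>-weights, so all \<open>\<ell>\<close>-weight spaces are lines,
  and the columns of weight \<open>\<omega>\<^sub>r\<close> are exactly those given by \<open>\<^bold>J\<^sub>r\<close>.
\<close>

section \<open>Operators of a module over the quantum loop algebra\<close>

text \<open>The coefficients come from the gap between two poles. At a node \<open>j < n\<close> the
  eigenvalue of \<psi> on a column has two factors, one for the letters \<open>j\<close>,
  \<open>j + 1\<close> and one for their negatives, and the exponents of their poles differ by
  \<open>2 * (excess T j + 1) + exp2 j T - exp1 j T\<close>. The residue at one pole involves the
  other factor evaluated there, a ratio of quantum integers in the excess, and this ratio vanishes
  where a move would leave the admissible columns. The two poles never coincide. Hence a combination
  of the modes 0 and 1 of \<open>X\<close> isolates a single move; this yields the vectors one step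
  deeper and shows that no vector of the model becomes 0. A deeper vector is built from an
  arbitrarily chosen parent, and no independence of the choice has to be proved, since the action of
  the raising operators already determines it. Parameters are those of a variable Y_y whose series
  of \<open>P_elt\<close> for \<open>Plus\<close> is 1 - q y u, so \<open>spec1\<close> and
  \<open>spec2\<close> are one less than the exponents occurring in \<open>ell_fund\<close>.\<close>

lemma cls_ring_hom: "cls n q \<in> ring_hom (free_alg n) (Uq n q)"
  using ideal.rcos_ring_hom[OF ideal_uq_ideal, of n q] by (simp add: Uq_def cls_def[abs_def])

lemma carrier_Uq: "carrier (Uq n q) = cls n q ` carrier (free_alg n)"
  by (auto simp: Uq_def FactRing_def cls_def A_RCOSETS_def')

lemma cls_eq_if_diff_in_ideal:
  assumes "f \<in> carrier (free_alg n)" "g \<in> carrier (free_alg n)" "f - g \<in> uq_ideal n q"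
  shows "cls n q f = cls n q g"
proof -
  interpret R: ring "free_alg n" by (rule ring_free_alg)
  have "\<ominus>\<^bsub>free_alg n\<^esub> g = - g"
    using assms(2) by (intro R.minus_equality) (auto intro: free_alg_uminus)
  then have "f \<ominus>\<^bsub>free_alg n\<^esub> g = f - g"
    using assms(1,2) by (simp add: R.minus_eq)
  then show ?thesis
    using R.quotient_eq_iff_same_a_r_cos[OF ideal_uq_ideal assms(1,2), of q] assms(3)
    by (simp add: cls_def)
qed

lemma single_word_eq: "Poly_Mapping.single (Word l) c = sc c * prod_list (map gen l)"
proof (induction l)
  case Nil
  then show ?case by (simp add: sc_def zero_uq_word_def)
next
  case (Cons g l)
  have "Poly_Mapping.single (Word (g # l)) c = gen g * Poly_Mapping.single (Word l) c"
    by (simp add: gen_def mult_single plus_uq_word_def)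
  also have "\<dots> = gen g * sc c * prod_list (map gen l)"
    by (simp add: Cons mult.assoc)
  also have "gen g * sc c = sc c * gen g"
    by (simp add: gen_def sc_def mult_single)
  finally show ?case by (simp add: mult.assoc)
qed

text \<open>A finitely supported function is built by adding one word at a time, and a word with its
  coefficient is a scalar times generators.\<close>

lemma free_alg_induct [consumes 1, case_names scalar generator plus times]:
  assumes "f \<in> carrier (free_alg n)"
    and sc: "\<And>c. P (sc c)"
    and gen: "\<And>g. g \<in> uq_gens n \<Longrightarrow> P (gen g)"
    and add: "\<And>f g. f \<in> carrier (free_alg n) \<Longrightarrow> g \<in> carrier (free_alg n) \<Longrightarrow> P f \<Longrightarrow> P g \<Longrightarrow> P (f + g)"
    and mul: "\<And>f g. f \<in> carrier (free_alg n) \<Longrightarrow> g \<in> carrier (free_alg n) \<Longrightarrow> P f \<Longrightarrow> P g \<Longrightarrow> P (f * g)"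
  shows "P f"
  using assms(1)
proof (induction f rule: update_induct)
  case const
  then show ?case using sc[of 0] by (simp add: sc_def)
next
  case (update f w c)
  have keys: "Poly_Mapping.keys (Poly_Mapping.update w c f) = insert w (Poly_Mapping.keys f)"
    using update.hyps by (auto simp: keys_update)
  have eq: "Poly_Mapping.update w c f = Poly_Mapping.single w c + f"
    using update.hyps
    by (intro poly_mapping_eqI) (auto simp: lookup_update lookup_add lookup_single when_def in_keys_iff)
  obtain l where w: "w = Word l" by (cases w)
  have f: "f \<in> carrier (free_alg n)" and l: "set l \<subseteq> uq_gens n"
    using update.prems keys by (auto simp: carrier_free_alg w)
  have prodl: "prod_list (map gen l) \<in> carrier (free_alg n) \<and> P (prod_list (map gen l))" using l
  proof (induction l)
    case Nil
    then show ?case using sc[of 1] by (auto simp: sc_def)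
  next
    case (Cons g l)
    then show ?case by (auto intro!: mul gen free_alg_gen free_alg_mult)
  qed
  have "P (Poly_Mapping.single w c)"
    unfolding w single_word_eq using prodl by (auto intro!: mul sc)
  moreover have "Poly_Mapping.single w c \<in> carrier (free_alg n)"
    using l by (simp add: carrier_free_alg w)
  ultimately show ?case
    unfolding eq using update.IH f by (intro add) auto
qed

locale uq_rep =
  fixes n :: nat and q :: complex
    and scale :: "complex \<Rightarrow> 'v::ab_group_add \<Rightarrow> 'v"
    and act :: "uq_free set \<Rightarrow> 'v \<Rightarrow> 'v"
  assumes uq_module: "uq_module n q scale act"
    and q_nonzero: "q \<noteq> 0"
    and q_not_root: "\<And>m::nat. 0 < m \<Longrightarrow> q ^ m \<noteq> 1"
begin

sublocale vs: vector_space scale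
  using uq_module by (simp add: uq_module_def)

definition opr :: "uq_free \<Rightarrow> 'v \<Rightarrow> 'v" where
  "opr f = act (cls n q f)"

lemma cls_carrier: "f \<in> carrier (free_alg n) \<Longrightarrow> cls n q f \<in> carrier (Uq n q)"
  by (simp add: carrier_Uq)

lemma opr_linear: "f \<in> carrier (free_alg n) \<Longrightarrow> Vector_Spaces.linear scale scale (opr f)"
  using uq_module cls_carrier by (auto simp: uq_module_def opr_def)

lemma opr_sc [simp]: "opr (sc c) v = scale c v"
  using uq_module by (auto simp: uq_module_def opr_def)

lemma opr_0 [simp]: "opr 0 v = 0"
  using opr_sc[of 0 v] by (simp add: sc_def)

lemma opr_1 [simp]: "opr 1 v = v"
  using opr_sc[of 1 v] by (simp add: sc_def)

lemma opr_add:
  "f \<in> carrier (free_alg n) \<Longrightarrow> g \<in> carrier (free_alg n) \<Longrightarrow> opr (f + g) v = opr f v + opr g v"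
  using uq_module cls_carrier ring_hom_add[OF cls_ring_hom, of f n g q]
  by (auto simp: uq_module_def opr_def)

lemma opr_mult:
  "f \<in> carrier (free_alg n) \<Longrightarrow> g \<in> carrier (free_alg n) \<Longrightarrow> opr (f * g) v = opr f (opr g v)"
  using uq_module cls_carrier ring_hom_mult[OF cls_ring_hom, of f n g q]
  by (auto simp: uq_module_def opr_def)

lemma opr_uminus: "f \<in> carrier (free_alg n) \<Longrightarrow> opr (- f) v = - opr f v"
  using opr_add[of f "- f" v] by (auto simp: add_eq_0_iff)

lemma opr_diff:
  "f \<in> carrier (free_alg n) \<Longrightarrow> g \<in> carrier (free_alg n) \<Longrightarrow> opr (f - g) v = opr f v - opr g v"
  using opr_add[of f "- g" v] opr_uminus[of g v] by auto

lemma opr_sum: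
  "(\<And>x. x \<in> A \<Longrightarrow> f x \<in> carrier (free_alg n)) \<Longrightarrow> opr (sum f A) v = (\<Sum>x\<in>A. opr (f x) v)"
proof (induction A rule: infinite_finite_induct)
  case (insert x A)
  have "sum f A \<in> carrier (free_alg n)" using insert.prems by (intro free_alg_sum) auto
  then show ?case using insert by (simp add: opr_add)
qed auto

lemma opr_rel:
  assumes "f \<in> uq_rels n q" shows "opr f v = 0"
proof -
  have "f \<in> carrier (free_alg n)" using assms uq_rels_carrier by blast
  moreover have "f \<in> uq_ideal n q"
    unfolding uq_ideal_def using ring.genideal_self[OF ring_free_alg uq_rels_carrier] assms by blast
  ultimately have "cls n q f = cls n q 0" by (intro cls_eq_if_diff_in_ideal) auto
  then have "opr f v = opr 0 v" by (simp add: opr_def)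
  then show ?thesis by simp
qed

lemma opr_linear_simps:
  assumes "f \<in> carrier (free_alg n)"
  shows "opr f (v + w) = opr f v + opr f w" "opr f (v - w) = opr f v - opr f w"
    "opr f (scale c v) = scale c (opr f v)" "opr f 0 = 0" "opr f (sum h A) = (\<Sum>x\<in>A. opr f (h x))"
proof -
  interpret l: Vector_Spaces.linear scale scale "opr f" by (rule opr_linear[OF assms])
  show "opr f (v + w) = opr f v + opr f w" "opr f (v - w) = opr f v - opr f w"
    "opr f (scale c v) = scale c (opr f v)" "opr f 0 = 0" "opr f (sum h A) = (\<Sum>x\<in>A. opr f (h x))"
    by (rule l.add l.diff l.scale l.zero l.sum)+
qed

abbreviation X :: "sign \<Rightarrow> nat \<Rightarrow> int \<Rightarrow> 'v \<Rightarrow> 'v" where "X e j r \<equiv> opr (gx e j r)"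
abbreviation K :: "sign \<Rightarrow> nat \<Rightarrow> 'v \<Rightarrow> 'v" where "K e j \<equiv> opr (gK e j)"
abbreviation H :: "nat \<Rightarrow> int \<Rightarrow> 'v \<Rightarrow> 'v" where "H j m \<equiv> opr (gh j m)"

lemmas X_linear = opr_linear_simps[OF free_alg_gens(1)]
lemmas K_linear = opr_linear_simps[OF free_alg_gens(2)]
lemmas H_linear = opr_linear_simps[OF free_alg_gens(3)]

text \<open>Irreducibility speaks of all of \<open>Uq n q\<close>; this reduces invariance of a
  subspace to a check on generators.\<close>

lemma invariant_if_generators:
  assumes W: "vs.subspace W" and gen: "\<And>g w. g \<in> uq_gens n \<Longrightarrow> w \<in> W \<Longrightarrow> opr (gen g) w \<in> W"
    and a: "a \<in> carrier (Uq n q)" and w: "w \<in> W"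
  shows "act a w \<in> W"
proof -
  obtain f where f: "f \<in> carrier (free_alg n)" "a = cls n q f" using a by (auto simp: carrier_Uq)
  have "\<forall>w\<in>W. opr f w \<in> W" using f(1)
    by (induction rule: free_alg_induct)
      (auto simp: opr_add opr_mult gen vs.subspace_add[OF W] vs.subspace_scale[OF W])
  then show ?thesis using f(2) w by (simp add: opr_def)
qed

lemma K_cancel:
  assumes "i \<in> {1..n}"
  shows "K Plus i (K Minus i v) = v" "K Minus i (K Plus i v) = v"
  using opr_rel[where v = v, OF uq_rels.K_right_inv[OF assms]] opr_rel[where v = v, OF uq_rels.K_left_inv[OF assms]] assms
  by (auto simp: opr_diff opr_mult free_alg_gens free_alg_mult free_alg_1)

lemma K_X:
  assumes "i \<in> {1..n}" "j \<in> {1..n}"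
  shows "K Plus i (X e j r v) = scale (qi n q i powi (sg e * cartan n i j)) (X e j r (K Plus i v))"
  using opr_rel[where v = "K Plus i v", OF uq_rels.K_x[OF assms, of e r]] assms
  by (simp add: opr_diff opr_mult free_alg_gens free_alg_mult free_alg_sc K_cancel)

lemma K_H:
  assumes "i \<in> {1..n}" "j \<in> {1..n}" "m \<noteq> 0"
  shows "K Plus i (H j m v) = H j m (K Plus i v)"
  using opr_rel[where v = v, OF uq_rels.K_h[OF assms]] assms
  by (simp add: opr_diff opr_mult free_alg_gens free_alg_mult)

lemma H_X:
  assumes "i \<in> {1..n}" "j \<in> {1..n}" "m \<noteq> 0"
  shows "H i m (X e j s v) = X e j s (H i m v)
     + scale (of_int (sg e) * (1 / of_int m) * qint (qi n q i) (m * cartan n i j)) (X e j (m + s) v)"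
  using opr_rel[where v = v, OF uq_rels.h_x[OF assms, of e s]] assms
  by (simp add: opr_diff opr_mult free_alg_gens free_alg_mult free_alg_sc free_alg_diff diff_eq_eq add.commute)

lemma X_X:
  assumes "i \<in> {1..n}" "j \<in> {1..n}"
  shows "X Plus i r (X Minus j s v) = X Minus j s (X Plus i r v)
    + (if i = j then scale (1 / (qi n q i - inverse (qi n q i)))
        (opr (psi n q Plus i (r + s)) v - opr (psi n q Minus i (r + s)) v) else 0)"
proof (cases "i = j")
  case True
  then show ?thesis
    using opr_rel[where v = v, OF uq_rels.x_plus_x_minus[OF assms, of r s]] assms
    by (simp add: opr_diff opr_mult free_alg_gens free_alg_mult free_alg_sc free_alg_diff free_alg_psi
        diff_eq_eq add.commute del: One_nat_def)
next
  case False
  then show ?thesis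
    using opr_rel[where v = v, OF uq_rels.x_plus_x_minus[OF assms, of r s]] assms
    by (simp add: opr_diff opr_mult free_alg_gens free_alg_mult)
qed

end

section \<open>Exponentials of power series\<close>

text \<open>The scalar counterpart of \<open>exp_series\<close>, for the eigenvalues of an
  exponential of operators.\<close>

definition expo :: "complex fps \<Rightarrow> complex fps" where
  "expo f = fps_compose (Abs_fps (\<lambda>m. 1 / fact m)) f"

lemma expo_nth_0 [simp]: "fps_nth (expo f) 0 = 1"
  by (simp add: expo_def)

lemma fps_deriv_expo:
  assumes "fps_nth f 0 = 0"
  shows "fps_deriv (expo f) = fps_deriv f * expo f"
proof -
  have "fps_deriv (Abs_fps (\<lambda>m. 1 / fact m)) = (Abs_fps (\<lambda>m. 1 / fact m) :: complex fps)"
    by (rule fps_ext) (simp add: divide_simps fact_reduce del: of_nat_Suc)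
  then show ?thesis
    unfolding expo_def by (subst fps_compose_deriv[OF assms]) (simp add: mult.commute)
qed

text \<open>In characteristic 0 the equation F' = D F determines each coefficient from the earlier
  ones. Identities between exponentials are thereby reduced to comparing derivatives.\<close>

lemma fps_eq_if_same_log_deriv:
  fixes F G :: "complex fps"
  assumes "fps_nth F 0 = fps_nth G 0" "fps_deriv F = D * F" "fps_deriv G = D * G"
  shows "F = G"
proof (rule fps_ext)
  fix k show "fps_nth F k = fps_nth G k"
  proof (induction k rule: less_induct)
    case (less k)
    show ?case
    proof (cases k)
      case 0
      then show ?thesis using assms(1) by simp
    next
      case (Suc m)
      have "fps_nth (fps_deriv F) m = fps_nth (fps_deriv G) m"
        unfolding assms(2,3) fps_mult_nth using less Suc by (intro sum.cong) auto
      then show ?thesis using Suc by (simp del: of_nat_Suc)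
    qed
  qed
qed

lemma expo_unique:
  assumes "fps_nth f 0 = 0" "fps_nth G 0 = 1" "fps_deriv G = fps_deriv f * G"
  shows "expo f = G"
  by (rule fps_eq_if_same_log_deriv[where D = "fps_deriv f"])
    (use assms fps_deriv_expo[OF assms(1)] in simp_all)

lemma expo_add:
  assumes "fps_nth f 0 = 0" "fps_nth g 0 = 0"
  shows "expo (f + g) = expo f * expo g"
  by (rule expo_unique) (use assms in \<open>simp_all add: fps_deriv_expo distrib_right distrib_left mult_ac add_ac\<close>)

lemma expo_0 [simp]: "expo 0 = 1"
  by (rule expo_unique) simp_all

lemma expo_uminus:
  assumes "fps_nth f 0 = 0"
  shows "expo (- f) = inverse (expo f)"
proof -
  have "expo (- f) * expo f = 1"
    using expo_add[of "- f" f] assms by simp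
  then show ?thesis by (metis fps_inverse_unique mult.commute)
qed

definition lin :: "complex \<Rightarrow> complex fps" where
  "lin z = 1 - fps_const z * fps_X"

text \<open>This is the series -log (1 - z u).\<close>

definition logs :: "complex \<Rightarrow> complex fps" where
  "logs z = Abs_fps (\<lambda>k. if k = 0 then 0 else z ^ k / of_nat k)"

lemma lin_nth: "fps_nth (lin z) k = (if k = 0 then 1 else if k = 1 then - z else 0)"
  by (auto simp: lin_def)

lemma logs_nth_0 [simp]: "fps_nth (logs z) 0 = 0"
  by (simp add: logs_def)

lemma fps_mult_lin_nth: "fps_nth (F * lin z) k = fps_nth F k - (if k = 0 then 0 else z * fps_nth F (k - 1))"
proof -
  have "F * lin z = F - fps_const z * (fps_X * F)" by (simp add: lin_def algebra_simps)
  then show ?thesis by simp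
qed

lemma expo_uminus_logs: "expo (- logs z) = lin z"
proof (rule expo_unique)
  show "fps_deriv (lin z) = fps_deriv (- logs z) * lin z"
  proof (rule fps_ext)
    fix k show "fps_nth (fps_deriv (lin z)) k = fps_nth (fps_deriv (- logs z) * lin z) k"
      by (cases k) (auto simp: fps_mult_lin_nth logs_def lin_nth simp del: of_nat_Suc)
  qed
qed (auto simp: lin_nth)

text \<open>Only exponents \<open>e \<in> {-1, 0, 1}\<close> are meaningful; the value for other \<open>e\<close> is junk.\<close>

definition signed_power :: "int \<Rightarrow> 'a::{inverse,one} \<Rightarrow> 'a" where
  "signed_power e x = (if e = 1 then x else if e = - 1 then inverse x else 1)"

lemma fps_const_minus_one: "fps_const (- 1 :: complex) = - 1"
  by (metis fps_const_1_eq_1 fps_const_neg)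

lemma expo_signed:
  assumes "e \<in> {-1, 0, 1}" "fps_nth f 0 = 0"
  shows "expo (fps_const (of_int e) * f) = signed_power e (expo f)"
proof -
  consider "e = -1" | "e = 0" | "e = 1" using assms by auto
  then show ?thesis
  proof cases
    case 1
    then have "fps_const (of_int e) * f = - f" by (simp add: fps_const_minus_one)
    then show ?thesis using 1 assms by (simp add: signed_power_def expo_uminus)
  qed (auto simp: signed_power_def)
qed

text \<open>The power series of \<open>(Q\<^sup>e - Q\<^sup>-\<^sup>e p u) / (1 - p u)\<close>.\<close>

definition psi_factor :: "complex \<Rightarrow> int \<Rightarrow> complex \<Rightarrow> complex fps" where
  "psi_factor Q e p = Abs_fps (\<lambda>k. if k = 0 then Q powi e else (Q powi e - Q powi (- e)) * p ^ k)"

lemma psi_factor_mult_lin: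
  "psi_factor Q e p * lin p = fps_const (Q powi e) - fps_const (Q powi (- e) * p) * fps_X"
proof (rule fps_ext)
  fix k show "fps_nth (psi_factor Q e p * lin p) k = fps_nth (fps_const (Q powi e) - fps_const (Q powi (- e) * p) * fps_X) k"
    unfolding fps_mult_lin_nth
    by (cases k; cases "k - 1") (auto simp: psi_factor_def algebra_simps)
qed

lemma lin_nonzero [simp]: "lin z \<noteq> 0"
  using lin_nth[of z 0] by (metis fps_zero_nth zero_neq_one)

lemma expo_logs: "expo (logs z) = inverse (lin z)"
  using expo_uminus[of "- logs z"] by (simp add: expo_uminus_logs)

lemma expo_logs_diff: "expo (logs z - logs w) = lin w * inverse (lin z)"
  using expo_add[of "logs z" "- logs w"] by (simp add: expo_logs expo_uminus_logs mult.commute)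

text \<open>The exponential is (1 - y u / Q) / (1 - Q y u) for e = 1 and has the roles of Q y and y
  / Q exchanged for e = -1, so the pole parameter is uniformly \<open>y * Q powi e\<close>. For e =
  0 the factor is 1 and this pole is only formal.\<close>

lemma psi_factor_eq:
  assumes "Q \<noteq> 0" "y \<noteq> 0" "e \<in> {-1, 0, 1}"
  shows "fps_const (Q powi e) * expo (fps_const (of_int e) * (logs (Q * y) - logs (y / Q)))
    = psi_factor Q e (y * Q powi e)"
proof -
  let ?L = "fps_const (Q powi e) * expo (fps_const (of_int e) * (logs (Q * y) - logs (y / Q)))"
  have 1: "?L * lin (y * Q powi e) = fps_const (Q powi e) - fps_const (y) * fps_X"
  proof -
    have inv: "inverse (lin z) * lin z = 1" for z by (rule inverse_mult_eq_1) (simp add: lin_nth)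
    consider "e = 1" | "e = -1" | "e = 0" using assms by auto
    then show ?thesis
    proof cases
      case 1
      have "?L * lin (y * Q powi e) = fps_const Q * lin (y / Q) * (inverse (lin (Q * y)) * lin (Q * y))"
        using 1 by (simp add: expo_logs_diff mult_ac)
      also have "\<dots> = fps_const Q - fps_const y * fps_X"
        using assms unfolding inv by (simp add: lin_def algebra_simps)
      finally show ?thesis using 1 by simp
    next
      case 2
      have e: "fps_const (of_int e) * (logs (Q * y) - logs (y / Q)) = logs (y / Q) - logs (Q * y)"
        using 2 by (simp add: fps_const_minus_one)
      have "?L * lin (y * Q powi e) = fps_const (inverse Q) * lin (Q * y) * (inverse (lin (y / Q)) * lin (y / Q))"
        unfolding e expo_logs_diff using 2 by (simp add: mult_ac divide_inverse)
      also have "\<dots> = fps_const (inverse Q) - fps_const y * fps_X"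
        using assms unfolding inv by (simp add: lin_def algebra_simps)
      finally show ?thesis using 2 by simp
    next
      case 3
      then show ?thesis by (simp add: lin_def)
    qed
  qed
  have "Q powi (- e) * (y * Q powi e) = y"
    using assms by (simp add: power_int_minus field_simps)
  then have "?L * lin (y * Q powi e) = psi_factor Q e (y * Q powi e) * lin (y * Q powi e)"
    unfolding 1 psi_factor_mult_lin by simp
  then show ?thesis by simp
qed

text \<open>The partial fraction expansion of a product of two factors \<^const>\<open>psi_factor\<close>.\<close>

definition psi_residues :: "complex \<Rightarrow> int \<Rightarrow> complex \<Rightarrow> int \<Rightarrow> complex \<Rightarrow> int \<Rightarrow> complex" where
  "psi_residues Q e1 p1 e2 p2 m =
     (Q powi e1 - Q powi (- e1)) * ((Q powi e2 * p1 - Q powi (- e2) * p2) / (p1 - p2)) * p1 powi m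
   + (Q powi e2 - Q powi (- e2)) * ((Q powi e1 * p2 - Q powi (- e1) * p1) / (p2 - p1)) * p2 powi m"

text \<open>Each factor is a constant plus a multiple of a geometric series, and the product of two
  geometric series is a combination of both when the ratios differ.\<close>

lemma psi_factor_mult_nth:
  assumes "p1 \<noteq> p2" "0 < k"
  shows "fps_nth (psi_factor Q e1 p1 * psi_factor Q e2 p2) k = psi_residues Q e1 p1 e2 p2 (int k)"
proof -
  define A A' B B' where d: "A = Q powi e1" "A' = Q powi (- e1)" "B = Q powi e2" "B' = Q powi (- e2)"
  have F: "psi_factor Q e p = fps_const (Q powi (- e)) + fps_const (Q powi e - Q powi (- e)) * Abs_fps (\<lambda>k. p ^ k)" for e p
    by (rule fps_ext) (auto simp: psi_factor_def)
  have geo: "fps_nth (Abs_fps (\<lambda>k. p1 ^ k) * Abs_fps (\<lambda>k. p2 ^ k)) k = (p1 ^ Suc k - p2 ^ Suc k) / (p1 - p2)"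
  proof -
    have "(\<Sum>i = 0..k. p1 ^ i * p2 ^ (k - i)) = (\<Sum>i<Suc k. p2 ^ (Suc k - Suc i) * p1 ^ i)"
      by (intro sum.cong) auto
    then have "(p1 - p2) * (\<Sum>i = 0..k. p1 ^ i * p2 ^ (k - i)) = p1 ^ Suc k - p2 ^ Suc k"
      by (simp only: power_diff_sumr2)
    then show ?thesis using assms(1) by (simp add: fps_mult_nth nonzero_eq_divide_eq mult.commute)
  qed
  have expand: "(a' + a * G) * (b' + b * G') = a' * b' + (a' * b) * G' + (a * b') * G + (a * b) * (G * G')"
    for a a' b b' G G' :: "complex fps"
    by (simp only: distrib_left distrib_right mult_ac add_ac)
  have "psi_factor Q e1 p1 * psi_factor Q e2 p2 =
      fps_const (A' * B') + fps_const (A' * (B - B')) * Abs_fps (\<lambda>k. p2 ^ k)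
      + fps_const ((A - A') * B') * Abs_fps (\<lambda>k. p1 ^ k)
      + fps_const ((A - A') * (B - B')) * (Abs_fps (\<lambda>k. p1 ^ k) * Abs_fps (\<lambda>k. p2 ^ k))"
    unfolding F d[symmetric] expand by (simp only: fps_const_mult)
  then have "fps_nth (psi_factor Q e1 p1 * psi_factor Q e2 p2) k =
     A' * (B - B') * p2 ^ k + (A - A') * B' * p1 ^ k + (A - A') * (B - B') * ((p1 ^ Suc k - p2 ^ Suc k) / (p1 - p2))"
    using assms by (simp add: geo)
  also have "\<dots> = psi_residues Q e1 p1 e2 p2 (int k)"
  proof -
    have "p1 - p2 \<noteq> 0" "p2 - p1 \<noteq> 0" using assms by auto
    then show ?thesis unfolding psi_residues_def d[symmetric]
      by (simp add: divide_simps) (simp add: algebra_simps)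
  qed
  finally show ?thesis .
qed

text \<open>Order 0 is special: the residues add up to the difference of the constant terms of the
  expansions at 0 and at infinity, which is what the relation between \<open>x\<^sup>+\<close> and
  \<open>x\<^sup>-\<close> contains.\<close>

lemma psi_residues_0:
  assumes "p1 \<noteq> p2" "Q \<noteq> 0"
  shows "psi_residues Q e1 p1 e2 p2 0 = Q powi (e1 + e2) - Q powi (- (e1 + e2))"
proof -
  define A B where d: "A = Q powi e1" "B = Q powi e2"
  have i: "Q powi (- e1) = inverse A" "Q powi (- e2) = inverse B" "Q powi (e1 + e2) = A * B"
      "Q powi (- (e1 + e2)) = inverse A * inverse B"
    using assms power_int_minus[of Q "e1 + e2"]
    by (simp_all add: d power_int_minus power_int_add del: minus_add_distrib)
  \<comment> \<open>Naming the difference turns the denominators \<open>p1 - p2\<close> and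
    \<open>p2 - p1\<close> into \<open>D\<close> and \<open>- D\<close>.\<close>
  obtain D where D: "p1 = p2 + D" by (metis add.commute diff_add_cancel)
  have "A \<noteq> 0" "B \<noteq> 0" "D \<noteq> 0" using assms D by (auto simp: d)
  then show ?thesis unfolding psi_residues_def i d[symmetric] D
    by (simp add: divide_simps) (simp add: algebra_simps)
qed

text \<open>The series for \<open>Minus\<close> expands the same rational function at infinity: in
  the inverse variable the exponents change sign and the poles are inverted. The sign on the right
  lets one formula serve all integer modes.\<close>

lemma psi_residues_inverse:
  assumes "p1 \<noteq> p2" "p1 \<noteq> 0" "p2 \<noteq> 0"
  shows "psi_residues Q (- e1) (inverse p1) (- e2) (inverse p2) m = - psi_residues Q e1 p1 e2 p2 (- m)"
proof -
  have *: "(B * inverse x - A * inverse y) / (inverse x - inverse y) = (A * x - B * y) / (x - y)"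
    if "x \<noteq> y" "x \<noteq> 0" "y \<noteq> 0" for A B x y :: complex
  proof -
    have "inverse x - inverse y = (y - x) / (x * y)" "B * inverse x - A * inverse y = (B * y - A * x) / (x * y)"
      using that by (simp_all add: field_simps)
    moreover have "(B * y - A * x) / (y - x) = (A * x - B * y) / (x - y)"
      by (metis minus_diff_eq minus_divide_divide)
    ultimately show ?thesis using that by simp
  qed
  have inv: "inverse p powi m = p powi (- m)" for p :: complex
    by (simp add: power_int_minus power_int_inverse)
  have neg: "(a' - a) * t + (b' - b) * s = - ((a - a') * t + (b - b') * s)" for a a' b b' s t :: complex
    by (simp add: algebra_simps)
  have "p2 \<noteq> p1" using assms by auto
  then show ?thesis
    unfolding psi_residues_def minus_minus inv *[OF assms] *[OF \<open>p2 \<noteq> p1\<close> assms(3,2)] mult.assoc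
    by (intro neg)
qed

text \<open>The eigenvalue of \<open>h\<^sub>m\<close> on a vector with \<open>\<ell>\<close>-weight \<open>Y\<^sub>y\<^sup>e Y\<^sub>z\<^sup>f\<close>.\<close>

definition h_eigenvalue :: "complex \<Rightarrow> int \<Rightarrow> complex \<Rightarrow> int \<Rightarrow> complex \<Rightarrow> int \<Rightarrow> complex" where
  "h_eigenvalue Q e y f z m = qint Q m / of_int m * (of_int e * y powi m + of_int f * z powi m)"

lemma qint_minus: "qint Q (- m) = - qint Q m"
  by (simp add: qint_def minus_divide_left del: divide_minus_left)

lemma h_eigenvalue_minus:
  "h_eigenvalue Q e y f z (- m) = h_eigenvalue Q e (inverse y) f (inverse z) m"
  by (simp add: h_eigenvalue_def qint_minus power_int_minus power_int_inverse)

lemma h_eigenvalue_uminus: "h_eigenvalue Q (- e) y (- f) z m = - h_eigenvalue Q e y f z m"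
  by (simp add: h_eigenvalue_def algebra_simps)

section \<open>Eigenvalues of \<open>psi\<close> and \<open>P_elt\<close> from those of
  \<open>h\<close>, and back\<close>

context uq_rep
begin

lemma q_powi_eq_1_iff: "q powi m = 1 \<longleftrightarrow> m = 0"
proof
  assume *: "q powi m = 1"
  show "m = 0"
  proof (rule ccontr)
    assume "m \<noteq> 0"
    then consider "0 < m" | "0 < - m" by linarith
    then show False
    proof cases
      case 1
      then show False using * q_not_root[of "nat m"] by (simp add: power_int_def)
    next
      case 2
      have "q powi (- m) = 1" using * by (simp add: power_int_minus)
      then show False using 2 q_not_root[of "nat (- m)"] by (simp add: power_int_def)
    qed
  qed
qed simp

lemma q_powi_eq_iff: "q powi a = q powi b \<longleftrightarrow> a = b"
proof -
  have "q powi a = q powi b \<longleftrightarrow> q powi (a - b) = 1"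
    using q_nonzero by (auto simp: power_int_diff)
  then show ?thesis by (simp add: q_powi_eq_1_iff)
qed

lemma qi_nonzero [simp]: "qi n q j \<noteq> 0"
  using q_nonzero by (simp add: qi_def)

lemma qi_powi: "qi n q j powi m = q powi (int (symm_d n j) * m)"
  by (simp add: qi_def power_int_mult)

lemma qi_powi_eq_iff: "qi n q j powi a = qi n q j powi b \<longleftrightarrow> a = b"
  by (auto simp: qi_powi q_powi_eq_iff symm_d_def)

lemma qi_diff_inverse: "qi n q j - inverse (qi n q j) \<noteq> 0"
  using qi_powi_eq_iff[of j 1 "-1"] by (simp add: power_int_minus)

lemma qint_nonzero: "m \<noteq> 0 \<Longrightarrow> qint (qi n q j) m \<noteq> 0"
  using qi_powi_eq_iff[of j m "- m"] qi_diff_inverse[of j] by (simp add: qint_def)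

lemma qint_mult_diff:
  "(qi n q j - inverse (qi n q j)) * qint (qi n q j) m = qi n q j powi m - qi n q j powi (- m)"
  using qi_diff_inverse by (simp add: qint_def)

text \<open>The truncation at order \<open>m\<close> permits an induction that recovers the
  eigenvalues of a series from those of its exponential.\<close>

definition series_eigen :: "nat \<Rightarrow> 'v \<Rightarrow> uq_free fps \<Rightarrow> complex fps \<Rightarrow> bool" where
  "series_eigen m v F f \<longleftrightarrow> (\<forall>k. fps_nth F k \<in> carrier (free_alg n)) \<and>
     (\<forall>k\<le>m. opr (fps_nth F k) v = scale (fps_nth f k) v)"

lemma series_eigen_mult_nth:
  assumes F: "\<And>k. fps_nth F k \<in> carrier (free_alg n)" and G: "\<And>k. fps_nth G k \<in> carrier (free_alg n)"
    and *: "\<And>i. i \<le> k \<Longrightarrow> opr (fps_nth F i) (opr (fps_nth G (k - i)) v) = scale (fps_nth f i * fps_nth g (k - i)) v"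
  shows "opr (fps_nth (F * G) k) v = scale (fps_nth (f * g) k) v"
  using F G * by (simp add: fps_mult_nth opr_sum free_alg_mult opr_mult vs.scale_sum_left)

lemma series_eigen_mult:
  assumes "series_eigen m v F f" "series_eigen m v G g"
  shows "series_eigen m v (F * G) (f * g)"
proof -
  have c: "\<And>k. fps_nth F k \<in> carrier (free_alg n)" "\<And>k. fps_nth G k \<in> carrier (free_alg n)"
    using assms by (auto simp: series_eigen_def)
  have "opr (fps_nth (F * G) k) v = scale (fps_nth (f * g) k) v" if "k \<le> m" for k
    using assms that c
    by (intro series_eigen_mult_nth) (auto simp: series_eigen_def opr_linear_simps mult.commute)
  then show ?thesis using c by (auto simp: series_eigen_def fps_mult_nth intro!: free_alg_sum free_alg_mult)
qed

lemma series_eigen_power: "series_eigen m v F f \<Longrightarrow> series_eigen m v (F ^ i) (f ^ i)"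
proof (induction i)
  case 0
  then show ?case by (auto simp: series_eigen_def free_alg_1)
next
  case (Suc i)
  then show ?case by (simp add: series_eigen_mult)
qed

lemma opr_exp_series:
  assumes "\<And>k. fps_nth F k \<in> carrier (free_alg n)"
  shows "opr (fps_nth (exp_series F) k) v = (\<Sum>i=0..k. scale (1 / fact i) (opr (fps_nth (F ^ i) k) v))"
  unfolding exp_series_def fps_compose_def
  using assms by (simp add: opr_sum opr_mult free_alg_sc free_alg_mult free_alg_fps_power)

lemma series_eigen_exp:
  assumes "series_eigen m v F f"
  shows "series_eigen m v (exp_series F) (expo f)"
proof -
  have c: "\<And>k. fps_nth F k \<in> carrier (free_alg n)" using assms by (auto simp: series_eigen_def)
  have "opr (fps_nth (exp_series F) k) v = scale (fps_nth (expo f) k) v" if "k \<le> m" for k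
    using series_eigen_power[OF assms] that
    by (simp add: opr_exp_series[OF c] expo_def fps_compose_nth vs.scale_sum_left series_eigen_def)
  then show ?thesis using c by (auto simp: series_eigen_def intro: free_alg_exp_series)
qed

text \<open>With vanishing constant terms, the coefficient of \<open>u\<^sup>m\<close> in a power \<open>F\<^sup>i\<close>, \<open>i \<ge> 2\<close>, only
  involves coefficients of \<open>F\<close> of lower order.\<close>

lemma series_eigen_higher_power:
  assumes "series_eigen m v F f" "fps_nth F 0 = 0" "fps_nth f 0 = 0"
  shows "opr (fps_nth (F ^ Suc (Suc i)) (Suc m)) v = scale (fps_nth (f ^ Suc (Suc i)) (Suc m)) v"
proof -
  have c: "\<And>k. fps_nth F k \<in> carrier (free_alg n)" using assms by (auto simp: series_eigen_def)
  have p: "series_eigen m v (F ^ Suc i) (f ^ Suc i)" by (rule series_eigen_power[OF assms(1)])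
  have z: "fps_nth (F ^ Suc i) 0 = 0" "fps_nth (f ^ Suc i) 0 = 0" using assms by simp_all
  have "opr (fps_nth F k) (opr (fps_nth (F ^ Suc i) (Suc m - k)) v) =
      scale (fps_nth f k * fps_nth (f ^ Suc i) (Suc m - k)) v" if k: "k \<le> Suc m" for k
  proof -
    consider "k = 0" | "k = Suc m" | "k \<le> m" "Suc m - k \<le> m"
      using k by (cases "k = 0"; cases "k = Suc m") auto
    then show ?thesis
    proof cases
      case 1
      then show ?thesis using assms by simp
    next
      case 2
      then show ?thesis using z c by (simp add: opr_linear_simps del: power_Suc)
    next
      case 3
      then show ?thesis using assms(1) p c
        by (simp add: series_eigen_def opr_linear_simps mult.commute del: power_Suc)
    qed
  qed
  then show ?thesis
    unfolding power_Suc[of _ "Suc i"] using c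
    by (intro series_eigen_mult_nth free_alg_fps_power) auto
qed

text \<open>At order m + 1 the exponential is \<open>F\<close> itself plus powers of exponent at
  least 2, whose contribution is known by induction. This is needed because the highest weight
  vector is specified through \<open>P_elt\<close>, while the commutation relations are stated with
  \<open>h\<close>.\<close>

lemma series_eigen_of_exp:
  assumes c: "\<And>k. fps_nth F k \<in> carrier (free_alg n)"
    and e: "\<And>k. opr (fps_nth (exp_series F) k) v = scale (fps_nth (expo f) k) v"
    and 0: "fps_nth F 0 = 0" "fps_nth f 0 = 0"
  shows "series_eigen m v F f"
proof (induction m)
  case 0
  then show ?case using c assms(3,4) by (simp add: series_eigen_def)
next
  case (Suc m)
  have high: "opr (fps_nth (F ^ i) (Suc m)) v = scale (fps_nth (f ^ i) (Suc m)) v" if "i \<noteq> 1" for i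
  proof (cases i)
    case (Suc j)
    then obtain l where "i = Suc (Suc l)" using \<open>i \<noteq> 1\<close> by (cases j) auto
    then show ?thesis using series_eigen_higher_power[OF Suc.IH assms(3,4)] by blast
  qed simp
  \<comment> \<open>The linear term of the exponential is split off; all other terms agree on both
    sides.\<close>
  have split: "{0..Suc m} = insert 1 ({0..Suc m} - {1})" by auto
  have "scale (1 / fact 1) (opr (fps_nth (F ^ 1) (Suc m)) v) = scale (1 / fact 1) (scale (fps_nth (f ^ 1) (Suc m)) v)"
    using e[of "Suc m"] high
    unfolding opr_exp_series[OF c] expo_def fps_compose_nth vs.scale_sum_left
    by (subst (asm) split, subst (asm) (2) split) (simp del: insert_Diff_single)
  then have "opr (fps_nth F (Suc m)) v = scale (fps_nth f (Suc m)) v" by simp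
  then show ?case using Suc.IH c by (auto simp: series_eigen_def le_Suc_eq)
qed


lemma log_series_psi:
  assumes "k \<noteq> 0"
  shows "(qi n q j - inverse (qi n q j)) * h_eigenvalue (qi n q j) e y f z (int k) =
     fps_nth (fps_const (of_int e) * (logs (qi n q j * y) - logs (y / qi n q j))
       + fps_const (of_int f) * (logs (qi n q j * z) - logs (z / qi n q j))) k"
proof -
  have "(qi n q j - inverse (qi n q j)) * h_eigenvalue (qi n q j) e y f z (int k) =
    (qi n q j ^ k - inverse (qi n q j) ^ k) / of_nat k * (of_int e * y ^ k + of_int f * z ^ k)"
    unfolding h_eigenvalue_def using qint_mult_diff[of j "int k"]
    by (simp add: power_int_minus power_inverse)
  then show ?thesis
    using assms by (simp add: logs_def divide_inverse power_mult_distrib power_inverse algebra_simps)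
qed

text \<open>For \<open>Minus\<close> the variable is the inverse one, and negated exponents with
  inverted parameters are to be supplied; the sign in front of \<open>H\<close> is the one in the
  exponent of \<psi>.\<close>

lemma opr_psi_series:
  assumes j: "j \<in> {1..n}"
    and H: "\<And>k. 0 < k \<Longrightarrow> scale (of_int (sg s)) (H j (sg s * int k) v) = scale (h_eigenvalue (qi n q j) e y f z (int k)) v"
    and K: "K s j v = scale (qi n q j powi (e + f)) v"
    and e: "e \<in> {-1, 0, 1}" "f \<in> {-1, 0, 1}" and y: "y \<noteq> 0" "z \<noteq> 0"
  shows "opr (fps_nth (psi_series n q s j) k) v =
     scale (fps_nth (psi_factor (qi n q j) e (y * qi n q j powi e) * psi_factor (qi n q j) f (z * qi n q j powi f)) k) v"
proof -
  define Q where "Q = qi n q j"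
  have Q: "Q \<noteq> 0" by (simp add: Q_def)
  define F where "F = Abs_fps (\<lambda>k. if k = 0 then 0
        else sc (of_int (sg s) * (Q - inverse Q)) * gh j (sg s * int k))"
  define g where "g = fps_const (of_int e) * (logs (Q * y) - logs (y / Q))
       + fps_const (of_int f) * (logs (Q * z) - logs (z / Q))"
  have F: "fps_nth F i \<in> carrier (free_alg n)" for i
    using j by (auto simp: F_def intro!: free_alg_mult free_alg_gens)
  have "opr (fps_nth F i) v = scale (fps_nth g i) v" for i
  proof (cases "i = 0")
    case False
    have "opr (fps_nth F i) v = scale (Q - inverse Q) (scale (of_int (sg s)) (H j (sg s * int i) v))"
      using False j by (simp add: F_def opr_mult free_alg_sc free_alg_gens mult.commute)
    also have "\<dots> = scale (fps_nth g i) v"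
      using False log_series_psi[of i j e y f z] H[of i] by (simp add: g_def Q_def)
    finally show ?thesis .
  qed (simp add: F_def g_def)
  with F have "series_eigen k v F g" by (simp add: series_eigen_def)
  then have exp: "opr (fps_nth (exp_series F) k) v = scale (fps_nth (expo g) k) v"
    using series_eigen_exp by (auto simp: series_eigen_def)
  have "fps_const (Q powi (e + f)) * expo g =
      (fps_const (Q powi e) * expo (fps_const (of_int e) * (logs (Q * y) - logs (y / Q))))
    * (fps_const (Q powi f) * expo (fps_const (of_int f) * (logs (Q * z) - logs (z / Q))))"
    unfolding g_def using Q
    by (subst expo_add) (simp_all add: power_int_add mult_ac flip: fps_const_mult)
  also have "\<dots> = psi_factor Q e (y * Q powi e) * psi_factor Q f (z * Q powi f)"
    unfolding psi_factor_eq[OF Q y(1) e(1)] psi_factor_eq[OF Q y(2) e(2)] ..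
  finally have "Q powi (e + f) * fps_nth (expo g) k = fps_nth (psi_factor Q e (y * Q powi e) * psi_factor Q f (z * Q powi f)) k"
    by (metis fps_mult_left_const_nth)
  moreover have "opr (fps_nth (psi_series n q s j) k) v = K s j (opr (fps_nth (exp_series F) k) v)"
    unfolding psi_series_def F_def Q_def fps_mult_left_const_nth using j
    by (intro opr_mult free_alg_gens free_alg_exp_series) (auto intro!: free_alg_gens free_alg_mult)
  ultimately show ?thesis
    using exp j K by (simp add: Q_def[symmetric] K_linear mult.commute)
qed

text \<open>Both series expand one rational function, at 0 and at infinity, so their difference is a
  sum over its poles, uniformly in the mode.\<close>

lemma opr_psi_diff:
  assumes j: "j \<in> {1..n}" and H: "\<And>m. m \<noteq> 0 \<Longrightarrow> H j m v = scale (h_eigenvalue (qi n q j) e y f z m) v"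
    and K: "K Plus j v = scale (qi n q j powi (e + f)) v"
    and e: "e \<in> {-1, 0, 1}" "f \<in> {-1, 0, 1}" and y: "y \<noteq> 0" "z \<noteq> 0"
    and poles: "y * qi n q j powi e \<noteq> z * qi n q j powi f"
  shows "opr (psi n q Plus j m) v - opr (psi n q Minus j m) v =
    scale (psi_residues (qi n q j) e (y * qi n q j powi e) f (z * qi n q j powi f) m) v"
proof -
  define Q where "Q = qi n q j"
  define p1 p2 where "p1 = y * Q powi e" "p2 = z * Q powi f"
  have Q: "Q \<noteq> 0" by (simp add: Q_def)
  have p: "p1 \<noteq> 0" "p2 \<noteq> 0" "p1 \<noteq> p2" using y poles Q by (auto simp: p1_p2_def Q_def)
  have plus: "opr (fps_nth (psi_series n q Plus j) k) v = scale (fps_nth (psi_factor Q e p1 * psi_factor Q f p2) k) v" for k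
    unfolding p1_p2_def Q_def by (rule opr_psi_series) (use assms in auto)
  have "K Minus j (K Plus j v) = v" using j by (rule K_cancel)
  moreover have "Q powi (- e + - f) * Q powi (e + f) = 1"
    using Q by (simp flip: power_int_add)
  ultimately have KM: "K Minus j v = scale (Q powi (- e + - f)) v"
    using j K by (metis K_linear(3) Q_def vs.scale_one vs.scale_scale)
  have "opr (fps_nth (psi_series n q Minus j) k) v =
      scale (fps_nth (psi_factor Q (- e) (inverse y * Q powi (- e)) * psi_factor Q (- f) (inverse z * Q powi (- f))) k) v" for k
    unfolding Q_def
  proof (rule opr_psi_series)
    fix k :: nat assume "0 < k"
    then show "scale (of_int (sg Minus)) (H j (sg Minus * int k) v) =
        scale (h_eigenvalue (qi n q j) (- e) (inverse y) (- f) (inverse z) (int k)) v"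
      using H[of "- int k"] by (simp add: h_eigenvalue_minus h_eigenvalue_uminus)
  qed (use assms KM Q_def in auto)
  moreover have "inverse y * Q powi (- e) = inverse p1" "inverse z * Q powi (- f) = inverse p2"
    by (simp_all add: p1_p2_def power_int_minus)
  ultimately have minus: "opr (fps_nth (psi_series n q Minus j) k) v =
      scale (fps_nth (psi_factor Q (- e) (inverse p1) * psi_factor Q (- f) (inverse p2)) k) v" for k
    by simp
  have p': "inverse p1 \<noteq> inverse p2" using p by simp
  consider "0 < m" | "m < 0" | "m = 0" by linarith
  then show ?thesis unfolding Q_def[symmetric] p1_p2_def[symmetric]
  proof cases
    case 1
    then show "opr (psi n q Plus j m) v - opr (psi n q Minus j m) v = scale (psi_residues Q e p1 f p2 m) v"
      using psi_factor_mult_nth[OF p(3), of "nat m" Q e f] by (simp add: psi_def plus)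
  next
    case 2
    then show "opr (psi n q Plus j m) v - opr (psi n q Minus j m) v = scale (psi_residues Q e p1 f p2 m) v"
      using psi_factor_mult_nth[OF p', of "nat (- m)" Q "- e" "- f"] psi_residues_inverse[OF p(3,1,2), of Q e f "- m"]
      by (simp add: psi_def minus)
  next
    case 3
    have "psi_residues Q e p1 f p2 0 = Q powi e * Q powi f - Q powi (- e) * Q powi (- f)"
      using psi_residues_0[OF p(3) Q, of e f] Q by (simp add: power_int_add power_int_diff power_int_minus divide_inverse)
    then show "opr (psi n q Plus j m) v - opr (psi n q Minus j m) v = scale (psi_residues Q e p1 f p2 m) v"
      using 3 by (simp add: psi_def plus minus psi_factor_def vs.scale_left_diff_distrib)
  qed
qed

definition P_log :: "sign \<Rightarrow> nat \<Rightarrow> uq_free fps" where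
  "P_log s j = Abs_fps (\<lambda>k. if k = 0 then 0
     else - (sc (q powi (sg s * int k) / qint (qi n q j) (int k)) * gh j (sg s * int k)))"

text \<open>The factor q^k / [k] in \<open>P_elt\<close> cancels the [k] in the eigenvalue of
  \<open>h\<close> and shifts the parameter: Y_y corresponds to \<open>ell_fund\<close> at q
  y.\<close>

definition P_log_eigenvalue :: "sign \<Rightarrow> int \<Rightarrow> complex \<Rightarrow> int \<Rightarrow> complex \<Rightarrow> complex fps" where
  "P_log_eigenvalue s e y f z =
     fps_const (of_int e) * - logs ((q * y) powi sg s) + fps_const (of_int f) * - logs ((q * z) powi sg s)"

lemma P_elt_eq: "P_elt n q s j k = fps_nth (exp_series (P_log s j)) k"
  by (simp add: P_elt_def P_log_def)

lemma P_log_carrier: "j \<in> {1..n} \<Longrightarrow> fps_nth (P_log s j) k \<in> carrier (free_alg n)"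
  by (auto simp: P_log_def intro!: free_alg_mult free_alg_gens free_alg_uminus)

lemma P_log_0: "fps_nth (P_log s j) 0 = 0" "fps_nth (P_log_eigenvalue s e y f z) 0 = 0"
  by (simp_all add: P_log_def P_log_eigenvalue_def)

lemma opr_P_log:
  assumes "j \<in> {1..n}" "k \<noteq> 0"
  shows "opr (fps_nth (P_log s j) k) v =
     scale (- (q powi (sg s * int k) / qint (qi n q j) (int k))) (H j (sg s * int k) v)"
  using assms by (simp add: P_log_def opr_uminus opr_mult free_alg_sc free_alg_gens free_alg_mult)

lemma P_log_eigenvalue_nth:
  assumes "k \<noteq> 0"
  shows "fps_nth (P_log_eigenvalue s e y f z) k =
    - (q powi (sg s * int k) / qint (qi n q j) (int k)) * h_eigenvalue (qi n q j) e y f z (sg s * int k)"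
proof -
  have h: "h_eigenvalue (qi n q j) e y f z (sg s * int k) =
      qint (qi n q j) (int k) / of_nat k * (of_int e * y powi (sg s * int k) + of_int f * z powi (sg s * int k))"
    by (cases s) (simp_all add: h_eigenvalue_def qint_minus)
  have pow: "((q * x) powi sg s) ^ k = q powi (sg s * int k) * x powi (sg s * int k)" for x
    by (metis power_int_mult power_int_mult_distrib power_int_of_nat)
  show ?thesis using assms qint_nonzero[of "int k" j]
    by (simp add: P_log_eigenvalue_def h logs_def pow) (simp add: field_simps)
qed

lemma expo_P_log_eigenvalue:
  assumes "e \<in> {-1, 0, 1}" "f \<in> {-1, 0, 1}"
  shows "expo (P_log_eigenvalue s e y f z) =
    signed_power e (lin ((q * y) powi sg s)) * signed_power f (lin ((q * z) powi sg s))"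
proof -
  have "expo (P_log_eigenvalue s e y f z) =
      expo (fps_const (of_int e) * - logs ((q * y) powi sg s)) * expo (fps_const (of_int f) * - logs ((q * z) powi sg s))"
    unfolding P_log_eigenvalue_def by (rule expo_add) simp_all
  also have "expo (fps_const (of_int e) * - logs ((q * y) powi sg s)) = signed_power e (expo (- logs ((q * y) powi sg s)))"
    using assms by (intro expo_signed) simp_all
  also have "expo (fps_const (of_int f) * - logs ((q * z) powi sg s)) = signed_power f (expo (- logs ((q * z) powi sg s)))"
    using assms by (intro expo_signed) simp_all
  finally show ?thesis by (simp only: expo_uminus_logs)
qed

lemma opr_P_elt:
  assumes j: "j \<in> {1..n}" and e: "e \<in> {-1, 0, 1}" "f \<in> {-1, 0, 1}"
    and H: "\<And>m. m \<noteq> 0 \<Longrightarrow> H j m v = scale (h_eigenvalue (qi n q j) e y f z m) v"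
  shows "opr (P_elt n q s j k) v =
    scale (fps_nth (signed_power e (lin ((q * y) powi sg s)) * signed_power f (lin ((q * z) powi sg s))) k) v"
proof -
  have "opr (fps_nth (P_log s j) i) v = scale (fps_nth (P_log_eigenvalue s e y f z) i) v" for i
    using j H by (cases "i = 0") (simp_all add: P_log_0 opr_P_log P_log_eigenvalue_nth[of _ _ _ _ _ _ j])
  then have "series_eigen k v (P_log s j) (P_log_eigenvalue s e y f z)"
    using P_log_carrier[OF j] by (simp add: series_eigen_def)
  from series_eigen_exp[OF this] show ?thesis
    by (simp add: series_eigen_def P_elt_eq expo_P_log_eigenvalue[OF e])
qed

lemma H_if_P_elt:
  assumes j: "j \<in> {1..n}" and e: "e \<in> {-1, 0, 1}" "f \<in> {-1, 0, 1}"
    and P: "\<And>s k. opr (P_elt n q s j k) v =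
      scale (fps_nth (signed_power e (lin ((q * y) powi sg s)) * signed_power f (lin ((q * z) powi sg s))) k) v"
    and "m \<noteq> 0"
  shows "H j m v = scale (h_eigenvalue (qi n q j) e y f z m) v"
proof -
  obtain s k where m: "m = sg s * int k" and k: "k \<noteq> 0"
  proof (cases "0 < m")
    case True then show ?thesis using that[of Plus "nat m"] by auto
  next
    case False then show ?thesis using that[of Minus "nat (- m)"] \<open>m \<noteq> 0\<close> by auto
  qed
  have "series_eigen k v (P_log s j) (P_log_eigenvalue s e y f z)"
    using P P_log_carrier[OF j]
    by (intro series_eigen_of_exp) (simp_all add: P_log_0 P_elt_eq expo_P_log_eigenvalue[OF e])
  then have "opr (fps_nth (P_log s j) k) v = scale (fps_nth (P_log_eigenvalue s e y f z) k) v"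
    by (simp add: series_eigen_def)
  moreover have "- (q powi (sg s * int k) / qint (qi n q j) (int k)) \<noteq> 0"
    using q_nonzero qint_nonzero[of "int k" j] k by simp
  ultimately show ?thesis
    unfolding opr_P_log[OF j k] P_log_eigenvalue_nth[OF k, of _ _ _ _ _ j] m
      vs.scale_scale[symmetric]
    by (rule vs.scale_left_imp_eq[rotated])
qed

end

section \<open>Primitive vectors in irreducible modules\<close>

definition simple_root :: "nat \<Rightarrow> nat \<Rightarrow> nat \<Rightarrow> int" where
  "simple_root n j k = (if k \<in> {1..n} then cartan n k j else 0)"

text \<open>Twice the pairing with the coweight \<open>\<Sum>\<^sub>j (n + 1 - j) \<epsilon>\<^sub>j\<close>, which is positive on simple roots.\<close>

definition height :: "nat \<Rightarrow> (nat \<Rightarrow> int) \<Rightarrow> int" where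
  "height n \<mu> = (\<Sum>k=1..n. \<mu> k * (int k * (2 * int n + 1 - int k)))"

text \<open>Only \<open>j\<close> and its neighbours contribute. The cases separate the ends of the
  diagram and the double bond; the value 4 at \<open>n\<close> reflects that the long root is twice
  a coordinate vector.\<close>

lemma height_simple_root_pos:
  assumes j: "j \<in> {1..n}" and n: "2 \<le> n"
  shows "0 < height n (simple_root n j)"
proof -
  let ?f = "\<lambda>k. int k * (2 * int n + 1 - int k)"
  have "height n (simple_root n j) = (\<Sum>k\<in>{1..n}. cartan n k j * ?f k)"
    by (simp add: height_def simple_root_def)
  also have "\<dots> = (\<Sum>k\<in>{1..n} \<inter> {j - 1, j, j + 1}. cartan n k j * ?f k)"
    by (rule sum.mono_neutral_right) (auto simp: cartan_def)
  also have "\<dots> = (if j = n then 4 else 2)"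
  proof -
    consider "j = n" | "j = n - 1" "1 < j" | "j = n - 1" "j = 1" | "j < n - 1" "1 < j" | "j < n - 1" "j = 1"
      using j by fastforce
    then show ?thesis
    proof cases
      case 1
      then have "{1..n} \<inter> {j - 1, j, j + 1} = {n - 1, n}" "n - 1 \<noteq> n" using n by auto
      then show ?thesis using 1 n by (simp add: cartan_def of_nat_diff algebra_simps)
    next
      case 2
      define m where "m = n - 3"
      have m: "n = m + 3" "j = m + 2" using 2 by (auto simp: m_def)
      then have "{1..n} \<inter> {j - 1, j, j + 1} = {m + 1, m + 2, m + 3}" by auto
      then show ?thesis by (simp add: m cartan_def algebra_simps)
    next
      case 3
      then have "n = 2" using n by auto
      then have "{1..n} \<inter> {j - 1, j, j + 1} = {1, 2}" using 3 by auto
      then show ?thesis using 3 \<open>n = 2\<close> by (simp add: cartan_def)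
    next
      case 4
      then have "{1..n} \<inter> {j - 1, j, j + 1} = {j - 1, j, j + 1}" by auto
      moreover have "j - 1 \<noteq> j" "j \<noteq> j + 1" "j - 1 \<noteq> j + 1" "j \<noteq> n" using 4 by auto
      ultimately show ?thesis using 4 n by (simp add: cartan_def of_nat_diff algebra_simps) 
    next
      case 5
      then have "{1..n} \<inter> {j - 1, j, j + 1} = {1, 2}" by auto
      then show ?thesis using 5 n by (simp add: cartan_def)
    qed
  qed
  finally show ?thesis by (auto split: if_splits)
qed

context uq_rep
begin

abbreviation W :: "(nat \<Rightarrow> int) \<Rightarrow> 'v set" where "W \<equiv> weight_space n q scale act"

lemma W_iff: "v \<in> W \<mu> \<longleftrightarrow> (\<forall>k\<in>{1..n}. K Plus k v = scale (qi n q k powi \<mu> k) v)"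
  by (simp add: weight_space_def opr_def)

lemma W_subspace: "vs.subspace (W \<mu>)"
  by (auto simp: vs.subspace_def W_iff K_linear vs.scale_right_distrib vs.scale_left_commute)

lemma X_weight:
  assumes "j \<in> {1..n}" "v \<in> W \<mu>"
  shows "X e j r v \<in> W (\<lambda>k. \<mu> k + sg e * simple_root n j k)"
  using assms by (auto simp: W_iff K_X X_linear power_int_add simple_root_def)

lemma H_weight:
  assumes "j \<in> {1..n}" "m \<noteq> 0" "v \<in> W \<mu>"
  shows "H j m v \<in> W \<mu>"
  using assms by (auto simp: W_iff K_H H_linear)

lemma K_Minus_weight:
  assumes "j \<in> {1..n}" "v \<in> W \<mu>"
  shows "K Minus j v = scale (qi n q j powi (- \<mu> j)) v"
proof -
  have "qi n q j powi (- \<mu> j) * qi n q j powi \<mu> j = 1"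
    by (simp flip: power_int_add)
  moreover have "K Plus j v = scale (qi n q j powi \<mu> j) v" using assms by (simp add: W_iff)
  ultimately show ?thesis
    using assms by (metis K_linear(3) K_cancel(2) vs.scale_one vs.scale_scale)
qed

text \<open>Brings an element of the span into the shape for which \<open>type_one\<close> asserts
  uniqueness.\<close>

lemma weight_decomposition:
  assumes "y \<in> vs.span (\<Union>\<mu>\<in>L. W \<mu>)"
  shows "\<exists>c. finite {\<mu>. c \<mu> \<noteq> 0} \<and> {\<mu>. c \<mu> \<noteq> 0} \<subseteq> L \<and> (\<forall>\<mu>. c \<mu> \<in> W \<mu>) \<and> y = (\<Sum>\<mu> | c \<mu> \<noteq> 0. c \<mu>)"
  using assms
proof (induction rule: vs.span_induct_alt)
  case base
  show ?case by (intro exI[of _ "\<lambda>_. 0"]) (auto simp: vs.subspace_0[OF W_subspace])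
next
  case (step a x y)
  then obtain c \<mu> where c: "finite {\<mu>. c \<mu> \<noteq> 0}" "{\<mu>. c \<mu> \<noteq> 0} \<subseteq> L" "\<And>\<mu>. c \<mu> \<in> W \<mu>" "y = (\<Sum>\<mu> | c \<mu> \<noteq> 0. c \<mu>)"
    and \<mu>: "\<mu> \<in> L" "x \<in> W \<mu>" by blast
  define d where "d = c(\<mu> := scale a x + c \<mu>)"
  let ?F = "insert \<mu> {\<mu>. c \<mu> \<noteq> 0}"
  have "(\<Sum>\<nu> | d \<nu> \<noteq> 0. d \<nu>) = sum d ?F"
    by (rule sum.mono_neutral_left) (use c in \<open>auto simp: d_def\<close>)
  also have "\<dots> = d \<mu> + sum d (?F - {\<mu>})" using c(1) by (simp add: sum.remove[of ?F \<mu>])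
  also have "sum d (?F - {\<mu>}) = sum c (?F - {\<mu>})" by (rule sum.cong) (auto simp: d_def)
  also have "d \<mu> + sum c (?F - {\<mu>}) = scale a x + sum c ?F"
    using c(1) by (simp add: d_def sum.remove[of ?F \<mu>] add.assoc)
  also have "sum c ?F = y" unfolding c(4)
    by (rule sum.mono_neutral_right) (use c in auto)
  finally have "scale a x + y = (\<Sum>\<nu> | d \<nu> \<noteq> 0. d \<nu>)" by simp
  moreover have "finite {\<nu>. d \<nu> \<noteq> 0}" "{\<nu>. d \<nu> \<noteq> 0} \<subseteq> L"
    using c(1,2) \<mu>(1) by (auto simp: d_def split: if_splits intro: finite_subset[of _ ?F])
  moreover have "d \<nu> \<in> W \<nu>" for \<nu>
    using c(3) \<mu>(2) by (auto simp: d_def intro!: vs.subspace_add[OF W_subspace] vs.subspace_scale[OF W_subspace])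
  ultimately show ?case by blast
qed

text \<open>The elements of the free algebra that preserve \<open>S\<close> are closed under sums
  and products, so they include every coefficient of the exponential defining
  \<open>psi\<close>.\<close>

lemma psi_invariant:
  assumes S: "vs.subspace S" and j: "j \<in> {1..n}"
    and K: "\<And>e w. w \<in> S \<Longrightarrow> K e j w \<in> S" and H: "\<And>m w. m \<noteq> 0 \<Longrightarrow> w \<in> S \<Longrightarrow> H j m w \<in> S"
    and w: "w \<in> S"
  shows "opr (psi n q e j m) w \<in> S"
proof -
  define T where "T = {f \<in> carrier (free_alg n). \<forall>w\<in>S. opr f w \<in> S}"
  have T_sum: "sum f A \<in> T" if "\<And>x. x \<in> A \<Longrightarrow> f x \<in> T" for f :: "nat \<Rightarrow> uq_free" and A
    using that by (auto simp: T_def opr_sum intro!: vs.subspace_sum[OF S])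
  have T_mult: "f * g \<in> T" if "f \<in> T" "g \<in> T" for f g
    using that by (auto simp: T_def opr_mult)
  have T_sc: "sc c \<in> T" for c by (auto simp: T_def vs.subspace_scale[OF S])
  have T_0: "0 \<in> T" using T_sc[of 0] by (simp add: sc_def)
  have T_1: "1 \<in> T" using T_sc[of 1] by (simp add: sc_def)
  have T_K: "gK e j \<in> T" for e using j K by (auto simp: T_def free_alg_gens)
  have T_H: "gh j m \<in> T" if "m \<noteq> 0" for m using j H that by (auto simp: T_def free_alg_gens)
  have T_exp: "fps_nth (exp_series F) k \<in> T" if "\<And>k. fps_nth F k \<in> T" for F k
  proof -
    have "fps_nth (F ^ i) k \<in> T" for i k
    proof (induction i arbitrary: k)
      case 0
      then show ?case by (simp add: T_0 T_1)
    next
      case (Suc i)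
      then show ?case using that by (auto simp: fps_mult_nth intro!: T_sum T_mult)
    qed
    then show ?thesis by (auto simp: exp_series_def fps_compose_def intro!: T_sum T_mult T_sc)
  qed
  have "psi n q e j m \<in> T"
    unfolding psi_def psi_series_def
    by (auto simp: T_0 fps_mult_left_const_nth intro!: T_mult T_exp T_K T_sc T_H)
  then show ?thesis using w by (simp add: T_def)
qed

text \<open>For a suitable \<open>B\<close> this is already a submodule. That part of a triangular
  decomposition suffices, and induction over the closure gives it without any basis of the
  algebra.\<close>

inductive_set lowering_closure :: "'v set \<Rightarrow> 'v set" for B where
  base: "x \<in> B \<Longrightarrow> x \<in> lowering_closure B"
| zero: "0 \<in> lowering_closure B"
| add: "x \<in> lowering_closure B \<Longrightarrow> y \<in> lowering_closure B \<Longrightarrow> x + y \<in> lowering_closure B"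
| scale: "x \<in> lowering_closure B \<Longrightarrow> scale c x \<in> lowering_closure B"
| lower: "x \<in> lowering_closure B \<Longrightarrow> j \<in> {1..n} \<Longrightarrow> X Minus j r x \<in> lowering_closure B"

lemma lowering_closure_subspace: "vs.subspace (lowering_closure B)"
  by (auto simp: vs.subspace_def intro: lowering_closure.intros)

lemmas lowering_closure_intros = lowering_closure.zero lowering_closure.add lowering_closure.scale
  lowering_closure.lower vs.subspace_diff[OF lowering_closure_subspace]

lemma lowering_closure_K:
  assumes j: "j \<in> {1..n}" and B: "\<And>x e. x \<in> B \<Longrightarrow> K e j x \<in> lowering_closure B"
    and x: "x \<in> lowering_closure B"
  shows "K e j x \<in> lowering_closure B"
  using x
proof induction
  case (lower x k r)
  show ?case
  proof (cases e)
    case Plus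
    then show ?thesis using lower j by (auto simp: K_X intro!: lowering_closure_intros)
  next
    case Minus
    \<comment> \<open>\<open>K_X\<close> covers \<open>K Plus\<close> only; the exchange rule for
      \<open>K Minus\<close> results from inverting it.\<close>
    have "scale (qi n q j powi (- cartan n j k)) (X Minus k r x) = K Plus j (X Minus k r (K Minus j x))"
      using j lower by (simp add: K_X K_cancel)
    then have "scale (qi n q j powi (- cartan n j k)) (K Minus j (X Minus k r x)) = X Minus k r (K Minus j x)"
      using j by (metis K_cancel(2) K_linear(3))
    then have "K Minus j (X Minus k r x) = scale (inverse (qi n q j powi (- cartan n j k))) (X Minus k r (K Minus j x))"
      by (metis power_int_eq_0_iff qi_nonzero left_inverse vs.scale_one vs.scale_scale)
    then show ?thesis using Minus lower by (auto intro!: lowering_closure_intros)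
  qed
qed (use B j in \<open>auto simp: K_linear intro!: lowering_closure_intros\<close>)

lemma lowering_closure_H:
  assumes j: "j \<in> {1..n}" and B: "\<And>x m. x \<in> B \<Longrightarrow> m \<noteq> 0 \<Longrightarrow> H j m x \<in> lowering_closure B"
    and x: "x \<in> lowering_closure B" and m: "m \<noteq> 0"
  shows "H j m x \<in> lowering_closure B"
  using x
  by induction (use B j m in \<open>auto simp: H_linear H_X intro!: lowering_closure_intros\<close>)

text \<open>Moving a raising operator past a lowering one costs only coefficients of
  \<open>psi\<close>, which preserve the closure as soon as \<open>K\<close> and \<open>H\<close>
  do; finally the raising operator reaches \<open>B\<close> and kills it.\<close>

lemma lowering_closure_invariant:
  assumes "\<And>x e j. x \<in> B \<Longrightarrow> j \<in> {1..n} \<Longrightarrow> K e j x \<in> lowering_closure B"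
    and "\<And>x m j. x \<in> B \<Longrightarrow> j \<in> {1..n} \<Longrightarrow> m \<noteq> 0 \<Longrightarrow> H j m x \<in> lowering_closure B"
    and B: "\<And>x j r. x \<in> B \<Longrightarrow> j \<in> {1..n} \<Longrightarrow> X Plus j r x = 0"
    and "a \<in> carrier (Uq n q)" "x \<in> lowering_closure B"
  shows "act a x \<in> lowering_closure B"
proof (rule invariant_if_generators[OF lowering_closure_subspace _ assms(4,5)])
  fix g x assume g: "g \<in> uq_gens n" and x: "x \<in> lowering_closure B"
  have K: "\<And>e j x. j \<in> {1..n} \<Longrightarrow> x \<in> lowering_closure B \<Longrightarrow> K e j x \<in> lowering_closure B"
    using assms(1) lowering_closure_K by blast
  have H: "\<And>m j x. j \<in> {1..n} \<Longrightarrow> m \<noteq> 0 \<Longrightarrow> x \<in> lowering_closure B \<Longrightarrow> H j m x \<in> lowering_closure B"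
    using assms(2) lowering_closure_H by blast
  have X: "X Plus j r x \<in> lowering_closure B" if j: "j \<in> {1..n}" for j r
    using x
  proof induction
    case (lower x k s)
    have "opr (psi n q e j m) x \<in> lowering_closure B" for e m
      by (rule psi_invariant[OF lowering_closure_subspace j]) (use K H j lower in auto)
    then show ?case
      using j lower by (auto simp: X_X intro!: lowering_closure_intros)
  qed (use B j in \<open>auto simp: X_linear intro!: lowering_closure_intros\<close>)
  show "opr (gen g) x \<in> lowering_closure B"
  proof -
    have "X e j r x \<in> lowering_closure B" if "j \<in> {1..n}" for e j r
      using X[OF that] lowering_closure.lower[OF x that] by (cases e) auto
    then show ?thesis using g x K H by (auto simp: uq_gens_def)
  qed
qed

text \<open>The vectors below the highest weight that are killed by all raising operators span, together
  with what they generate, a proper submodule.\<close>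

lemma no_primitive_vector:
  assumes n: "2 \<le> n" and t1: "type_one n q scale act" and irr: "uq_irreducible n q scale act"
    and v0: "v0 \<noteq> 0" "v0 \<in> W \<kappa>" "\<kappa> \<in> weight_lattice n"
    and x: "x \<in> W \<mu>" "\<mu> \<in> weight_lattice n" "height n \<mu> < height n \<kappa>"
    and kill: "\<And>j r. j \<in> {1..n} \<Longrightarrow> X Plus j r x = 0"
  shows "x = 0"
proof (rule ccontr)
  assume "x \<noteq> 0"
  \<comment> \<open>All killed vectors of weight \<mu> are taken, not only \<open>x\<close>: the
    operators \<open>H\<close> may move \<open>x\<close>, but by their relation with
    \<open>x\<^sup>+\<close> they stay within this set.\<close>
  define B where "B = {x \<in> W \<mu>. \<forall>j\<in>{1..n}. \<forall>r. X Plus j r x = 0}"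
  define L where "L = {\<nu> \<in> weight_lattice n. height n \<nu> < height n \<kappa>}"
  have "x \<in> lowering_closure B" using x kill by (auto simp: B_def intro: lowering_closure.base)
  moreover have "act a y \<in> lowering_closure B" if "a \<in> carrier (Uq n q)" "y \<in> lowering_closure B" for a y
  proof (rule lowering_closure_invariant[OF _ _ _ that])
    show "K e j x \<in> lowering_closure B" if "x \<in> B" "j \<in> {1..n}" for x e j
    proof -
      have x: "x \<in> W \<mu>" using that by (simp add: B_def)
      obtain c where "K e j x = scale c x"
      proof (cases e)
        case Plus
        then show ?thesis using x \<open>j \<in> {1..n}\<close> by (intro that) (auto simp: W_iff)
      next
        case Minus
        then show ?thesis using K_Minus_weight[OF \<open>j \<in> {1..n}\<close> x] by (intro that) auto
      qed
      then show ?thesis using that by (simp add: lowering_closure.scale lowering_closure.base)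
    qed
    show "H j m x \<in> lowering_closure B" if x: "x \<in> B" and j: "j \<in> {1..n}" and m: "m \<noteq> 0" for x m j
    proof (intro lowering_closure.base)
      have "X Plus k r (H j m x) = 0" if k: "k \<in> {1..n}" for k r
      proof -
        have "H j m (X Plus k r x) = X Plus k r (H j m x) +
            scale (of_int (sg Plus) * (1 / of_int m) * qint (qi n q j) (m * cartan n j k)) (X Plus k (m + r) x)"
          by (rule H_X[OF j k m])
        then show ?thesis using x k j m by (simp add: B_def H_linear)
      qed
      then show "H j m x \<in> B" using x j m by (auto simp: B_def H_weight)
    qed
  qed (simp add: B_def)
  ultimately have UNIV: "lowering_closure B = UNIV"
    using irr lowering_closure_subspace \<open>x \<noteq> 0\<close> unfolding uq_irreducible_def by blast
  have "lowering_closure B \<subseteq> vs.span (\<Union>\<nu>\<in>L. W \<nu>)"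
  proof
    fix y assume "y \<in> lowering_closure B"
    then show "y \<in> vs.span (\<Union>\<nu>\<in>L. W \<nu>)"
    proof induction
      case (base y)
      then show ?case using x by (auto simp: B_def L_def intro!: vs.span_base)
    next
      case (lower y j r)
      have "\<forall>y\<in>vs.span (\<Union>\<nu>\<in>L. W \<nu>). X Minus j r y \<in> vs.span (\<Union>\<nu>\<in>L. W \<nu>)"
      proof
        fix y assume "y \<in> vs.span (\<Union>\<nu>\<in>L. W \<nu>)"
        then show "X Minus j r y \<in> vs.span (\<Union>\<nu>\<in>L. W \<nu>)"
        proof (induction rule: vs.span_induct_alt)
          case base
          then show ?case using lower by (simp add: X_linear vs.span_zero)
        next
          case (step a y z)
          then obtain \<nu> where \<nu>: "\<nu> \<in> L" "y \<in> W \<nu>" by blast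
          let ?\<nu> = "\<lambda>k. \<nu> k + sg Minus * simple_root n j k"
          have "height n ?\<nu> = height n \<nu> - height n (simple_root n j)"
            by (simp add: height_def algebra_simps sum_subtractf sum.distrib)
          then have "?\<nu> \<in> L"
            using \<nu>(1) height_simple_root_pos[OF lower(2) n] by (auto simp: L_def weight_lattice_def simple_root_def)
          moreover have "X Minus j r y \<in> W ?\<nu>" by (rule X_weight[OF lower(2) \<nu>(2)])
          ultimately have "X Minus j r y \<in> vs.span (\<Union>\<nu>\<in>L. W \<nu>)" by (intro vs.span_base) blast
          then show ?case using step lower by (auto simp: X_linear intro!: vs.span_add vs.span_scale)
        qed
      qed
      then show ?case using lower by blast
    qed (auto intro: vs.span_zero vs.span_add vs.span_scale)
  qed
  then have "v0 \<in> vs.span (\<Union>\<nu>\<in>L. W \<nu>)" using UNIV by blast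
  from weight_decomposition[OF this]
  obtain c where c: "finite {\<mu>. c \<mu> \<noteq> 0}" "{\<mu>. c \<mu> \<noteq> 0} \<subseteq> L" "\<forall>\<mu>. c \<mu> \<in> W \<mu>" "v0 = (\<Sum>\<mu> | c \<mu> \<noteq> 0. c \<mu>)" by blast
  \<comment> \<open>The one-term decomposition of \<open>v0\<close> competes with \<open>c\<close>,
    whose weights all lie strictly below \<kappa>; uniqueness identifies the two.\<close>
  define d where "d = (\<lambda>\<nu>. if \<nu> = \<kappa> then v0 else 0)"
  have supp: "{\<nu>. d \<nu> \<noteq> 0} = {\<kappa>}" using v0 by (auto simp: d_def)
  have "c = d"
  proof -
    have "\<exists>!c. finite {\<mu>. c \<mu> \<noteq> 0} \<and> {\<mu>. c \<mu> \<noteq> 0} \<subseteq> weight_lattice n \<and> (\<forall>\<mu>. c \<mu> \<in> W \<mu>) \<and> v0 = (\<Sum>\<mu> | c \<mu> \<noteq> 0. c \<mu>)"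
      using t1 by (simp add: type_one_def)
    moreover have "finite {\<mu>. d \<mu> \<noteq> 0} \<and> {\<mu>. d \<mu> \<noteq> 0} \<subseteq> weight_lattice n \<and> (\<forall>\<mu>. d \<mu> \<in> W \<mu>) \<and> v0 = (\<Sum>\<mu> | d \<mu> \<noteq> 0. d \<mu>)"
      unfolding supp using v0 by (auto simp: d_def vs.subspace_0[OF W_subspace])
    moreover have "{\<mu>. c \<mu> \<noteq> 0} \<subseteq> weight_lattice n" using c(2) by (auto simp: L_def)
    ultimately show ?thesis using c by blast
  qed
  then have "\<kappa> \<in> L" using c(2) supp by auto
  then show False by (simp add: L_def)
qed

end

section \<open>Realization of thin modules\<close>

text \<open>
  A combinatorial model of a module all of whose \<open>\<ell>\<close>-weight spaces are lines: a state has at each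
  node \<open>j\<close> the two \<open>\<ell>\<close>-weight factors \<open>Y\<^sub>y\<^sup>e\<close> with \<open>(e, y) = (e1 j T, y1 j T), (e2 j T, y2 j T)\<close>, and
  for each node there are two kinds of moves, labelled by a boolean.  Both the Serre relations and
  the relations between two raising or two lowering operators are absent: in an irreducible module
  they are forced by the relations below.
\<close>

locale thin_model = uq_rep n q scale act
  for n q and scale :: "complex \<Rightarrow> 'v::ab_group_add \<Rightarrow> 'v" and act +
  fixes S :: "'s set" and top_state :: 's and depth :: "'s \<Rightarrow> nat"
    and lower raise :: "nat \<Rightarrow> bool \<Rightarrow> 's \<Rightarrow> 's"
    and cm cp :: "nat \<Rightarrow> bool \<Rightarrow> 's \<Rightarrow> complex" and pole :: "nat \<Rightarrow> bool \<Rightarrow> 's \<Rightarrow> complex"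
    and e1 e2 :: "nat \<Rightarrow> 's \<Rightarrow> int" and y1 y2 :: "nat \<Rightarrow> 's \<Rightarrow> complex"
    and v0 :: 'v
  assumes n: "2 \<le> n" and finite_S: "finite S" and top_S: "top_state \<in> S"
    and lower: "\<And>j \<mu> T. \<lbrakk>j \<in> {1..n}; T \<in> S; cm j \<mu> T \<noteq> 0\<rbrakk> \<Longrightarrow>
        lower j \<mu> T \<in> S \<and> depth (lower j \<mu> T) = Suc (depth T) \<and> raise j \<mu> (lower j \<mu> T) = T"
    and raise: "\<And>j \<mu> T. \<lbrakk>j \<in> {1..n}; T \<in> S; cp j \<mu> T \<noteq> 0\<rbrakk> \<Longrightarrow>
        raise j \<mu> T \<in> S \<and> lower j \<mu> (raise j \<mu> T) = T \<and> cm j \<mu> (raise j \<mu> T) \<noteq> 0"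
    and commute: "\<And>j \<mu> k \<nu> T. \<lbrakk>j \<in> {1..n}; k \<in> {1..n}; T \<in> S; (j, \<mu>) \<noteq> (k, \<nu>)\<rbrakk> \<Longrightarrow>
        cm j \<mu> T * cp k \<nu> (lower j \<mu> T) = cp k \<nu> T * cm j \<mu> (raise k \<nu> T)"
    and commute_states: "\<And>j \<mu> k \<nu> T. \<lbrakk>j \<in> {1..n}; k \<in> {1..n}; T \<in> S; (j, \<mu>) \<noteq> (k, \<nu>);
        cm j \<mu> T \<noteq> 0; cp k \<nu> (lower j \<mu> T) \<noteq> 0\<rbrakk> \<Longrightarrow>
        raise k \<nu> (lower j \<mu> T) = lower j \<mu> (raise k \<nu> T)
        \<and> pole k \<nu> (lower j \<mu> (raise k \<nu> T)) = pole k \<nu> (raise k \<nu> T) \<and> pole j \<mu> (raise k \<nu> T) = pole j \<mu> T"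
    and e: "\<And>j T. \<lbrakk>j \<in> {1..n}; T \<in> S\<rbrakk> \<Longrightarrow> e1 j T \<in> {-1, 0, 1} \<and> e2 j T \<in> {-1, 0, 1}"
    and y: "\<And>j T. y1 j T \<noteq> 0" "\<And>j T. y2 j T \<noteq> 0"
    and poles: "\<And>j T. \<lbrakk>j \<in> {1..n}; T \<in> S\<rbrakk> \<Longrightarrow>
        y1 j T * qi n q j powi e1 j T \<noteq> y2 j T * qi n q j powi e2 j T"
    and lower_pole: "\<And>j \<mu> T. \<lbrakk>j \<in> {1..n}; T \<in> S; cm j \<mu> T \<noteq> 0\<rbrakk> \<Longrightarrow> pole j \<mu> T =
        (if \<mu> then y1 j T * qi n q j powi e1 j T else y2 j T * qi n q j powi e2 j T)"
    and raise_pole: "\<And>j \<mu> T. \<lbrakk>j \<in> {1..n}; T \<in> S; cp j \<mu> T \<noteq> 0\<rbrakk> \<Longrightarrow> pole j \<mu> (raise j \<mu> T) =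
        (if \<mu> then y1 j T * qi n q j powi e1 j T else y2 j T * qi n q j powi e2 j T)"
    and residues: "\<And>j T m. \<lbrakk>j \<in> {1..n}; T \<in> S\<rbrakk> \<Longrightarrow>
        psi_residues (qi n q j) (e1 j T) (y1 j T * qi n q j powi e1 j T) (e2 j T) (y2 j T * qi n q j powi e2 j T) m
        = (qi n q j - inverse (qi n q j)) *
          ((cm j True T * cp j True (lower j True T) - cp j True T * cm j True (raise j True T))
             * (y1 j T * qi n q j powi e1 j T) powi m
           + (cm j False T * cp j False (lower j False T) - cp j False T * cm j False (raise j False T))
             * (y2 j T * qi n q j powi e2 j T) powi m)"
    and weights: "\<And>j k \<mu> T. \<lbrakk>j \<in> {1..n}; k \<in> {1..n}; T \<in> S; cm j \<mu> T \<noteq> 0\<rbrakk> \<Longrightarrow>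
        e1 k (lower j \<mu> T) + e2 k (lower j \<mu> T) = e1 k T + e2 k T - cartan n k j"
    and h_eigenvalues: "\<And>j k \<mu> T m. \<lbrakk>j \<in> {1..n}; k \<in> {1..n}; T \<in> S; cm j \<mu> T \<noteq> 0; m \<noteq> 0\<rbrakk> \<Longrightarrow>
        h_eigenvalue (qi n q k) (e1 k (lower j \<mu> T)) (y1 k (lower j \<mu> T)) (e2 k (lower j \<mu> T)) (y2 k (lower j \<mu> T)) m
        = h_eigenvalue (qi n q k) (e1 k T) (y1 k T) (e2 k T) (y2 k T) m
          - 1 / of_int m * qint (qi n q k) (m * cartan n k j) * pole j \<mu> T powi m"
    and top_depth: "depth top_state = 0"
    and top_extremal: "\<And>j \<mu>. j \<in> {1..n} \<Longrightarrow> cp j \<mu> top_state = 0"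
    and raise_exists: "\<And>T. \<lbrakk>T \<in> S; T \<noteq> top_state\<rbrakk> \<Longrightarrow> \<exists>j\<in>{1..n}. \<exists>\<mu>. cp j \<mu> T \<noteq> 0"
    and distinct_lower_poles: "\<And>j \<mu> T. \<lbrakk>j \<in> {1..n}; T \<in> S\<rbrakk> \<Longrightarrow> pole j \<mu> T \<noteq> pole j (\<not> \<mu>) T"
    and distinct_raise_poles: "\<And>j \<mu> T. \<lbrakk>j \<in> {1..n}; T \<in> S\<rbrakk> \<Longrightarrow> pole j \<mu> (raise j \<mu> T) \<noteq> pole j (\<not> \<mu>) (raise j (\<not> \<mu>) T)"
    and type_one: "type_one n q scale act" and irreducible: "uq_irreducible n q scale act"
    and v0_nonzero: "v0 \<noteq> 0"
    and v0_weight: "\<And>j. j \<in> {1..n} \<Longrightarrow> K Plus j v0 = scale (qi n q j powi (e1 j top_state + e2 j top_state)) v0"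
    and v0_killed: "\<And>j r. j \<in> {1..n} \<Longrightarrow> X Plus j r v0 = 0"
    and v0_H: "\<And>j m. \<lbrakk>j \<in> {1..n}; m \<noteq> 0\<rbrakk> \<Longrightarrow>
        H j m v0 = scale (h_eigenvalue (qi n q j) (e1 j top_state) (y1 j top_state) (e2 j top_state) (y2 j top_state) m) v0"
begin

definition wt :: "'s \<Rightarrow> nat \<Rightarrow> int" where
  "wt T k = (if k \<in> {1..n} then e1 k T + e2 k T else 0)"

abbreviation chi :: "nat \<Rightarrow> int \<Rightarrow> 's \<Rightarrow> complex" where
  "chi j m T \<equiv> h_eigenvalue (qi n q j) (e1 j T) (y1 j T) (e2 j T) (y2 j T) m"

text \<open>Mode \<open>r\<close> weights a move by the r-th power of its pole. A move and its
  reverse share one pole, attached to the upper of the two states.\<close>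

definition raise_sum :: "('s \<Rightarrow> 'v) \<Rightarrow> nat \<Rightarrow> int \<Rightarrow> 's \<Rightarrow> 'v" where
  "raise_sum v j r T = (\<Sum>\<mu>\<in>UNIV. scale (cp j \<mu> T * pole j \<mu> (raise j \<mu> T) powi r) (v (raise j \<mu> T)))"

definition lower_sum :: "('s \<Rightarrow> 'v) \<Rightarrow> nat \<Rightarrow> int \<Rightarrow> 's \<Rightarrow> 'v" where
  "lower_sum v j r T = (\<Sum>\<mu>\<in>UNIV. scale (cm j \<mu> T * pole j \<mu> T powi r) (v (lower j \<mu> T)))"

text \<open>The lowering relation is demanded only at depth less than \<open>d\<close>, because its
  right-hand side refers to vectors one step deeper.\<close>

definition realizes_above :: "('s \<Rightarrow> 'v) \<Rightarrow> nat \<Rightarrow> bool" where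
  "realizes_above v d \<longleftrightarrow> v top_state = v0
     \<and> (\<forall>T\<in>S. depth T \<le> d \<longrightarrow> v T \<in> W (wt T) \<and>
          (\<forall>j\<in>{1..n}. (\<forall>m. m \<noteq> 0 \<longrightarrow> H j m (v T) = scale (chi j m T) (v T)) \<and>
             (\<forall>r. X Plus j r (v T) = raise_sum v j r T)))
     \<and> (\<forall>T\<in>S. depth T < d \<longrightarrow> (\<forall>j\<in>{1..n}. \<forall>r. X Minus j r (v T) = lower_sum v j r T))"

lemma raise_depth:
  assumes "j \<in> {1..n}" "T \<in> S" "cp j \<mu> T \<noteq> 0"
  shows "depth T = Suc (depth (raise j \<mu> T))"
  using raise[OF assms] lower[OF assms(1), of "raise j \<mu> T" \<mu>] by auto

lemma depth_0: "T \<in> S \<Longrightarrow> depth T = 0 \<Longrightarrow> T = top_state"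
  using raise_exists[of T] raise_depth by fastforce

lemma wt_lower:
  assumes "j \<in> {1..n}" "T \<in> S" "cm j \<mu> T \<noteq> 0"
  shows "wt (lower j \<mu> T) = (\<lambda>k. wt T k - simple_root n j k)"
  using weights[OF assms(1) _ assms(2,3)] by (auto simp: wt_def simple_root_def)

lemma wt_raise:
  assumes "j \<in> {1..n}" "T \<in> S" "cp j \<mu> T \<noteq> 0"
  shows "wt T = (\<lambda>k. wt (raise j \<mu> T) k - simple_root n j k)"
  using wt_lower[OF assms(1), of "raise j \<mu> T" \<mu>] raise[OF assms] by simp

lemma wt_lattice: "wt T \<in> weight_lattice n"
  by (simp add: wt_def weight_lattice_def)

lemma height_diff: "height n (\<lambda>k. f k - g k) = height n f - height n g"
  by (simp add: height_def left_diff_distrib sum_subtractf)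

lemma height_wt: "T \<in> S \<Longrightarrow> T \<noteq> top_state \<Longrightarrow> height n (wt T) < height n (wt top_state)"
proof (induction "depth T" arbitrary: T rule: less_induct)
  case less
  obtain j \<mu> where j: "j \<in> {1..n}" "cp j \<mu> T \<noteq> 0" using raise_exists less.prems by blast
  note r = raise[OF j(1) less.prems(1) j(2)]
  have "height n (wt T) < height n (wt (raise j \<mu> T))"
    unfolding wt_raise[OF j(1) less.prems(1) j(2)] height_diff using height_simple_root_pos[OF j(1) n] by simp
  then show ?case
    using less.hyps[of "raise j \<mu> T"] r raise_depth[OF j(1) less.prems(1) j(2)]
    by (cases "raise j \<mu> T = top_state") auto
qed

lemma v0_in_W: "v0 \<in> W (wt top_state)"
  using v0_weight by (simp add: W_iff wt_def)

lemma killed_imp_zero: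
  assumes "x \<in> W \<mu>" "\<mu> \<in> weight_lattice n" "height n \<mu> < height n (wt top_state)"
    and "\<And>j r. j \<in> {1..n} \<Longrightarrow> X Plus j r x = 0"
  shows "x = 0"
  by (rule no_primitive_vector[OF n type_one irreducible v0_nonzero v0_in_W wt_lattice assms])

lemma psi_diff:
  assumes v: "realizes_above v d" and T: "T \<in> S" "depth T \<le> d" and j: "j \<in> {1..n}"
  shows "scale (1 / (qi n q j - inverse (qi n q j))) (opr (psi n q Plus j m) (v T) - opr (psi n q Minus j m) (v T))
    = scale ((cm j True T * cp j True (lower j True T) - cp j True T * cm j True (raise j True T))
             * (y1 j T * qi n q j powi e1 j T) powi m
           + (cm j False T * cp j False (lower j False T) - cp j False T * cm j False (raise j False T))
             * (y2 j T * qi n q j powi e2 j T) powi m) (v T)"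
proof -
  have "K Plus j (v T) = scale (qi n q j powi (e1 j T + e2 j T)) (v T)"
    using v T j by (auto simp: realizes_above_def W_iff wt_def)
  moreover have "\<And>m. m \<noteq> 0 \<Longrightarrow> H j m (v T) = scale (chi j m T) (v T)"
    using v T j by (auto simp: realizes_above_def)
  ultimately have "opr (psi n q Plus j m) (v T) - opr (psi n q Minus j m) (v T) =
      scale (psi_residues (qi n q j) (e1 j T) (y1 j T * qi n q j powi e1 j T) (e2 j T) (y2 j T * qi n q j powi e2 j T) m) (v T)"
    using e[OF j T(1)] y poles[OF j T(1)] by (intro opr_psi_diff[OF j]) auto
  then show ?thesis using residues[OF j T(1)] qi_diff_inverse[of j] by simp
qed

text \<open>Predicts the action of \<open>X Plus\<close> on a lowered vector before the vectors one
  step deeper are known: the exchange relation leads back to depth at most \<open>d\<close>. Terms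
  from two different moves match by \<open>commute\<close>; those from a move and its reverse are
  the residues given by \<open>psi_diff\<close>.\<close>

lemma raise_lower:
  assumes v: "realizes_above v d" and T: "T \<in> S" "depth T \<le> d" and jk: "j \<in> {1..n}" "k \<in> {1..n}"
  shows "X Plus k s (X Minus j r (v T)) =
    (\<Sum>\<mu>\<in>UNIV. scale (cm j \<mu> T * pole j \<mu> T powi r) (raise_sum v k s (lower j \<mu> T)))"
proof -
  define L where "L = (\<lambda>\<mu> \<nu>. scale (cm j \<mu> T * pole j \<mu> T powi r *
      (cp k \<nu> (lower j \<mu> T) * pole k \<nu> (raise k \<nu> (lower j \<mu> T)) powi s)) (v (raise k \<nu> (lower j \<mu> T))))"
  define R where "R = (\<lambda>\<mu> \<nu>. scale (cp k \<nu> T * pole k \<nu> (raise k \<nu> T) powi s *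
      (cm j \<mu> (raise k \<nu> T) * pole j \<mu> (raise k \<nu> T) powi r)) (v (lower j \<mu> (raise k \<nu> T))))"
  have rhs: "(\<Sum>\<mu>\<in>UNIV. scale (cm j \<mu> T * pole j \<mu> T powi r) (raise_sum v k s (lower j \<mu> T))) = (\<Sum>\<mu>\<in>UNIV. \<Sum>\<nu>\<in>UNIV. L \<mu> \<nu>)"
    by (simp add: raise_sum_def vs.scale_sum_right L_def)
  have "X Minus j r (X Plus k s (v T)) = X Minus j r (raise_sum v k s T)"
    using v T jk by (simp add: realizes_above_def)
  also have "\<dots> = (\<Sum>\<nu>\<in>UNIV. scale (cp k \<nu> T * pole k \<nu> (raise k \<nu> T) powi s) (X Minus j r (v (raise k \<nu> T))))"
    using jk by (simp add: raise_sum_def X_linear)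
  also have "\<dots> = (\<Sum>\<nu>\<in>UNIV. \<Sum>\<mu>\<in>UNIV. R \<mu> \<nu>)"
  proof (rule sum.cong[OF refl])
    fix \<nu>
    show "scale (cp k \<nu> T * pole k \<nu> (raise k \<nu> T) powi s) (X Minus j r (v (raise k \<nu> T))) = (\<Sum>\<mu>\<in>UNIV. R \<mu> \<nu>)"
    proof (cases "cp k \<nu> T = 0")
      case False
      have "X Minus j r (v (raise k \<nu> T)) = lower_sum v j r (raise k \<nu> T)"
        using v jk raise[OF jk(2) T(1) False] raise_depth[OF jk(2) T(1) False] T(2) by (simp add: realizes_above_def)
      then show ?thesis by (simp add: lower_sum_def vs.scale_sum_right R_def)
    qed (simp add: R_def)
  qed
  finally have XmXp: "X Minus j r (X Plus k s (v T)) = (\<Sum>\<nu>\<in>UNIV. \<Sum>\<mu>\<in>UNIV. R \<mu> \<nu>)" .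
  have LR: "L \<mu> \<nu> = R \<mu> \<nu>" if ne: "(j, \<mu>) \<noteq> (k, \<nu>)" for \<mu> \<nu>
  proof (cases "cm j \<mu> T * cp k \<nu> (lower j \<mu> T) = 0")
    case True
    then have "cp k \<nu> T * cm j \<mu> (raise k \<nu> T) = 0" using commute[OF jk T(1) ne] by simp
    with True show ?thesis by (auto simp: L_def R_def)
  next
    case False
    then have s: "raise k \<nu> (lower j \<mu> T) = lower j \<mu> (raise k \<nu> T)"
        "pole k \<nu> (lower j \<mu> (raise k \<nu> T)) = pole k \<nu> (raise k \<nu> T)" "pole j \<mu> (raise k \<nu> T) = pole j \<mu> T"
      using commute_states[OF jk T(1) ne] by auto
    have "cm j \<mu> T * pole j \<mu> T powi r * (cp k \<nu> (lower j \<mu> T) * pole k \<nu> (raise k \<nu> T) powi s)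
        = (cm j \<mu> T * cp k \<nu> (lower j \<mu> T)) * pole j \<mu> T powi r * pole k \<nu> (raise k \<nu> T) powi s"
      by simp
    also have "\<dots> = cp k \<nu> T * pole k \<nu> (raise k \<nu> T) powi s * (cm j \<mu> (raise k \<nu> T) * pole j \<mu> T powi r)"
      unfolding commute[OF jk T(1) ne] by simp
    finally show ?thesis by (simp add: L_def R_def s)
  qed
  show ?thesis
  proof (cases "j = k")
    case False
    then have "L \<mu> \<nu> = R \<mu> \<nu>" for \<mu> \<nu> using LR by blast
    then show ?thesis unfolding rhs using X_X[OF jk(2,1)] False XmXp by (simp add: UNIV_bool)
  next
    case True
    define p where "p = (\<lambda>\<mu>. if \<mu> then y1 j T * qi n q j powi e1 j T else y2 j T * qi n q j powi e2 j T)"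
    have p0: "p \<mu> \<noteq> 0" for \<mu> using y by (simp add: p_def)
    have L: "L \<mu> \<mu> = scale (cm j \<mu> T * cp j \<mu> (lower j \<mu> T) * p \<mu> powi (s + r)) (v T)" for \<mu>
      using lower[OF jk(1) T(1), of \<mu>] lower_pole[OF jk(1) T(1), of \<mu>] True p0[of \<mu>]
      by (cases "cm j \<mu> T = 0") (simp_all add: L_def p_def[symmetric] power_int_add mult_ac, simp_all add: p_def)
    have R: "R \<mu> \<mu> = scale (cp j \<mu> T * cm j \<mu> (raise j \<mu> T) * p \<mu> powi (s + r)) (v T)" for \<mu>
      using raise[OF jk(1) T(1), of \<mu>] raise_pole[OF jk(1) T(1), of \<mu>] True p0[of \<mu>]
      by (cases "cp j \<mu> T = 0") (simp_all add: R_def p_def[symmetric] power_int_add mult_ac, simp_all add: p_def)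
    have off: "L True False = R True False" "L False True = R False True" using LR by auto
    have "X Plus k s (X Minus j r (v T)) = (\<Sum>\<nu>\<in>UNIV. \<Sum>\<mu>\<in>UNIV. R \<mu> \<nu>) +
        scale ((cm j True T * cp j True (lower j True T) - cp j True T * cm j True (raise j True T)) * p True powi (s + r)
           + (cm j False T * cp j False (lower j False T) - cp j False T * cm j False (raise j False T)) * p False powi (s + r)) (v T)"
      using X_X[OF jk(2,1), of s r "v T"] XmXp True psi_diff[OF v T jk(1), of "s + r"] by (simp add: p_def)
    then show ?thesis
      unfolding rhs unfolding UNIV_bool
      by (simp add: off L R vs.scale_left_distrib vs.scale_left_diff_distrib left_diff_distrib)
  qed
qed

lemma realizes_above_0: "realizes_above (\<lambda>_. v0) 0"
proof -
  have "T = top_state" if "T \<in> S" "depth T = 0" for T using depth_0 that by blast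
  then show ?thesis
    using v0_in_W v0_H v0_killed top_extremal by (auto simp: realizes_above_def raise_sum_def)
qed

text \<open>A new vector is characterised by the action of the raising operators. One parent gives
  existence; the relations for \<open>H\<close> and \<open>X Minus\<close> hold because the
  difference of their two sides is killed by all raising operators.\<close>

lemma realizes_above_Suc:
  assumes v: "realizes_above v d"
  shows "\<exists>v'. realizes_above v' (Suc d)"
proof -
  have "\<exists>x. x \<in> W (wt T) \<and> (\<forall>k\<in>{1..n}. \<forall>s. X Plus k s x = raise_sum v k s T)" if T: "T \<in> S" "depth T = Suc d" for T
  proof -
    have "T \<noteq> top_state" using T top_depth by auto
    then obtain j \<mu> where j: "j \<in> {1..n}" "cp j \<mu> T \<noteq> 0" using raise_exists T by blast
    define T1 where "T1 = raise j \<mu> T"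
    have T1: "T1 \<in> S" "depth T1 = d" "lower j \<mu> T1 = T" "cm j \<mu> T1 \<noteq> 0"
      using raise[OF j(1) T(1) j(2)] raise_depth[OF j(1) T(1) j(2)] T by (auto simp: T1_def)
    \<comment> \<open>Modes 1 and 0 weight the two moves by their poles and by 1, so subtracting the
      other pole times mode 0 removes the unwanted move. The constant normalises what is
      left.\<close>
    define c where "c = 1 / (cm j \<mu> T1 * (pole j \<mu> T1 - pole j (\<not> \<mu>) T1))"
    define x where "x = scale c (X Minus j 1 (v T1) - scale (pole j (\<not> \<mu>) T1) (X Minus j 0 (v T1)))"
    have "v T1 \<in> W (wt T1)" using v T1 by (simp add: realizes_above_def)
    then have "X Minus j r (v T1) \<in> W (wt T)" for r
      using X_weight[OF j(1), of "v T1" "wt T1" Minus r] wt_lower[OF j(1) T1(1,4)] T1(3) by simp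
    then have "x \<in> W (wt T)"
      unfolding x_def by (intro vs.subspace_scale vs.subspace_diff W_subspace)
    moreover have "X Plus k s x = raise_sum v k s T" if k: "k \<in> {1..n}" for k s
    proof -
      have *: "X Plus k s (X Minus j r (v T1)) =
          scale (cm j \<mu> T1 * pole j \<mu> T1 powi r) (raise_sum v k s T) +
          scale (cm j (\<not> \<mu>) T1 * pole j (\<not> \<mu>) T1 powi r) (raise_sum v k s (lower j (\<not> \<mu>) T1))" for r
        using raise_lower[OF v T1(1) _ j(1) k, of s r] T1(2,3) by (cases \<mu>) (simp_all add: UNIV_bool add.commute)
      have "X Plus k s x = scale c (X Plus k s (X Minus j 1 (v T1)) - scale (pole j (\<not> \<mu>) T1) (X Plus k s (X Minus j 0 (v T1))))"
        using k by (simp add: x_def X_linear)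
      also have "\<dots> = scale (c * (cm j \<mu> T1 * (pole j \<mu> T1 - pole j (\<not> \<mu>) T1))) (raise_sum v k s T)"
        unfolding * by (simp add: vs.scale_right_distrib vs.scale_right_diff_distrib algebra_simps vs.scale_left_diff_distrib)
      also have "c * (cm j \<mu> T1 * (pole j \<mu> T1 - pole j (\<not> \<mu>) T1)) = 1"
        using T1(4) distinct_lower_poles[OF j(1) T1(1)] by (simp add: c_def)
      finally show ?thesis by simp
    qed
    ultimately show ?thesis by blast
  qed
  then obtain w where w: "\<And>T. T \<in> S \<Longrightarrow> depth T = Suc d \<Longrightarrow> w T \<in> W (wt T)"
      "\<And>T k s. T \<in> S \<Longrightarrow> depth T = Suc d \<Longrightarrow> k \<in> {1..n} \<Longrightarrow> X Plus k s (w T) = raise_sum v k s T"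
    by metis
  define v' where "v' = (\<lambda>T. if depth T = Suc d then w T else v T)"
  have v': "v' T = v T" if "depth T \<le> d" for T using that by (simp add: v'_def)
  \<comment> \<open>Raising from depth at most d + 1 meets only vectors that were not
    redefined.\<close>
  have raise_sum': "raise_sum v' k s T = raise_sum v k s T" if "k \<in> {1..n}" "T \<in> S" "depth T \<le> Suc d" for k s T
    unfolding raise_sum_def
  proof (rule sum.cong[OF refl])
    fix \<mu>
    show "scale (cp k \<mu> T * pole k \<mu> (raise k \<mu> T) powi s) (v' (raise k \<mu> T)) =
        scale (cp k \<mu> T * pole k \<mu> (raise k \<mu> T) powi s) (v (raise k \<mu> T))"
      using raise_depth[of k T \<mu>] that v' by (cases "cp k \<mu> T = 0") auto
  qed
  have weight: "v' T \<in> W (wt T)" if "T \<in> S" "depth T \<le> Suc d" for T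
    using that v w(1) by (cases "depth T = Suc d") (auto simp: v'_def realizes_above_def)
  have X_plus: "X Plus k s (v' T) = raise_sum v' k s T" if "k \<in> {1..n}" "T \<in> S" "depth T \<le> Suc d" for k s T
    unfolding raise_sum'[OF that] using that v w(2) by (cases "depth T = Suc d") (auto simp: v'_def realizes_above_def)
  \<comment> \<open>The eigenvalues at \<open>T\<close> and at a state above it differ by exactly
    the term that the relation between \<open>h\<close> and \<open>x\<^sup>+\<close>
    produces.\<close>
  have H_v': "H j m (v' T) = scale (chi j m T) (v' T)"
    if j: "j \<in> {1..n}" and T: "T \<in> S" "depth T \<le> Suc d" and m: "m \<noteq> 0" for j m T
  proof (cases "depth T = Suc d")
    case False
    then show ?thesis using that v by (simp add: v'_def realizes_above_def)
  next
    case True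
    have "H j m (v' T) - scale (chi j m T) (v' T) = 0"
    proof (rule killed_imp_zero)
      show "H j m (v' T) - scale (chi j m T) (v' T) \<in> W (wt T)"
        using weight[OF T] H_weight[OF j m] by (intro vs.subspace_diff vs.subspace_scale W_subspace)
      show "height n (wt T) < height n (wt top_state)" using T(1) True top_depth by (intro height_wt) auto
      fix k s assume k: "k \<in> {1..n}"
      let ?a = "1 / of_int m * qint (qi n q j) (m * cartan n j k)"
      have "X Plus k s (H j m (v' T)) = H j m (X Plus k s (v' T)) - scale ?a (X Plus k (m + s) (v' T))"
        using H_X[OF j k m, of Plus s "v' T"] by simp
      also have "\<dots> = (\<Sum>\<nu>\<in>UNIV. scale (cp k \<nu> T * pole k \<nu> (raise k \<nu> T) powi s) (H j m (v' (raise k \<nu> T))))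
          - (\<Sum>\<nu>\<in>UNIV. scale (?a * (cp k \<nu> T * pole k \<nu> (raise k \<nu> T) powi (m + s))) (v' (raise k \<nu> T)))"
        unfolding X_plus[OF k T] raise_sum_def using j m by (simp add: H_linear vs.scale_sum_right)
      also have "\<dots> = (\<Sum>\<nu>\<in>UNIV. scale (cp k \<nu> T * pole k \<nu> (raise k \<nu> T) powi s) (scale (chi j m T) (v' (raise k \<nu> T))))"
        unfolding sum_subtractf[symmetric]
      proof (rule sum.cong[OF refl])
        fix \<nu>
        show "scale (cp k \<nu> T * pole k \<nu> (raise k \<nu> T) powi s) (H j m (v' (raise k \<nu> T)))
           - scale (?a * (cp k \<nu> T * pole k \<nu> (raise k \<nu> T) powi (m + s))) (v' (raise k \<nu> T))
           = scale (cp k \<nu> T * pole k \<nu> (raise k \<nu> T) powi s) (scale (chi j m T) (v' (raise k \<nu> T)))"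
        proof (cases "cp k \<nu> T = 0")
          case False
          define p where "p = pole k \<nu> (raise k \<nu> T)"
          note r = raise[OF k T(1) False]
          have "depth (raise k \<nu> T) \<le> d" using raise_depth[OF k T(1) False] True by simp
          then have H1: "H j m (v' (raise k \<nu> T)) = scale (chi j m (raise k \<nu> T)) (v' (raise k \<nu> T))"
            using v r j m v' by (simp add: realizes_above_def)
          have chi: "chi j m T = chi j m (raise k \<nu> T) - ?a * p powi m"
            using h_eigenvalues[of k j "raise k \<nu> T" \<nu> m] r j k m by (simp add: p_def)
          have "p \<noteq> 0" using raise_pole[OF k T(1) False] y by (simp add: p_def)
          then have "p powi (m + s) = p powi m * p powi s" by (simp add: power_int_add)
          then show ?thesis unfolding H1 chi p_def[symmetric]
            by (simp add: algebra_simps flip: vs.scale_left_diff_distrib)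
        qed simp
      qed
      also have "\<dots> = scale (chi j m T) (X Plus k s (v' T))"
        unfolding X_plus[OF k T] raise_sum_def by (simp add: vs.scale_sum_right mult.commute)
      finally show "X Plus k s (H j m (v' T) - scale (chi j m T) (v' T)) = 0"
        using k by (simp add: X_linear)
    qed (rule wt_lattice)
    then show ?thesis by simp
  qed
  \<comment> \<open>By \<open>raise_lower\<close> both sides have the same image under every raising
    operator.\<close>
  have X_minus: "X Minus j r (v' T) = lower_sum v' j r T" if j: "j \<in> {1..n}" and T: "T \<in> S" "depth T < Suc d" for j r T
  proof -
    have vT: "v' T = v T" using T v' by simp
    have "X Minus j r (v' T) - lower_sum v' j r T = 0"
    proof (rule killed_imp_zero[where \<mu> = "\<lambda>k. wt T k - simple_root n j k"])
      have "X Minus j r (v' T) \<in> W (\<lambda>k. wt T k - simple_root n j k)"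
        using X_weight[OF j weight[OF T(1)], of Minus r] T by simp
      moreover have "scale (cm j \<mu> T * pole j \<mu> T powi r) (v' (lower j \<mu> T)) \<in> W (\<lambda>k. wt T k - simple_root n j k)" for \<mu>
      proof (cases "cm j \<mu> T = 0")
        case False
        then show ?thesis using lower[OF j T(1) False] T(2) weight[of "lower j \<mu> T"] wt_lower[OF j T(1) False]
          by (auto intro!: vs.subspace_scale W_subspace)
      qed (simp add: vs.subspace_0 W_subspace)
      then have "lower_sum v' j r T \<in> W (\<lambda>k. wt T k - simple_root n j k)"
        unfolding lower_sum_def by (intro vs.subspace_sum W_subspace)
      ultimately show "X Minus j r (v' T) - lower_sum v' j r T \<in> W (\<lambda>k. wt T k - simple_root n j k)"
        by (intro vs.subspace_diff W_subspace)
      show "(\<lambda>k. wt T k - simple_root n j k) \<in> weight_lattice n"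
        by (simp add: weight_lattice_def wt_def simple_root_def)
      have "height n (wt T) \<le> height n (wt top_state)" using height_wt[OF T(1)] by (cases "T = top_state") auto
      then show "height n (\<lambda>k. wt T k - simple_root n j k) < height n (wt top_state)"
        unfolding height_diff using height_simple_root_pos[OF j n] by simp
      fix k s assume k: "k \<in> {1..n}"
      have "X Plus k s (X Minus j r (v' T)) = (\<Sum>\<mu>\<in>UNIV. scale (cm j \<mu> T * pole j \<mu> T powi r) (raise_sum v k s (lower j \<mu> T)))"
        unfolding vT using raise_lower[OF v T(1) _ j k] T(2) by simp
      also have "\<dots> = (\<Sum>\<mu>\<in>UNIV. scale (cm j \<mu> T * pole j \<mu> T powi r) (X Plus k s (v' (lower j \<mu> T))))"
      proof (rule sum.cong[OF refl])
        fix \<mu>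
        show "scale (cm j \<mu> T * pole j \<mu> T powi r) (raise_sum v k s (lower j \<mu> T)) =
            scale (cm j \<mu> T * pole j \<mu> T powi r) (X Plus k s (v' (lower j \<mu> T)))"
        proof (cases "cm j \<mu> T = 0")
          case False
          then have "lower j \<mu> T \<in> S" "depth (lower j \<mu> T) \<le> Suc d" using lower[OF j T(1) False] T(2) by auto
          then show ?thesis using X_plus[OF k] raise_sum'[OF k] by simp
        qed simp
      qed
      also have "\<dots> = X Plus k s (lower_sum v' j r T)"
        using k by (simp add: lower_sum_def X_linear)
      finally show "X Plus k s (X Minus j r (v' T) - lower_sum v' j r T) = 0"
        using k by (simp add: X_linear)
    qed
    then show ?thesis by simp
  qed
  have "realizes_above v' (Suc d)"
    using weight H_v' X_plus X_minus v v' top_depth by (simp add: realizes_above_def)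
  then show ?thesis by blast
qed

theorem realization:
  obtains v where "v top_state = v0" "\<And>T. T \<in> S \<Longrightarrow> v T \<noteq> 0" "\<And>T. T \<in> S \<Longrightarrow> v T \<in> W (wt T)"
    "\<And>T j m. T \<in> S \<Longrightarrow> j \<in> {1..n} \<Longrightarrow> m \<noteq> 0 \<Longrightarrow> H j m (v T) = scale (chi j m T) (v T)"
    "vs.span (v ` S) = UNIV"
proof -
  have "\<exists>v. realizes_above v d" for d
    by (induction d) (use realizes_above_0 realizes_above_Suc in blast)+
  \<comment> \<open>One more than the maximal depth, so that the lowering relation is available on
    all of \<open>S\<close>.\<close>
  moreover define d where "d = Suc (Max (depth ` S))"
  ultimately obtain v where v: "realizes_above v d" by blast
  have d: "depth T < d" if "T \<in> S" for T
    using finite_S that by (simp add: d_def less_Suc_eq_le)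
  have v_top: "v top_state = v0" using v by (simp add: realizes_above_def)
  have weight: "v T \<in> W (wt T)" if "T \<in> S" for T
    using v d[OF that] that by (simp add: realizes_above_def)
  have Hv: "H j m (v T) = scale (chi j m T) (v T)" if "T \<in> S" "j \<in> {1..n}" "m \<noteq> 0" for T j m
    using v d[OF that(1)] that by (simp add: realizes_above_def)
  have Xp: "X Plus j r (v T) = raise_sum v j r T" if "T \<in> S" "j \<in> {1..n}" for T j r
    using v d[OF that(1)] that by (simp add: realizes_above_def)
  have Xm: "X Minus j r (v T) = lower_sum v j r T" if "T \<in> S" "j \<in> {1..n}" for T j r
    using v d[OF that(1)] that by (simp add: realizes_above_def)
  have nz: "v T \<noteq> 0" if "T \<in> S" for T
    using that
  proof (induction "depth T" arbitrary: T rule: less_induct)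
    case less
    show ?case
    proof (cases "T = top_state")
      case False
      then obtain j \<mu> where j: "j \<in> {1..n}" "cp j \<mu> T \<noteq> 0" using raise_exists less.prems by blast
      \<comment> \<open>The same elimination as in the construction, now with the poles of the
        raising moves: a vanishing \<open>v T\<close> would force the vector above it to
        vanish.\<close>
      define p p' where "p = pole j \<mu> (raise j \<mu> T)" "p' = pole j (\<not> \<mu>) (raise j (\<not> \<mu>) T)"
      have "v (raise j \<mu> T) \<noteq> 0"
        using less.hyps raise[OF j(1) less.prems j(2)] raise_depth[OF j(1) less.prems j(2)] by simp
      moreover have "p \<noteq> p'" unfolding p_p'_def by (rule distinct_raise_poles[OF j(1) less.prems])
      moreover have "X Plus j 1 (v T) - scale p' (X Plus j 0 (v T)) = scale (cp j \<mu> T * (p - p')) (v (raise j \<mu> T))"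
        unfolding Xp[OF less.prems j(1)]
        by (cases \<mu>) (simp_all add: raise_sum_def p_p'_def UNIV_bool vs.scale_right_distrib algebra_simps
            vs.scale_left_diff_distrib)
      ultimately have "X Plus j 1 (v T) - scale p' (X Plus j 0 (v T)) \<noteq> 0" using j(2) by simp
      then show ?thesis using j(1) by (auto simp: X_linear)
    qed (simp add: v_top v0_nonzero)
  qed
  have "vs.span (v ` S) = UNIV"
  proof -
    have gen: "opr (gen g) (v T) \<in> vs.span (v ` S)" if g: "g \<in> uq_gens n" and T: "T \<in> S" for g T
    proof -
      have vT: "v T \<in> vs.span (v ` S)" using T by (auto intro: vs.span_base)
      have KK: "K e j (v T) \<in> vs.span (v ` S)" if j: "j \<in> {1..n}" for e j
      proof (cases e)
        case Plus
        then show ?thesis using j weight[OF T] vT by (auto simp: W_iff intro: vs.span_scale)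
      next
        case Minus
        then show ?thesis using K_Minus_weight[OF j weight[OF T]] vT by (auto intro: vs.span_scale)
      qed
      have lowers: "scale (cm j \<mu> T * c) (v (lower j \<mu> T)) \<in> vs.span (v ` S)" if "j \<in> {1..n}" for j \<mu> c
        using lower[OF that T, of \<mu>]
        by (cases "cm j \<mu> T = 0") (auto simp: vs.span_zero intro: vs.span_scale vs.span_base)
      have raises: "scale (cp j \<mu> T * c) (v (raise j \<mu> T)) \<in> vs.span (v ` S)" if "j \<in> {1..n}" for j \<mu> c
        using raise[OF that T, of \<mu>]
        by (cases "cp j \<mu> T = 0") (auto simp: vs.span_zero intro: vs.span_scale vs.span_base)
      have XX: "X e j r (v T) \<in> vs.span (v ` S)" if j: "j \<in> {1..n}" for e j r
        using Xp[OF T j] Xm[OF T j] lowers[OF j] raises[OF j]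
        by (cases e) (auto simp: raise_sum_def lower_sum_def intro!: vs.span_sum)
      show ?thesis using g KK XX Hv[OF T] vT by (auto simp: uq_gens_def intro: vs.span_scale)
    qed
    have inv: "act a x \<in> vs.span (v ` S)" if "a \<in> carrier (Uq n q)" "x \<in> vs.span (v ` S)" for a x
    proof (rule invariant_if_generators[OF vs.subspace_span _ that])
      fix g w assume g: "g \<in> uq_gens n" and w: "w \<in> vs.span (v ` S)"
      have c: "gen g \<in> carrier (free_alg n)" using g by (rule free_alg_gen)
      show "opr (gen g) w \<in> vs.span (v ` S)" using w
        by (induction rule: vs.span_induct_alt)
          (auto simp: opr_linear_simps[OF c] vs.span_zero gen[OF g] intro!: vs.span_add vs.span_scale)
    qed
    have "v0 \<in> vs.span (v ` S)" using v_top top_S by (metis image_eqI vs.span_base)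
    then show ?thesis
      using irreducible inv vs.subspace_span v0_nonzero unfolding uq_irreducible_def by blast
  qed
  then show ?thesis using that v_top nz weight Hv by blast
qed

end

section \<open>Columns of type \<open>C\<^sub>n\<close>\<close>

type_synonym state = "(nat \<Rightarrow> int) \<times> (nat \<Rightarrow> int)"

text \<open>
  A state \<open>(a, b)\<close> encodes a column of height \<open>i\<close> in the alphabet \<open>1 < \<dots> < n < -n < \<dots> < -1\<close>:
  \<open>a j\<close> and \<open>b j\<close> count the entries in \<open>{1..j}\<close> and in \<open>{-j..-1}\<close>.  Admissibility of the column
  says that at most \<open>n - j\<close> entries have absolute value greater than \<open>j\<close>, i.e. \<open>0 \<le> excess T j\<close>.
\<close>

locale type_C_fund = uq_rep n q scale act
  for n q and scale :: "complex \<Rightarrow> 'v::ab_group_add \<Rightarrow> 'v" and act +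
  fixes i :: nat
  assumes i: "1 < i" "i \<le> n"
begin

text \<open>Indicates whether the letter \<open>j\<close> (for \<open>a\<close>) or
  \<open>-j\<close> (for \<open>b\<close>) occurs. The counts are 0 beyond \<open>n\<close>, and the
  guard prevents a spurious negative value at \<open>n + 1\<close>.\<close>

definition inc :: "(nat \<Rightarrow> int) \<Rightarrow> nat \<Rightarrow> int" where
  "inc a j = (if j \<le> n then a j - a (j - 1) else 0)"

definition excess :: "state \<Rightarrow> nat \<Rightarrow> int" where
  "excess T j = int n - int j - int i + fst T j + snd T j"

definition states :: "state set" where
  "states = {(a, b). a 0 = 0 \<and> b 0 = 0 \<and> (\<forall>j>n. a j = 0 \<and> b j = 0) \<and>
     (\<forall>j\<in>{1..n}. inc a j \<in> {0, 1} \<and> inc b j \<in> {0, 1}) \<and> a n + b n = int i \<and> (\<forall>j\<le>n. 0 \<le> excess (a, b) j)}"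

definition br :: "int \<Rightarrow> complex" where
  "br m = q powi m - q powi (- m)"

text \<open>The value of one factor of \<psi> at the pole of the other: \<open>x\<close> is an
  excess, \<open>e\<close> up to sign the exponent of the evaluated factor. The zero at
  \<open>x = 0\<close>, \<open>e = 1\<close> blocks moves out of the admissible columns. Where a
  coefficient has \<open>e = -1\<close>, both \<open>j\<close> and \<open>-j\<close> occur and
  \<open>excess_bounds\<close> gives \<open>1 \<le> x\<close>, so there is no division by 0.\<close>

definition rho :: "int \<Rightarrow> int \<Rightarrow> complex" where
  "rho x e = (if e = 1 then br x / br (x + 1) else if e = - 1 then br (x + 1) / br x else 1)"

text \<open>\<open>True\<close> turns the letter \<open>j\<close> into \<open>j + 1\<close>, or
  \<open>n\<close> into \<open>-n\<close>; \<open>False\<close> turns \<open>-(j + 1)\<close> into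
  \<open>-j\<close>. Only the counts at \<open>j\<close> change.\<close>

definition lowering :: "nat \<Rightarrow> bool \<Rightarrow> state \<Rightarrow> state" where
  "lowering j \<mu> T = (case T of (a, b) \<Rightarrow>
     if \<mu> then (a(j := a j - 1), if j = n then b(n := b n + 1) else b) else (a, b(j := b j + 1)))"

definition raising :: "nat \<Rightarrow> bool \<Rightarrow> state \<Rightarrow> state" where
  "raising j \<mu> T = (case T of (a, b) \<Rightarrow>
     if \<mu> then (a(j := a j + 1), if j = n then b(n := b n - 1) else b) else (a, b(j := b j - 1)))"

text \<open>Residues fix only the product of the coefficients of a move and its reverse. The factor
  \<open>rho\<close> is placed on lowering for \<open>True\<close> and on raising for
  \<open>False\<close>, with 1 on the reverse.\<close>

definition lower_coeff :: "nat \<Rightarrow> bool \<Rightarrow> state \<Rightarrow> complex" where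
  "lower_coeff j \<mu> T = (case T of (a, b) \<Rightarrow>
     if \<mu> then
       if j = n then if inc a n = 1 \<and> inc b n = 0 then 1 else 0
       else if inc a j = 1 \<and> inc a (j + 1) = 0 then rho (excess T j) (inc b (j + 1) - inc b j) else 0
     else if j \<noteq> n \<and> inc b j = 0 \<and> inc b (j + 1) = 1 then 1 else 0)"

definition raise_coeff :: "nat \<Rightarrow> bool \<Rightarrow> state \<Rightarrow> complex" where
  "raise_coeff j \<mu> T = (case T of (a, b) \<Rightarrow>
     if \<mu> then
       if j = n then if inc a n = 0 \<and> inc b n = 1 then 1 else 0
       else if inc a j = 0 \<and> inc a (j + 1) = 1 then 1 else 0
     else if j \<noteq> n \<and> inc b j = 1 \<and> inc b (j + 1) = 0 then rho (excess T j) (inc a (j + 1) - inc a j) else 0)"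

text \<open>The value for \<open>False\<close> at \<open>n\<close> belongs to a move with
  coefficient 0; it differs in parity from the value for \<open>True\<close>.\<close>

definition pole_exp :: "nat \<Rightarrow> bool \<Rightarrow> state \<Rightarrow> int" where
  "pole_exp j \<mu> T = (case T of (a, b) \<Rightarrow>
     if \<mu> then int i + int j - 2 * a j + (if j = n then 1 else 0) else 2 * int n + 2 - int i - int j + 2 * b j)"

text \<open>At the node \<open>n\<close> at most one factor is nontrivial; it is always listed first.\<close>

definition exp1 :: "nat \<Rightarrow> state \<Rightarrow> int" where
  "exp1 j T = (case T of (a, b) \<Rightarrow> if j = n then inc a n - inc b n else inc a j - inc a (j + 1))"

definition exp2 :: "nat \<Rightarrow> state \<Rightarrow> int" where
  "exp2 j T = (case T of (a, b) \<Rightarrow> if j = n then 0 else inc b (j + 1) - inc b j)"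

text \<open>At \<open>n\<close> the exponent is 1 for the letter \<open>n\<close> and -1 for
  \<open>-n\<close>. The move between them raises both \<open>b n\<close> and
  \<open>inc b n\<close>, which gives the shift by 4, that is, by
  \<open>q\<^sub>n\<^sup>2\<close>.\<close>

definition spec1 :: "nat \<Rightarrow> state \<Rightarrow> int" where
  "spec1 j T = (case T of (a, b) \<Rightarrow>
     if j = n then int n - int i - 1 + 2 * b n + 2 * inc b n else int i + int j - 2 * a j - 1)"

text \<open>At \<open>n\<close> this is a dummy, as \<open>exp2\<close> is 0 there; its parity is
  opposite to that of the first pole, so that the two formal poles differ.\<close>

definition spec2 :: "nat \<Rightarrow> state \<Rightarrow> int" where
  "spec2 j T = (case T of (a, b) \<Rightarrow>
     if j = n then int n - int i + 2 * b n else 2 * int n + 1 - int i - int j + 2 * b j)"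

definition top_state :: state where
  "top_state = (\<lambda>j. if j \<le> n then int (min j i) else 0, \<lambda>_. 0)"

text \<open>The count \<open>snd T n\<close> is left out because the move at \<open>n\<close>
  changes both counts there and must lower the level by 1 only.\<close>

definition level :: "state \<Rightarrow> int" where
  "level T = (\<Sum>j=1..<n. fst T j - snd T j) + fst T n"

definition depth :: "state \<Rightarrow> nat" where
  "depth T = nat (level top_state - level T)"

lemma br_0 [simp]: "br 0 = 0"
  by (simp add: br_def)

lemma br_eq_0_iff [simp]: "br m = 0 \<longleftrightarrow> m = 0"
  by (simp add: br_def q_powi_eq_iff)

lemma rho_simps: "rho x 0 = 1" "rho x 1 = br x / br (x + 1)" "rho x (- 1) = br (x + 1) / br x"
  by (simp_all add: rho_def)

lemma n_ge_2: "2 \<le> n"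
  using i by simp

lemma states_inc:
  assumes "(a, b) \<in> states"
  shows "inc a j \<in> {0, 1} \<or> j = 0" "inc b j \<in> {0, 1} \<or> j = 0"
proof -
  have "inc a j \<in> {0, 1} \<and> inc b j \<in> {0, 1}" if "j \<noteq> 0"
    using assms that by (cases "j \<le> n") (auto simp: states_def, auto simp: inc_def)
  then show "inc a j \<in> {0, 1} \<or> j = 0" "inc b j \<in> {0, 1} \<or> j = 0" by auto
qed

lemma excess_pred:
  assumes "j \<in> {1..n}"
  shows "excess (a, b) (j - 1) = excess (a, b) j + 1 - inc a j - inc b j"
  using assms by (simp add: excess_def inc_def of_nat_diff)

lemma excess_nonneg: "T \<in> states \<Longrightarrow> j \<le> n \<Longrightarrow> 0 \<le> excess T j"
  by (cases T) (auto simp: states_def)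

lemma excess_n: "T \<in> states \<Longrightarrow> excess T n = 0"
  by (cases T) (auto simp: states_def excess_def)

lemma excess_bounds:
  assumes T: "(a, b) \<in> states" and j: "j \<in> {1..n}"
  shows "0 \<le> excess (a, b) j + 1 - inc a j - inc b j"
proof -
  have "0 \<le> excess (a, b) (j - 1)" using j by (intro excess_nonneg[OF T]) auto
  then show ?thesis using excess_pred[OF j, of a b] by simp
qed

lemma excess_Suc:
  assumes "j < n"
  shows "excess (a, b) j = excess (a, b) (j + 1) + 1 - inc a (j + 1) - inc b (j + 1)"
  using excess_pred[of "j + 1" a b] assms by simp

text \<open>The excess is 0 at \<open>n\<close>; its nonnegativity at \<open>n - 1\<close> forbids
  \<open>n\<close> and \<open>-n\<close> from occurring together.\<close>

lemma states_last:
  assumes "(a, b) \<in> states"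
  shows "inc a n + inc b n \<le> 1"
  using excess_bounds[OF assms, of n] excess_n[OF assms] n_ge_2 by simp

lemma statesI:
  assumes "(a, b) \<in> states" "a' 0 = 0" "b' 0 = 0" "\<And>j. j > n \<Longrightarrow> a' j = a j \<and> b' j = b j"
    and "\<And>j. j \<in> {1..n} \<Longrightarrow> inc a' j \<in> {0, 1} \<and> inc b' j \<in> {0, 1}"
    and "a' n + b' n = a n + b n" "\<And>j. j \<le> n \<Longrightarrow> 0 \<le> excess (a', b') j"
  shows "(a', b') \<in> states"
  using assms by (auto simp: states_def)

lemma inc_upd:
  assumes "j \<in> {1..n}"
  shows "inc (a(j := c)) k = (if k = j then inc a j + (c - a j) else if k = j + 1 \<and> k \<le> n then inc a k - (c - a j) else inc a k)"
  using assms by (auto simp: inc_def)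

lemma excess_upd:
  "excess (a(j := c), b) k = (if k = j then excess (a, b) j + (c - a j) else excess (a, b) k)"
  "excess (a, b(j := c)) k = (if k = j then excess (a, b) j + (c - b j) else excess (a, b) k)"
  by (auto simp: excess_def)

text \<open>The move lowers the excess at \<open>j\<close> by 1. If this excess were 0,
  admissibility at \<open>j - 1\<close> and \<open>j + 1\<close> would force \<open>-(j + 1)\<close>
  to occur and \<open>-j\<close> to be absent, and the coefficient would be
  \<open>rho 0 1 = 0\<close>.\<close>

lemma lower_coeff_imp_excess:
  assumes T: "(a, b) \<in> states" and j: "j \<in> {1..n}" "j < n" and c: "lower_coeff j True (a, b) \<noteq> 0"
  shows "inc a j = 1" "inc a (j + 1) = 0" "1 \<le> excess (a, b) j"
proof -
  show *: "inc a j = 1" "inc a (j + 1) = 0"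
    using c j by (auto simp: lower_coeff_def split: if_splits)
  have x: "excess (a, b) j \<noteq> 0 \<or> inc b (j + 1) - inc b j \<noteq> 1"
    using c j * by (auto simp: lower_coeff_def rho_def split: if_splits)
  show "1 \<le> excess (a, b) j"
    using * x states_inc(2)[OF T, of j] states_inc(2)[OF T, of "j + 1"] excess_bounds[OF T j(1)] excess_Suc[OF j(2), of a b]
      excess_nonneg[OF T, of "j + 1"] excess_nonneg[OF T, of j] j by auto
qed

lemma raise_coeff_imp_excess:
  assumes T: "(a, b) \<in> states" and j: "j \<in> {1..n}" "j < n" and c: "raise_coeff j False (a, b) \<noteq> 0"
  shows "inc b j = 1" "inc b (j + 1) = 0" "1 \<le> excess (a, b) j"
proof -
  show *: "inc b j = 1" "inc b (j + 1) = 0"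
    using c j by (auto simp: raise_coeff_def split: if_splits)
  have x: "excess (a, b) j \<noteq> 0 \<or> inc a (j + 1) - inc a j \<noteq> 1"
    using c j * by (auto simp: raise_coeff_def rho_def split: if_splits)
  show "1 \<le> excess (a, b) j"
    using * x states_inc(1)[OF T, of j] states_inc(1)[OF T, of "j + 1"] excess_bounds[OF T j(1)] excess_Suc[OF j(2), of a b]
      excess_nonneg[OF T, of "j + 1"] excess_nonneg[OF T, of j] j by auto
qed

lemma lowering_states:
  assumes T: "T \<in> states" and j: "j \<in> {1..n}" and c: "lower_coeff j \<mu> T \<noteq> 0"
  shows "lowering j \<mu> T \<in> states"
proof -
  obtain a b where Tab: "T = (a, b)" by (cases T)
  have S: "(a, b) \<in> states" using T Tab by simp
  have inc01: "inc a k \<in> {0, 1}" "inc b k \<in> {0, 1}" if "k \<in> {1..n}" for k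
    using states_inc[OF S, of k] that by auto
  have ex: "0 \<le> excess (a, b) k" if "k \<le> n" for k using excess_nonneg[OF S that] .
  have ab: "a 0 = 0" "b 0 = 0" using S by (auto simp: states_def)
  consider "j = n" "\<mu>" | "j < n" "\<mu>" | "j < n" "\<not> \<mu>" using j c by (auto simp: lower_coeff_def Tab split: if_splits)
  then show ?thesis
  proof cases
    case 1
    then have "inc a n = 1" "inc b n = 0" using c by (auto simp: Tab lower_coeff_def split: if_splits)
    then have "(a(n := a n - 1), b(n := b n + 1)) \<in> states"
      using inc01 ex ab j by (intro statesI[OF S]) (auto simp: inc_upd excess_upd)
    then show ?thesis using 1 by (simp add: Tab lowering_def)
  next
    case 2
    then have "(a(j := a j - 1), b) \<in> states"
      using lower_coeff_imp_excess[OF S j] c inc01 ex ab j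
      by (intro statesI[OF S]) (auto simp: Tab inc_upd excess_upd)
    then show ?thesis using 2 by (simp add: Tab lowering_def)
  next
    case 3
    then have "inc b j = 0" "inc b (j + 1) = 1" using c by (auto simp: Tab lower_coeff_def split: if_splits)
    then have "(a, b(j := b j + 1)) \<in> states"
      using 3 inc01 ex ab j ex[of j]
      by (intro statesI[OF S]) (auto simp: Tab inc_upd excess_upd)
    then show ?thesis using 3 by (simp add: Tab lowering_def)
  qed
qed

lemma raising_states:
  assumes T: "T \<in> states" and j: "j \<in> {1..n}" and c: "raise_coeff j \<mu> T \<noteq> 0"
  shows "raising j \<mu> T \<in> states"
proof -
  obtain a b where Tab: "T = (a, b)" by (cases T)
  have S: "(a, b) \<in> states" using T Tab by simp
  have inc01: "inc a k \<in> {0, 1}" "inc b k \<in> {0, 1}" if "k \<in> {1..n}" for k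
    using states_inc[OF S, of k] that by auto
  have ex: "0 \<le> excess (a, b) k" if "k \<le> n" for k using excess_nonneg[OF S that] .
  have ab: "a 0 = 0" "b 0 = 0" using S by (auto simp: states_def)
  consider "j = n" "\<mu>" | "j < n" "\<mu>" | "j < n" "\<not> \<mu>" using j c by (auto simp: raise_coeff_def Tab split: if_splits)
  then show ?thesis
  proof cases
    case 1
    then have "inc a n = 0" "inc b n = 1" using c by (auto simp: Tab raise_coeff_def split: if_splits)
    then have "(a(n := a n + 1), b(n := b n - 1)) \<in> states"
      using inc01 ex ab j by (intro statesI[OF S]) (auto simp: inc_upd excess_upd)
    then show ?thesis using 1 by (simp add: Tab raising_def)
  next
    case 2
    then have "inc a j = 0" "inc a (j + 1) = 1" using c by (auto simp: Tab raise_coeff_def split: if_splits)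
    then have "(a(j := a j + 1), b) \<in> states"
      using 2 inc01 ex ab j ex[of j]
      by (intro statesI[OF S]) (auto simp: Tab inc_upd excess_upd)
    then show ?thesis using 2 by (simp add: Tab raising_def)
  next
    case 3
    then have "(a, b(j := b j - 1)) \<in> states"
      using raise_coeff_imp_excess[OF S j] c inc01 ex ab j
      by (intro statesI[OF S]) (auto simp: Tab inc_upd excess_upd)
    then show ?thesis using 3 by (simp add: Tab raising_def)
  qed
qed

lemma raising_lowering: "raising j \<mu> (lowering j \<mu> T) = T" "lowering j \<mu> (raising j \<mu> T) = T"
  by (cases T; auto simp: raising_def lowering_def)+

end

section \<open>Commutation of lowering moves with different raising moves\<close>

context type_C_fund
begin

lemma raise_coeff_local:
  assumes "fst T k = fst T' k" "snd T k = snd T' k" "fst T (k - 1) = fst T' (k - 1)" "snd T (k - 1) = snd T' (k - 1)"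
    "k < n \<Longrightarrow> fst T (k + 1) = fst T' (k + 1)" "k < n \<Longrightarrow> snd T (k + 1) = snd T' (k + 1)" "k \<le> n"
  shows "raise_coeff k \<nu> T = raise_coeff k \<nu> T'" "lower_coeff k \<nu> T = lower_coeff k \<nu> T'"
proof -
  have "inc (fst T) k = inc (fst T') k" "inc (snd T) k = inc (snd T') k" "excess T k = excess T' k"
    using assms(1-4) by (simp_all add: inc_def excess_def)
  moreover have "inc (fst T) (k + 1) = inc (fst T') (k + 1)" "inc (snd T) (k + 1) = inc (snd T') (k + 1)"
    using assms(1,2,5,6) by (simp_all add: inc_def)
  ultimately show "raise_coeff k \<nu> T = raise_coeff k \<nu> T'" "lower_coeff k \<nu> T = lower_coeff k \<nu> T'"
    unfolding raise_coeff_def lower_coeff_def case_prod_beta prod.collapse by auto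
qed

lemma commute_far:
  assumes "j \<in> {1..n}" "k \<in> {1..n}" "k \<noteq> j" "k \<noteq> j + 1" "j \<noteq> k + 1"
  shows "lower_coeff j \<mu> (raising k \<nu> T) = lower_coeff j \<mu> T" "raise_coeff k \<nu> (lowering j \<mu> T) = raise_coeff k \<nu> T"
proof -
  have "j - 1 \<noteq> k" "k - 1 \<noteq> j" using assms by auto
  then show "lower_coeff j \<mu> (raising k \<nu> T) = lower_coeff j \<mu> T" "raise_coeff k \<nu> (lowering j \<mu> T) = raise_coeff k \<nu> T"
    using assms by (auto intro!: raise_coeff_local simp: raising_def lowering_def split: prod.splits)
qed

text \<open>\<open>a1\<close>, \<open>a2\<close> and \<open>b1\<close>, \<open>b2\<close> stand for
  the indicators of \<open>j\<close>, \<open>j + 1\<close> and of their negatives, \<open>x\<close>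
  for the excess at \<open>j\<close>. Commutation becomes a case check on these local data.\<close>

definition lc :: "bool \<Rightarrow> int \<Rightarrow> int \<Rightarrow> int \<Rightarrow> int \<Rightarrow> int \<Rightarrow> complex" where
  "lc \<mu> a1 a2 b1 b2 x =
     (if \<mu> then if a1 = 1 \<and> a2 = 0 then rho x (b2 - b1) else 0 else if b1 = 0 \<and> b2 = 1 then 1 else 0)"

definition rc :: "bool \<Rightarrow> int \<Rightarrow> int \<Rightarrow> int \<Rightarrow> int \<Rightarrow> int \<Rightarrow> complex" where
  "rc \<mu> a1 a2 b1 b2 x =
     (if \<mu> then if a1 = 0 \<and> a2 = 1 then 1 else 0 else if b1 = 1 \<and> b2 = 0 then rho x (a2 - a1) else 0)"

lemma lower_coeff_lc:
  "j < n \<Longrightarrow> lower_coeff j \<mu> T = lc \<mu> (inc (fst T) j) (inc (fst T) (Suc j)) (inc (snd T) j) (inc (snd T) (Suc j)) (excess T j)"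
  by (cases T) (auto simp: lower_coeff_def lc_def)

lemma raise_coeff_rc:
  "j < n \<Longrightarrow> raise_coeff j \<mu> T = rc \<mu> (inc (fst T) j) (inc (fst T) (Suc j)) (inc (snd T) j) (inc (snd T) (Suc j)) (excess T j)"
  by (cases T) (auto simp: raise_coeff_def rc_def)

lemma lc_rc_same:
  "lc True a1 a2 b1 b2 x * rc False (a1 - 1) (a2 + 1) b1 b2 (x - 1) = rc False a1 a2 b1 b2 x * lc True a1 a2 (b1 - 1) (b2 + 1) (x - 1)"
  "lc False a1 a2 b1 b2 x * rc True a1 a2 (b1 + 1) (b2 - 1) (x + 1) = rc True a1 a2 b1 b2 x * lc False (a1 + 1) (a2 - 1) b1 b2 (x + 1)"
  by (auto simp: lc_def rc_def)

text \<open>Here \<open>x\<close> is the excess at the right one of two adjacent nodes. If both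
  moves are possible then \<open>a2 = 0\<close> and \<open>b2 = 1\<close>, so both excesses equal
  \<open>x\<close>, and the identity behind the cases is \<open>rho x 1 * rho x (- 1) = 1\<close>.
  Where it is used, one of the last two hypotheses gives \<open>x \<noteq> 0\<close>.\<close>

lemma lc_rc_up:
  assumes "a3 \<in> {0, 1}" "b1 \<in> {0, 1}" "0 \<le> x" "0 \<le> x - 1 + a3 + b3" "0 \<le> x + 2 - a2 - b2 - a1 - b1"
  shows "lc True a1 a2 b1 b2 (x + 1 - a2 - b2) * rc False (a2 + 1) a3 b2 b3 x
     = rc False a2 a3 b2 b3 x * lc True a1 a2 b1 (b2 - 1) (x + 1 - a2 - b2)"
proof (cases "a1 = 1 \<and> a2 = 0 \<and> b2 = 1 \<and> b3 = 0")
  case True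
  then show ?thesis using assms by (elim insertE emptyE) (simp_all add: lc_def rc_def rho_def)
qed (auto simp: lc_def rc_def)

lemma lc_rc_down:
  assumes "a1 \<in> {0, 1}" "b3 \<in> {0, 1}" "0 \<le> x" "0 \<le> x - 1 + a3 + b3" "0 \<le> x + 2 - a2 - b2 - a1 - b1"
  shows "lc True a2 a3 b2 b3 x * rc False a1 (a2 - 1) b1 b2 (x + 1 - a2 - b2)
     = rc False a1 a2 b1 b2 (x + 1 - a2 - b2) * lc True a2 a3 (b2 + 1) b3 x"
proof (cases "a2 = 1 \<and> a3 = 0 \<and> b1 = 1 \<and> b2 = 0")
  case True
  then show ?thesis using assms by (elim insertE emptyE) (simp_all add: lc_def rc_def rho_def)
qed (auto simp: lc_def rc_def)

text \<open>Either both sides vanish, because each move consumes what the other requires, or only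
  coefficients 0 and 1 occur, and these ignore the letter changed by the other move.\<close>

lemma lc_rc_trivial:
  "lc True a1 a2 b1 b2 y * rc True (a2 + 1) a3 b2 b3 x = rc True a2 a3 b2 b3 x * lc True a1 (a2 + 1) b1 b2 y"
  "lc False a1 a2 b1 b2 y * rc True a2 a3 (b2 - 1) b3 x = rc True a2 a3 b2 b3 x * lc False a1 (a2 + 1) b1 b2 y"
  "lc False a1 a2 b1 b2 y * rc False a2 a3 (b2 - 1) b3 x = rc False a2 a3 b2 b3 x * lc False a1 a2 b1 (b2 - 1) y"
  "lc True a2 a3 b2 b3 x * rc True a1 (a2 - 1) b1 b2 y = rc True a1 a2 b1 b2 y * lc True (a2 - 1) a3 b2 b3 x"
  "lc False a2 a3 b2 b3 x * rc True a1 a2 b1 (b2 + 1) y = rc True a1 a2 b1 b2 y * lc False (a2 - 1) a3 b2 b3 x"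
  "lc False a2 a3 b2 b3 x * rc False a1 a2 b1 (b2 + 1) y = rc False a1 a2 b1 b2 y * lc False a2 a3 (b2 + 1) b3 x"
  by (auto simp: lc_def rc_def)

lemma commute_same:
  assumes j: "j \<in> {1..n}" and ne: "\<mu> \<noteq> \<nu>"
  shows "lower_coeff j \<mu> T * raise_coeff j \<nu> (lowering j \<mu> T) = raise_coeff j \<nu> T * lower_coeff j \<mu> (raising j \<nu> T)"
proof (cases "j = n")
  case True
  then show ?thesis using ne by (cases \<mu>; cases \<nu>; cases T) (auto simp: lower_coeff_def raise_coeff_def lowering_def raising_def)
next
  case False
  then have jn: "j < n" using j by simp
  obtain a b where Tab: "T = (a, b)" by (cases T)
  show ?thesis
    using ne lc_rc_same[of "inc a j" "inc a (Suc j)" "inc b j" "inc b (Suc j)" "excess T j"] jn j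
    by (cases \<mu>; cases \<nu>)
      (simp_all add: lower_coeff_lc raise_coeff_rc Tab lowering_def raising_def inc_upd excess_upd)
qed

lemma commute_adjacent:
  assumes T: "T \<in> states" and j: "j \<in> {1..n}" and jn: "Suc j < n"
  shows "lower_coeff j \<mu> T * raise_coeff (Suc j) \<nu> (lowering j \<mu> T) = raise_coeff (Suc j) \<nu> T * lower_coeff j \<mu> (raising (Suc j) \<nu> T)"
    and "lower_coeff (Suc j) \<mu> T * raise_coeff j \<nu> (lowering (Suc j) \<mu> T) = raise_coeff j \<nu> T * lower_coeff (Suc j) \<mu> (raising j \<nu> T)"
proof -
  obtain a b where Tab: "T = (a, b)" by (cases T)
  have S: "(a, b) \<in> states" using T Tab by simp
  define a1 a2 a3 b1 b2 b3 where d: "a1 = inc a j" "a2 = inc a (Suc j)" "a3 = inc a (Suc (Suc j))"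
    "b1 = inc b j" "b2 = inc b (Suc j)" "b3 = inc b (Suc (Suc j))"
  define x where "x = excess (a, b) (Suc j)"
  have al: "a1 \<in> {0, 1}" "b1 \<in> {0, 1}" "a3 \<in> {0, 1}" "b3 \<in> {0, 1}"
    using states_inc[OF S, of j] states_inc[OF S, of "Suc (Suc j)"] j by (auto simp: d)
  have xj: "excess (a, b) j = x + 1 - a2 - b2" using excess_Suc[of j a b] jn by (simp add: x_def d)
  have x: "0 \<le> x" "0 \<le> x - 1 + a3 + b3" "0 \<le> x + 2 - a2 - b2 - a1 - b1"
    using excess_bounds[OF S j] xj excess_nonneg[OF S, of "Suc j"] excess_nonneg[OF S, of "Suc (Suc j)"] excess_Suc[of "Suc j" a b] jn
    by (auto simp: x_def d)
  have j': "j < n" "1 \<le> j" using j jn by simp_all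
  note defs = lower_coeff_lc raise_coeff_rc Tab lowering_def raising_def inc_upd excess_upd xj x_def[symmetric] d[symmetric]
  show "lower_coeff j \<mu> T * raise_coeff (Suc j) \<nu> (lowering j \<mu> T) = raise_coeff (Suc j) \<nu> T * lower_coeff j \<mu> (raising (Suc j) \<nu> T)"
    using lc_rc_up[OF al(3,2) x] lc_rc_trivial[of a1 a2 b1 b2 "x + 1 - a2 - b2" a3 b3 x] jn j'
    by (cases \<mu>; cases \<nu>) (simp_all add: defs)
  show "lower_coeff (Suc j) \<mu> T * raise_coeff j \<nu> (lowering (Suc j) \<mu> T) = raise_coeff j \<nu> T * lower_coeff (Suc j) \<mu> (raising j \<nu> T)"
    using lc_rc_down[OF al(1,4) x] lc_rc_trivial[of a2 a3 b2 b3 x a1 b1 "x + 1 - a2 - b2"]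
      lc_rc_trivial(4-6)[of a2 a3 b2 b3 x a1 b1 "x + 1 - a2 - b2"] jn j'
    by (cases \<mu>; cases \<nu>) (simp_all add: defs)
qed

end

context type_C_fund
begin

text \<open>All products are 0: a move at \<open>n - 1\<close> and one at \<open>n\<close> compete
  for the letter \<open>n\<close> or \<open>-n\<close>.\<close>

lemma commute_last:
  assumes "Suc j = n" "j \<in> {1..n}"
  shows "lower_coeff j \<mu> T * raise_coeff n \<nu> (lowering j \<mu> T) = raise_coeff n \<nu> T * lower_coeff j \<mu> (raising n \<nu> T)"
    and "lower_coeff n \<mu> T * raise_coeff j \<nu> (lowering n \<mu> T) = raise_coeff j \<nu> T * lower_coeff n \<mu> (raising j \<nu> T)"
proof -
  have jn: "j \<noteq> n" "1 \<le> j" "1 \<le> n" "n - 1 = j" "n \<noteq> Suc n" "j \<noteq> Suc n" using assms by auto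
  obtain a b where Tab: "T = (a, b)" by (cases T)
  show "lower_coeff j \<mu> T * raise_coeff n \<nu> (lowering j \<mu> T) = raise_coeff n \<nu> T * lower_coeff j \<mu> (raising n \<nu> T)"
    "lower_coeff n \<mu> T * raise_coeff j \<nu> (lowering n \<mu> T) = raise_coeff j \<nu> T * lower_coeff n \<mu> (raising j \<nu> T)"
    by (cases \<mu>; cases \<nu>; use assms jn in \<open>auto simp: Tab lower_coeff_def raise_coeff_def lowering_def raising_def inc_upd\<close>)+
qed

lemma coeffs_commute:
  assumes T: "T \<in> states" and jk: "j \<in> {1..n}" "k \<in> {1..n}" and ne: "(j, \<mu>) \<noteq> (k, \<nu>)"
  shows "lower_coeff j \<mu> T * raise_coeff k \<nu> (lowering j \<mu> T) = raise_coeff k \<nu> T * lower_coeff j \<mu> (raising k \<nu> T)"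
proof -
  consider "j = k" "\<mu> \<noteq> \<nu>" | "k = Suc j" "k < n" | "k = Suc j" "k = n" | "j = Suc k" "j < n" | "j = Suc k" "j = n"
    | "k \<noteq> j" "k \<noteq> j + 1" "j \<noteq> k + 1"
    using ne jk by fastforce
  then show ?thesis
  proof cases
    case 1
    then show ?thesis using commute_same jk by blast
  next
    case 2
    then show ?thesis using commute_adjacent(1)[OF T jk(1)] by simp
  next
    case 3
    then show ?thesis using commute_last(1)[OF _ jk(1)] by simp
  next
    case 4
    then show ?thesis using commute_adjacent(2)[OF T jk(2)] by simp
  next
    case 5
    then show ?thesis using commute_last(2)[OF _ jk(2)] by simp
  next
    case 6
    then show ?thesis using commute_far[OF jk] by simp
  qed
qed

text \<open>The pole of a move depends on one count, which only that move changes. The move at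
  \<open>n\<close> changes two counts, but \<open>False\<close> moves have coefficient 0
  there.\<close>

lemma moves_commute:
  assumes jk: "j \<in> {1..n}" "k \<in> {1..n}" and ne: "(j, \<mu>) \<noteq> (k, \<nu>)"
    and c: "lower_coeff j \<mu> T \<noteq> 0" "raise_coeff k \<nu> (lowering j \<mu> T) \<noteq> 0"
  shows "raising k \<nu> (lowering j \<mu> T) = lowering j \<mu> (raising k \<nu> T)"
    and "pole_exp k \<nu> (lowering j \<mu> (raising k \<nu> T)) = pole_exp k \<nu> (raising k \<nu> T)"
    and "pole_exp j \<mu> (raising k \<nu> T) = pole_exp j \<mu> T"
proof -
  obtain a b where Tab: "T = (a, b)" by (cases T)
  have m: "j = n \<Longrightarrow> \<mu>" "k = n \<Longrightarrow> \<nu>"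
    using c by (auto simp: lower_coeff_def raise_coeff_def Tab split: if_splits prod.splits)
  show "raising k \<nu> (lowering j \<mu> T) = lowering j \<mu> (raising k \<nu> T)"
    "pole_exp k \<nu> (lowering j \<mu> (raising k \<nu> T)) = pole_exp k \<nu> (raising k \<nu> T)"
    "pole_exp j \<mu> (raising k \<nu> T) = pole_exp j \<mu> T"
    by (cases \<mu>; cases \<nu>; use ne m in \<open>auto simp: Tab raising_def lowering_def pole_exp_def fun_upd_twist\<close>)+
qed

section \<open>Poles and residues of \<open>psi\<close> on a column\<close>

definition pole1 :: "nat \<Rightarrow> state \<Rightarrow> int" where "pole1 j T = spec1 j T + int (symm_d n j) * exp1 j T"
definition pole2 :: "nat \<Rightarrow> state \<Rightarrow> int" where "pole2 j T = spec2 j T + int (symm_d n j) * exp2 j T"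

lemma lower_coeff_pole:
  assumes "T \<in> states" "j \<in> {1..n}" "lower_coeff j \<mu> T \<noteq> 0"
  shows "pole_exp j \<mu> T = (if \<mu> then pole1 j T else pole2 j T)"
proof -
  obtain a b where Tab: "T = (a, b)" by (cases T)
  have "a n + b n = int i" using assms(1) by (auto simp: Tab states_def)
  then show ?thesis using assms(3)
    by (auto simp: Tab lower_coeff_def pole_exp_def pole1_def pole2_def spec1_def spec2_def exp1_def exp2_def symm_d_def
       split: if_splits)
qed

lemma raise_coeff_pole:
  assumes "T \<in> states" "j \<in> {1..n}" "raise_coeff j \<mu> T \<noteq> 0"
  shows "pole_exp j \<mu> (raising j \<mu> T) = (if \<mu> then pole1 j T else pole2 j T)"
proof -
  obtain a b where Tab: "T = (a, b)" by (cases T)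
  have "a n + b n = int i" using assms(1) by (auto simp: Tab states_def)
  then show ?thesis using assms(3)
    by (auto simp: Tab raise_coeff_def raising_def pole_exp_def pole1_def pole2_def spec1_def spec2_def exp1_def exp2_def symm_d_def
       split: if_splits)
qed

text \<open>This is how the excess enters the coefficients: up to the exponents it measures the
  distance of the poles.\<close>

lemma pole_diff:
  assumes "j < n"
  shows "pole2 j T = pole1 j T + 2 * (excess T j + 1) + exp2 j T - exp1 j T"
  using assms by (cases T) (simp add: pole1_def pole2_def spec1_def spec2_def excess_def symm_d_def)

lemma state_values:
  assumes T: "T \<in> states" and j: "j \<in> {1..n}" "j < n"
  shows "inc (fst T) j \<in> {0, 1}" "inc (fst T) (Suc j) \<in> {0, 1}" "inc (snd T) j \<in> {0, 1}" "inc (snd T) (Suc j) \<in> {0, 1}"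
    and "0 \<le> excess T j" "0 \<le> excess T j - 1 + inc (fst T) (Suc j) + inc (snd T) (Suc j)"
    and "exp1 j T = inc (fst T) j - inc (fst T) (Suc j)" "exp2 j T = inc (snd T) (Suc j) - inc (snd T) j"
proof -
  obtain a b where Tab: "T = (a, b)" by (cases T)
  have S: "(a, b) \<in> states" using T Tab by simp
  show "inc (fst T) j \<in> {0, 1}" "inc (fst T) (Suc j) \<in> {0, 1}" "inc (snd T) j \<in> {0, 1}" "inc (snd T) (Suc j) \<in> {0, 1}"
    using states_inc[OF S, of j] states_inc[OF S, of "Suc j"] j by (auto simp: Tab)
  show "0 \<le> excess T j" "0 \<le> excess T j - 1 + inc (fst T) (Suc j) + inc (snd T) (Suc j)"
    using excess_nonneg[OF S, of j] excess_nonneg[OF S, of "Suc j"] excess_Suc[OF j(2), of a b] j by (auto simp: Tab)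
  show "exp1 j T = inc (fst T) j - inc (fst T) (Suc j)" "exp2 j T = inc (snd T) (Suc j) - inc (snd T) j"
    using j by (simp_all add: Tab exp1_def exp2_def)
qed

text \<open>At \<open>n\<close> the exponents have different parity. At \<open>j < n\<close> the
  poles could meet only with excess 0, \<open>j\<close> and \<open>-j\<close> present, and
  \<open>j + 1\<close> and \<open>-(j + 1)\<close> absent, contrary to admissibility at
  \<open>j + 1\<close>.\<close>

lemma poles_distinct:
  assumes T: "T \<in> states" and j: "j \<in> {1..n}"
  shows "pole1 j T \<noteq> pole2 j T"
proof (cases "j = n")
  case True
  obtain a b where Tab: "T = (a, b)" by (cases T)
  have "pole1 j T = 2 * (b n + inc b n + (inc a n - inc b n)) + int n - int i - 1" "pole2 j T = 2 * b n + int n - int i"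
    using True by (simp_all add: pole1_def pole2_def Tab spec1_def spec2_def exp1_def exp2_def symm_d_def algebra_simps)
  then show ?thesis by presburger
next
  case False
  then have jn: "j < n" using j by simp
  note v = state_values[OF T j jn]
  have "2 * (excess T j + 1) + exp2 j T - exp1 j T \<noteq> 0"
    using v(1-6) unfolding v(7,8) by auto presburger+
  then show ?thesis
    unfolding pole_diff[OF jn] by linarith
qed

text \<open>Extracting the power of \<open>q\<close> at the midpoint \<open>P + D\<close> of the two
  exponents leaves differences of the form \<open>br\<close>.\<close>

lemma pole_fraction:
  assumes "Q = P + 2 * D" "D \<noteq> 0"
  shows "(q powi e * q powi P - q powi (- e) * q powi Q) / (q powi P - q powi Q) = br (D - e) / br D"
    and "(q powi e * q powi Q - q powi (- e) * q powi P) / (q powi Q - q powi P) = br (D + e) / br D"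
proof -
  have sum: "q powi a * q powi b = q powi (a + b)" for a b
    using q_nonzero by (simp add: power_int_add)
  have 1: "q powi (P + D) * br x = q powi (P + D + x) - q powi (P + D - x)" for x
    unfolding br_def right_diff_distrib sum by simp
  have QD: "Q = P + D + D" using assms(1) by simp
  have "q powi e * q powi P - q powi (- e) * q powi Q = - (q powi (P + D) * br (D - e))"
    unfolding 1 sum QD by (simp add: algebra_simps)
  moreover have "q powi P - q powi Q = - (q powi (P + D) * br D)"
    unfolding 1 QD by simp
  moreover have "q powi e * q powi Q - q powi (- e) * q powi P = q powi (P + D) * br (D + e)"
    unfolding 1 sum QD by (simp add: algebra_simps)
  moreover have "q powi Q - q powi P = q powi (P + D) * br D"
    unfolding 1 QD by simp
  ultimately show "(q powi e * q powi P - q powi (- e) * q powi Q) / (q powi P - q powi Q) = br (D - e) / br D"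
    "(q powi e * q powi Q - q powi (- e) * q powi P) / (q powi Q - q powi P) = br (D + e) / br D"
    using q_nonzero by simp_all
qed

lemma pole_fraction_rho:
  assumes e: "e \<in> {-1, 0, 1}" and ne: "P \<noteq> Q"
  shows "Q = P + 2 * (y + 1) + e - 1 \<Longrightarrow> (q powi e * q powi P - q powi (- e) * q powi Q) / (q powi P - q powi Q) = rho y e"
    and "Q = P + 2 * y + 1 - e \<Longrightarrow> (q powi e * q powi Q - q powi (- e) * q powi P) / (q powi Q - q powi P) = rho y (- e)"
proof -
  have ne': "q powi P - q powi Q \<noteq> 0" "q powi Q - q powi P \<noteq> 0" using ne by (auto simp: q_powi_eq_iff)
  show "(q powi e * q powi P - q powi (- e) * q powi Q) / (q powi P - q powi Q) = rho y e" if Q: "Q = P + 2 * (y + 1) + e - 1"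
  proof -
    consider "e = -1" "Q = P + 2 * y" | "e = 0" | "e = 1" "Q = P + 2 * (y + 1)" using e Q by auto
    then show ?thesis
    proof cases
      case 1
      then show ?thesis using pole_fraction(1)[OF 1(2), of "- 1"] ne by (simp only: rho_simps; simp)
    next
      case 2
      then show ?thesis using ne' by (simp add: rho_simps)
    next
      case 3
      then show ?thesis using pole_fraction(1)[OF 3(2), of 1] ne by (simp only: rho_simps; simp)
    qed
  qed
  show "(q powi e * q powi Q - q powi (- e) * q powi P) / (q powi Q - q powi P) = rho y (- e)" if Q: "Q = P + 2 * y + 1 - e"
  proof -
    consider "e = -1" "Q = P + 2 * (y + 1)" | "e = 0" | "e = 1" "Q = P + 2 * y" using e Q by auto
    then show ?thesis
    proof cases
      case 1
      then show ?thesis using pole_fraction(2)[OF 1(2), of "- 1"] ne by (simp only: rho_simps; simp add: rho_simps)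
    next
      case 2
      then show ?thesis using ne' by (simp add: rho_simps)
    next
      case 3
      then show ?thesis using pole_fraction(2)[OF 3(2), of 1] ne by (simp only: rho_simps; simp)
    qed
  qed
qed

text \<open>At each pole the letters allow only lowering, only raising, or neither.
  \<open>rho\<close> is evaluated at the upper column of a \<open>True\<close> move and at the lower
  column of a \<open>False\<close> move, hence with excess \<open>x\<close> or
  \<open>x + 1\<close>.\<close>

lemma residue_coeffs:
  assumes T: "T \<in> states" and j: "j \<in> {1..n}" and jn: "j < n"
  shows "(q powi exp1 j T - q powi - exp1 j T) *
      ((q powi exp2 j T * q powi pole1 j T - q powi (- exp2 j T) * q powi pole2 j T) / (q powi pole1 j T - q powi pole2 j T))
    = (q - inverse q) * (lower_coeff j True T * raise_coeff j True (lowering j True T) - raise_coeff j True T * lower_coeff j True (raising j True T))"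
      (is "?L1 * ?F1 = _")
    and "(q powi exp2 j T - q powi - exp2 j T) *
      ((q powi exp1 j T * q powi pole2 j T - q powi (- exp1 j T) * q powi pole1 j T) / (q powi pole2 j T - q powi pole1 j T))
    = (q - inverse q) * (lower_coeff j False T * raise_coeff j False (lowering j False T) - raise_coeff j False T * lower_coeff j False (raising j False T))"
      (is "?L2 * ?F2 = _")
proof -
  obtain a b where Tab: "T = (a, b)" by (cases T)
  define a1 a2 b1 b2 where d: "a1 = inc (fst T) j" "a2 = inc (fst T) (Suc j)" "b1 = inc (snd T) j" "b2 = inc (snd T) (Suc j)"
  have v: "inc (fst T) j = a1" "inc (fst T) (Suc j) = a2" "inc (snd T) j = b1" "inc (snd T) (Suc j) = b2"
    by (simp_all add: d)
  note ab = state_values(1-4)[OF T j jn, folded d] and e = state_values(7,8)[OF T j jn, folded d]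
  define x where "x = excess T j"
  have x: "excess (a, b) j = x" by (simp add: x_def Tab)
  have c: "lower_coeff j \<mu> T = lc \<mu> a1 a2 b1 b2 x" "raise_coeff j \<mu> T = rc \<mu> a1 a2 b1 b2 x"
    "raise_coeff j True (lowering j True T) = rc True (a1 - 1) (a2 + 1) b1 b2 (x - 1)"
    "raise_coeff j False (lowering j False T) = rc False a1 a2 (b1 + 1) (b2 - 1) (x + 1)"
    "lower_coeff j True (raising j True T) = lc True (a1 + 1) (a2 - 1) b1 b2 (x + 1)"
    "lower_coeff j False (raising j False T) = lc False a1 a2 (b1 - 1) (b2 + 1) (x - 1)" for \<mu>
    using v jn j by (simp_all add: lower_coeff_lc raise_coeff_rc Tab lowering_def raising_def inc_upd excess_upd x)
  have pd: "pole2 j T = pole1 j T + 2 * (x + 1) + exp2 j T - exp1 j T"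
    unfolding pole_diff[OF jn] x_def ..
  note ne = poles_distinct[OF T j]
  have e12: "exp1 j T \<in> {-1, 0, 1}" "exp2 j T \<in> {-1, 0, 1}" using ab e by auto
  consider "a1 = a2" | "a1 = 1" "a2 = 0" | "a1 = 0" "a2 = 1" using ab by auto
  then show "?L1 * ?F1 = (q - inverse q) * (lower_coeff j True T * raise_coeff j True (lowering j True T) - raise_coeff j True T * lower_coeff j True (raising j True T))"
  proof cases
    case 1
    then show ?thesis unfolding c by (simp add: e lc_def rc_def)
  next
    case 2
    then have "?F1 = rho x (exp2 j T)" using e pd by (intro pole_fraction_rho(1)[OF e12(2) ne]) simp
    then show ?thesis unfolding c using 2 by (simp only:) (simp add: e lc_def rc_def power_int_minus)
  next
    case 3
    then have "?F1 = rho (x + 1) (exp2 j T)" using e pd by (intro pole_fraction_rho(1)[OF e12(2) ne]) simp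
    then show ?thesis unfolding c using 3 by (simp only:) (simp add: e lc_def rc_def power_int_minus algebra_simps)
  qed
  consider "b1 = b2" | "b1 = 0" "b2 = 1" | "b1 = 1" "b2 = 0" using ab by auto
  then show "?L2 * ?F2 = (q - inverse q) * (lower_coeff j False T * raise_coeff j False (lowering j False T) - raise_coeff j False T * lower_coeff j False (raising j False T))"
  proof cases
    case 1
    then show ?thesis unfolding c by (simp add: e lc_def rc_def)
  next
    case 2
    then have "?F2 = rho (x + 1) (- exp1 j T)" using e pd by (intro pole_fraction_rho(2)[OF e12(1) ne]) simp
    then show ?thesis unfolding c using 2 by (simp only:) (simp add: e lc_def rc_def power_int_minus)
  next
    case 3
    then have "?F2 = rho x (- exp1 j T)" using e pd by (intro pole_fraction_rho(2)[OF e12(1) ne]) simp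
    then show ?thesis unfolding c using 3 by (simp only:) (simp add: e lc_def rc_def power_int_minus algebra_simps)
  qed
qed

end

section \<open>Weights and eigenvalues of \<open>h\<close> in the column model\<close>

context type_C_fund
begin

lemma raise_then_lower_coeff:
  assumes T: "T \<in> states" and j: "j \<in> {1..n}" and c: "raise_coeff j \<mu> T \<noteq> 0"
  shows "lower_coeff j \<mu> (raising j \<mu> T) \<noteq> 0"
proof -
  obtain a b where Tab: "T = (a, b)" by (cases T)
  show ?thesis
  proof (cases "j = n")
    case True
    then show ?thesis using c j by (auto simp: Tab raise_coeff_def raising_def lower_coeff_def inc_upd split: if_splits)
  next
    case False
    then have jn: "j < n" using j by simp
    note v = state_values[OF T j jn, unfolded Tab]
    have "excess (a, b) j + 1 \<noteq> 0" "excess (a, b) j + 2 \<noteq> 0" using v(5) by auto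
    then show ?thesis using c j jn
      by (cases \<mu>) (auto simp: Tab raise_coeff_rc lower_coeff_lc raising_def inc_upd excess_upd lc_def rc_def rho_def split: if_splits)
  qed
qed

text \<open>At \<open>n\<close> the second exponent is 0, so the second residue vanishes and the
  fraction in the first one is 1.\<close>

lemma model_residues:
  assumes T: "T \<in> states" and j: "j \<in> {1..n}"
  shows "psi_residues (qi n q j) (exp1 j T) (q powi pole1 j T) (exp2 j T) (q powi pole2 j T) m
        = (qi n q j - inverse (qi n q j)) *
          ((lower_coeff j True T * raise_coeff j True (lowering j True T) - raise_coeff j True T * lower_coeff j True (raising j True T))
             * (q powi pole1 j T) powi m
           + (lower_coeff j False T * raise_coeff j False (lowering j False T) - raise_coeff j False T * lower_coeff j False (raising j False T))
             * (q powi pole2 j T) powi m)"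
proof (cases "j = n")
  case True
  obtain a b where Tab: "T = (a, b)" by (cases T)
  have S: "(a, b) \<in> states" using T Tab by simp
  have ab: "inc a n \<in> {0, 1}" "inc b n \<in> {0, 1}" "inc a n + inc b n \<le> 1"
    using states_inc[OF S, of n] states_last[OF S] n_ge_2 by auto
  have ne: "q powi pole1 n T - q powi pole2 n T \<noteq> 0" using poles_distinct[OF T, of n] j True by (simp add: q_powi_eq_iff)
  have "exp2 n T = 0" by (simp add: exp2_def Tab)
  moreover have "(qi n q n powi exp1 n T - qi n q n powi - exp1 n T) = (qi n q n - inverse (qi n q n)) *
      (lower_coeff n True T * raise_coeff n True (lowering n True T) - raise_coeff n True T * lower_coeff n True (raising n True T))"
    using ab n_ge_2 by (elim insertE emptyE)
      (simp_all add: Tab exp1_def lower_coeff_def raise_coeff_def lowering_def raising_def inc_upd power_int_minus)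
  moreover have "lower_coeff n False T = 0" "raise_coeff n False T = 0"
    by (simp_all add: Tab lower_coeff_def raise_coeff_def)
  ultimately show ?thesis using ne True by (simp add: psi_residues_def)
next
  case False
  then have jn: "j < n" using j by simp
  then have Q: "qi n q j = q" by (simp add: qi_def symm_d_def)
  show ?thesis
    unfolding psi_residues_def Q residue_coeffs[OF T j jn] by (simp only: distrib_left mult.assoc)
qed

lemma weight_coord:
  "exp1 k (a, b) + exp2 k (a, b) = (inc a k - inc b k) - (inc a (k + 1) - inc b (k + 1))" if "k \<le> n"
  using that by (auto simp: exp1_def exp2_def inc_def)

lemma model_weights:
  assumes j: "j \<in> {1..n}" and k: "k \<in> {1..n}" and c: "lower_coeff j \<mu> T \<noteq> 0"
  shows "exp1 k (lowering j \<mu> T) + exp2 k (lowering j \<mu> T) = exp1 k T + exp2 k T - cartan n k j"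
proof -
  obtain a b where Tab: "T = (a, b)" by (cases T)
  have "j = n \<Longrightarrow> \<mu>" using c by (auto simp: lower_coeff_def Tab split: if_splits)
  then show ?thesis using j k
    by (cases \<mu>; cases "j = n") (auto simp: Tab lowering_def weight_coord inc_upd cartan_def)
qed

definition power_sum :: "int \<Rightarrow> nat \<Rightarrow> state \<Rightarrow> complex" where
  "power_sum m k T = of_int (exp1 k T) * (q powi m) powi spec1 k T + of_int (exp2 k T) * (q powi m) powi spec2 k T"

text \<open>The quotient of [m a] by [m] for the Cartan entry a.\<close>

definition cartan_coeff :: "int \<Rightarrow> nat \<Rightarrow> nat \<Rightarrow> complex" where
  "cartan_coeff m k j =
     (if cartan n k j = 2 then qi n q k powi m + qi n q k powi - m
      else if cartan n k j = - 2 then - (qi n q k powi m + qi n q k powi - m)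
      else of_int (cartan n k j))"

lemma qint_cartan: "qint (qi n q k) (m * cartan n k j) = qint (qi n q k) m * cartan_coeff m k j"
proof -
  have "qint Q (m * 2) = qint Q m * (Q powi m + Q powi - m)" if "Q \<noteq> 0" for Q
  proof -
    have "Q powi (m * 2) = Q powi m * Q powi m" "Q powi - (m * 2) = Q powi - m * Q powi - m"
      using that by (simp_all add: mult.commute flip: power_int_add)
    then show ?thesis by (simp add: qint_def algebra_simps)
  qed
  moreover from this have "qint Q (m * - 2) = - (qint Q m * (Q powi m + Q powi - m))" if "Q \<noteq> 0" for Q
    using qint_minus[of Q "m * 2"] that by simp
  moreover have "qint Q (m * - 1) = - qint Q m" "qint Q (m * 0) = 0" for Q
    using qint_minus[of Q m] by (simp_all add: qint_def)
  moreover have "cartan n k j \<in> {2, - 2, - 1, 0}" by (auto simp: cartan_def)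
  ultimately show ?thesis by (auto simp: cartan_coeff_def algebra_simps)
qed

text \<open>In power sums, lowering divides the \<ell>-weight by the affine analogue of a simple
  root: Y_y at \<open>j\<close> becomes the inverse of Y at \<open>y\<close> shifted by
  \<open>q\<^sub>j\<^sup>2\<close>, and adjacent nodes gain factors at the pole, or two factors
  around it when the Cartan entry is -2.\<close>

lemma power_sum_lowering:
  assumes T: "T \<in> states" and j: "j \<in> {1..n}" and k: "k \<in> {1..n}" and c: "lower_coeff j \<mu> T \<noteq> 0"
  shows "power_sum m k (lowering j \<mu> T) = power_sum m k T - cartan_coeff m k j * (q powi m) powi pole_exp j \<mu> T"
proof -
  obtain a b where Tab: "T = (a, b)" by (cases T)
  have S: "(a, b) \<in> states" using T Tab by simp
  define P where "P = q powi m"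
  have P: "P \<noteq> 0" using q_nonzero by (simp add: P_def)
  have add: "P powi (x + y) = P powi x * P powi y" for x y using P by (simp add: power_int_add)
  have Qk: "k < n \<Longrightarrow> qi n q k powi m = P" "k < n \<Longrightarrow> qi n q k powi - m = P powi (- 1)"
     "qi n q n powi m = P powi 2" "qi n q n powi - m = P powi - 2"
    unfolding qi_powi symm_d_def P_def power_int_mult[symmetric] by (simp_all add: mult.commute)
  have ps: "power_sum m k T = of_int (exp1 k T) * P powi spec1 k T + of_int (exp2 k T) * P powi spec2 k T" for k T
    by (simp add: power_sum_def P_def)
  have last: "a n + b n = int i" "inc a n + inc b n \<le> 1" using S states_last[OF S] by (auto simp: states_def)
  have ab01: "inc a n \<in> {0, 1}" "inc b n \<in> {0, 1}" using states_inc[OF S, of n] n_ge_2 by auto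
  have inca: "a (j - 1) = a j - inc a j" "b (j - 1) = b j - inc b j" using j by (simp_all add: inc_def)
  have incS: "a (Suc j) = a j + inc a (Suc j)" "b (Suc j) = b j + inc b (Suc j)" if "j < n" using that by (simp_all add: inc_def)
  consider (far) "k \<noteq> j" "k \<noteq> Suc j" "j \<noteq> Suc k" | (same) "k = j" | (up) "k = Suc j" "k < n" | (last) "Suc j = n" "k = n" | (down) "j = Suc k"
    using k by fastforce
  then have "power_sum m k (lowering j \<mu> T) = power_sum m k T - cartan_coeff m k j * P powi pole_exp j \<mu> T"
  proof cases
    case far
    then have "cartan_coeff m k j = 0" using k by (auto simp: cartan_coeff_def cartan_def)
    moreover have "power_sum m k (lowering j \<mu> T) = power_sum m k T"
      unfolding power_sum_def using far k j
      by (cases \<mu>; cases "k = n") (auto simp: Tab lowering_def exp1_def exp2_def spec1_def spec2_def inc_upd)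
    ultimately show ?thesis by simp
  next
    case same
    have C: "cartan_coeff m j j = qi n q j powi m + qi n q j powi - m" by (simp add: cartan_coeff_def cartan_def)
    \<comment> \<open>\<open>u\<close> is the power of the old parameter and \<open>w\<close> the
      step to the pole; after a second step the exponent has changed from 1 to -1.\<close>
    have shift: "- (u * w * w) = u - (w + w') * (u * w)" if "w * w' = 1" for u w w' :: complex
    proof -
      have "(w + w') * (u * w) = u * w * w + u * (w * w')" by (simp add: algebra_simps)
      then show ?thesis using that by simp
    qed
    have inv: "P powi 2 * P powi - 2 = 1" "P powi 1 * P powi - 1 = 1"
      unfolding add[symmetric] by simp_all
    have up2: "P powi (s + 2) = P powi s * P powi 1 * P powi 1" "P powi (s + 4) = P powi s * P powi 2 * P powi 2" for s
      unfolding add[symmetric] by (simp_all add: add.commute)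
    consider "j = n" "\<mu>" "inc a n = 1" "inc b n = 0" | "j < n" "\<mu>" "inc a j = 1" "inc a (Suc j) = 0"
      | "j < n" "\<not> \<mu>" "inc b j = 0" "inc b (Suc j) = 1"
      using c j by (auto simp: lower_coeff_def Tab split: if_splits)
    then show ?thesis
    proof cases
      case 1
      have p: "pole_exp j \<mu> T = spec1 j T + 2" "spec1 j (lowering j \<mu> T) = spec1 j T + 4"
        "exp1 j T = 1" "exp1 j (lowering j \<mu> T) = - 1" "exp2 j T = 0" "exp2 j (lowering j \<mu> T) = 0"
        using 1 last j by (simp_all add: Tab pole_exp_def spec1_def exp1_def exp2_def lowering_def inc_upd)
      have Q: "qi n q j powi m = P powi 2" "qi n q j powi - m = P powi - 2" using 1 Qk by simp_all
      show ?thesis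
        unfolding same ps C p Q up2(2) add[of _ 2] using shift[OF inv(1), of "P powi spec1 j T"] by simp
    next
      case 2
      have p: "pole_exp j \<mu> T = spec1 j T + 1" "spec1 j (lowering j \<mu> T) = spec1 j T + 2"
        "exp1 j T = 1" "exp1 j (lowering j \<mu> T) = - 1" "exp2 j (lowering j \<mu> T) = exp2 j T" "spec2 j (lowering j \<mu> T) = spec2 j T"
        using 2 j by (simp_all add: Tab pole_exp_def spec1_def spec2_def exp1_def exp2_def lowering_def inc_upd)
      have Q: "qi n q j powi m = P powi 1" "qi n q j powi - m = P powi - 1" using 2 Qk same by simp_all
      show ?thesis
        unfolding same ps C p Q up2 add[of _ 1] using shift[OF inv(2), of "P powi spec1 j T"] by simp
    next
      case 3
      have p: "pole_exp j \<mu> T = spec2 j T + 1" "spec2 j (lowering j \<mu> T) = spec2 j T + 2"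
        "exp2 j T = 1" "exp2 j (lowering j \<mu> T) = - 1" "exp1 j (lowering j \<mu> T) = exp1 j T" "spec1 j (lowering j \<mu> T) = spec1 j T"
        using 3 j by (simp_all add: Tab pole_exp_def spec1_def spec2_def exp1_def exp2_def lowering_def inc_upd)
      have Q: "qi n q j powi m = P powi 1" "qi n q j powi - m = P powi - 1" using 3 Qk same by simp_all
      show ?thesis
        unfolding same ps C p Q up2 add[of _ 1] using shift[OF inv(2), of "P powi spec2 j T"] by simp
    qed
  next
    case up
    then have C: "cartan_coeff m k j = - 1" by (simp add: cartan_coeff_def cartan_def)
    consider "\<mu>" "inc a j = 1" "inc a (Suc j) = 0" | "\<not> \<mu>" "inc b j = 0" "inc b (Suc j) = 1"
      using c up by (auto simp: lower_coeff_def Tab split: if_splits)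
    then show ?thesis
    proof cases
      case 1
      have p: "pole_exp j \<mu> T = spec1 k T" "spec1 k (lowering j \<mu> T) = spec1 k T" "exp1 k (lowering j \<mu> T) = exp1 k T + 1"
        "exp2 k (lowering j \<mu> T) = exp2 k T" "spec2 k (lowering j \<mu> T) = spec2 k T"
        using 1 j up incS by (simp_all add: Tab pole_exp_def spec1_def spec2_def exp1_def exp2_def lowering_def inc_upd)
      show ?thesis unfolding ps C p by (simp add: algebra_simps)
    next
      case 2
      have p: "pole_exp j \<mu> T = spec2 k T" "spec2 k (lowering j \<mu> T) = spec2 k T" "exp2 k (lowering j \<mu> T) = exp2 k T + 1"
        "exp1 k (lowering j \<mu> T) = exp1 k T" "spec1 k (lowering j \<mu> T) = spec1 k T"
        using 2 j up incS by (simp_all add: Tab pole_exp_def spec1_def spec2_def exp1_def exp2_def lowering_def inc_upd)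
      show ?thesis unfolding ps C p by (simp add: algebra_simps)
    qed
  next
    case last
    have jn: "j < n" using last by simp
    have "cartan n k j = - 1" using last jn j by (simp add: cartan_def)
    then have C: "cartan_coeff m k j = - 1" by (simp add: cartan_coeff_def)
    have j1: "j + 1 = n" using last by simp
    have x: "excess (a, b) j = 1 - inc a n - inc b n"
      using excess_Suc[OF jn, of a b] excess_n[OF S] unfolding j1 by simp
    have ab: "a n = a j + inc a n" "b n = b j + inc b n" using incS[OF jn] last by simp_all
    \<comment> \<open>A \<open>True\<close> move takes node \<open>n\<close> from a trivial factor
      to exponent 1, a \<open>False\<close> move from exponent -1 to a trivial factor. Admissibility
      excludes the remaining letters.\<close>
    consider "\<mu>" "inc a j = 1" "inc a n = 0" "inc b n = 0" | "\<not> \<mu>" "inc b j = 0" "inc b n = 1" "inc a n = 0"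
    proof (cases \<mu>)
      case True
      have "inc a j = 1" "inc a n = 0" "1 \<le> excess (a, b) j"
        using lower_coeff_imp_excess[OF S j jn] c True unfolding j1 Tab by simp_all
      then show ?thesis using that(1) True x ab01 by force
    next
      case False
      then have "inc b j = 0" "inc b n = 1" using c jn last(1) by (simp_all add: lower_coeff_def Tab split: if_splits)
      then show ?thesis using that(2) False \<open>inc a n + inc b n \<le> 1\<close> ab01 by force
    qed
    then show ?thesis
    proof cases
      case 1
      then have p: "exp1 n T = 0" "exp1 n (lowering j \<mu> T) = 1" "pole_exp j \<mu> T = spec1 n (lowering j \<mu> T)"
        "exp2 n T = 0" "exp2 n (lowering j \<mu> T) = 0"
        using j jn ab j1 \<open>a n + b n = int i\<close>
        by (simp_all add: Tab pole_exp_def spec1_def spec2_def exp1_def exp2_def lowering_def inc_upd)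
      show ?thesis unfolding last(2) ps p using C last(2) by simp
    next
      case 2
      then have p: "exp1 n T = - 1" "exp1 n (lowering j \<mu> T) = 0" "pole_exp j \<mu> T = spec1 n T"
        "exp2 n T = 0" "exp2 n (lowering j \<mu> T) = 0"
        using j jn ab j1 by (simp_all add: Tab pole_exp_def spec1_def spec2_def exp1_def exp2_def lowering_def inc_upd)
      show ?thesis unfolding last(2) ps p using C last(2) by simp
    qed
  next
    case down
    have k': "k < n" "1 \<le> k" "k \<noteq> n" using down j k by auto
    have jk: "a k = a j - inc a j" "b k = b j - inc b j" "int j = int k + 1" using inca down by simp_all
    consider "j = n" "\<mu>" "inc a n = 1" "inc b n = 0" | "j < n" "\<mu>" "inc a j = 1" "inc a (Suc j) = 0"
      | "j < n" "\<not> \<mu>" "inc b j = 0" "inc b (Suc j) = 1"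
      using c j by (auto simp: lower_coeff_def Tab split: if_splits)
    then show ?thesis
    proof cases
      case 1
      \<comment> \<open>Across the double bond the two parameters at \<open>n - 1\<close> lie one
        below and one above the pole, and both exponents rise by 1.\<close>
      have "n - 1 = k" using 1(1) down by simp
      then have "cartan n k j = - 2" using 1(1) k' by (simp add: cartan_def)
      then have C: "cartan_coeff m k j = - (qi n q k powi m + qi n q k powi - m)" by (simp add: cartan_coeff_def)
      have "inc a (Suc k) = 1" "inc b (Suc k) = 0" using 1 down by simp_all
      then have p: "spec1 k T = pole_exp j \<mu> T + - 1" "spec2 k T = pole_exp j \<mu> T + 1"
        "spec1 k (lowering j \<mu> T) = spec1 k T" "spec2 k (lowering j \<mu> T) = spec2 k T"
        "exp1 k (lowering j \<mu> T) = exp1 k T + 1" "exp2 k (lowering j \<mu> T) = exp2 k T + 1"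
        using 1(2-4) k' jk[unfolded 1(1)] last n_ge_2 unfolding 1(1)
        by (simp_all add: Tab pole_exp_def spec1_def spec2_def exp1_def exp2_def lowering_def inc_upd)
      show ?thesis unfolding ps C p add using Qk(1,2)[OF k'(1)] by (simp add: algebra_simps)
    next
      case 2
      have "cartan n k j = - 1" using down k' \<open>j < n\<close> by (simp add: cartan_def)
      then have C: "cartan_coeff m k j = - 1" by (simp add: cartan_coeff_def)
      have p: "pole_exp j \<mu> T = spec1 k T" "spec1 k (lowering j \<mu> T) = spec1 k T" "exp1 k (lowering j \<mu> T) = exp1 k T + 1"
        "exp2 k (lowering j \<mu> T) = exp2 k T" "spec2 k (lowering j \<mu> T) = spec2 k T"
        using 2 j k' jk down[symmetric] by (simp_all add: Tab pole_exp_def spec1_def spec2_def exp1_def exp2_def lowering_def inc_upd)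
      show ?thesis unfolding ps C p by (simp add: algebra_simps)
    next
      case 3
      have "cartan n k j = - 1" using down k' \<open>j < n\<close> by (simp add: cartan_def)
      then have C: "cartan_coeff m k j = - 1" by (simp add: cartan_coeff_def)
      have p: "pole_exp j \<mu> T = spec2 k T" "spec2 k (lowering j \<mu> T) = spec2 k T" "exp2 k (lowering j \<mu> T) = exp2 k T + 1"
        "exp1 k (lowering j \<mu> T) = exp1 k T" "spec1 k (lowering j \<mu> T) = spec1 k T"
        using 3 j k' jk down[symmetric] by (simp_all add: Tab pole_exp_def spec1_def spec2_def exp1_def exp2_def lowering_def inc_upd)
      show ?thesis unfolding ps C p by (simp add: algebra_simps)
    qed
  qed
  then show ?thesis by (simp add: P_def)
qed

lemma h_eigenvalue_power_sum:
  "h_eigenvalue Q (exp1 k T) (q powi spec1 k T) (exp2 k T) (q powi spec2 k T) m = qint Q m / of_int m * power_sum m k T"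
proof -
  have "(q powi s) powi m = (q powi m) powi s" for s
    by (simp add: mult.commute flip: power_int_mult)
  then show ?thesis by (simp add: h_eigenvalue_def power_sum_def)
qed

lemma model_h_eigenvalues:
  assumes "T \<in> states" "j \<in> {1..n}" "k \<in> {1..n}" "lower_coeff j \<mu> T \<noteq> 0"
  shows "h_eigenvalue (qi n q k) (exp1 k (lowering j \<mu> T)) (q powi spec1 k (lowering j \<mu> T))
            (exp2 k (lowering j \<mu> T)) (q powi spec2 k (lowering j \<mu> T)) m
        = h_eigenvalue (qi n q k) (exp1 k T) (q powi spec1 k T) (exp2 k T) (q powi spec2 k T) m
          - 1 / of_int m * qint (qi n q k) (m * cartan n k j) * (q powi pole_exp j \<mu> T) powi m"
proof -
  have "(q powi s) powi m = (q powi m) powi s" for s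
    by (simp add: mult.commute flip: power_int_mult)
  then show ?thesis
    unfolding h_eigenvalue_power_sum power_sum_lowering[OF assms] qint_cartan
    by (simp add: algebra_simps)
qed

end

section \<open>Finiteness, depth and the highest column\<close>

context type_C_fund
begin

lemma states_mono:
  assumes T: "(a, b) \<in> states" and "j \<le> k" "k \<le> n"
  shows "a j \<le> a k" "b j \<le> b k" "a k \<le> a j + int (k - j)"
proof -
  have "a j \<le> a k \<and> b j \<le> b k \<and> a k \<le> a j + int (k - j)" using assms(2,3)
  proof (induction k rule: dec_induct)
    case (step k)
    have "inc a (Suc k) \<in> {0, 1}" "inc b (Suc k) \<in> {0, 1}"
      using states_inc[OF T, of "Suc k"] by auto
    moreover have "inc a (Suc k) = a (Suc k) - a k" "inc b (Suc k) = b (Suc k) - b k"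
      using step by (simp_all add: inc_def)
    ultimately show ?case using step by auto
  qed simp
  then show "a j \<le> a k" "b j \<le> b k" "a k \<le> a j + int (k - j)" by auto
qed

lemma states_bounds:
  assumes T: "(a, b) \<in> states" and j: "j \<le> n"
  shows "0 \<le> a j" "0 \<le> b j" "a j \<le> int j" "a j \<le> int i" "b j \<le> int i"
proof -
  have 0: "a 0 = 0" "b 0 = 0" and n: "a n + b n = int i" using T by (auto simp: states_def)
  show ge: "0 \<le> a j" "0 \<le> b j" "a j \<le> int j"
    using states_mono[OF T, of 0 j] j 0 by auto
  have "0 \<le> a n" "0 \<le> b n" using states_mono[OF T, of 0 n] 0 by auto
  then show "a j \<le> int i" "b j \<le> int i"
    using states_mono[OF T j order_refl] n by auto
qed

lemma finite_states: "finite states"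
proof -
  define A where "A = {f :: nat \<Rightarrow> int. \<forall>j. (j \<in> {0..n} \<longrightarrow> f j \<in> {0..int i}) \<and> (j \<notin> {0..n} \<longrightarrow> f j = 0)}"
  have "finite A" unfolding A_def by (rule finite_set_of_finite_funs) auto
  moreover have "states \<subseteq> A \<times> A"
  proof
    fix T assume T: "T \<in> states"
    obtain a b where Tab: "T = (a, b)" by (cases T)
    have "\<forall>j>n. a j = 0 \<and> b j = 0" using T by (auto simp: Tab states_def)
    then show "T \<in> A \<times> A" using states_bounds[of a b] T by (auto simp: Tab A_def)
  qed
  ultimately show ?thesis by (meson finite_SigmaI finite_subset)
qed

lemma inc_top: "j \<in> {1..n} \<Longrightarrow> inc (fst top_state) j = (if j \<le> i then 1 else 0)" "inc (\<lambda>_. 0) j = 0"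
  by (auto simp: inc_def top_state_def min_def)

lemma top_states: "top_state \<in> states"
proof -
  have "inc (fst top_state) j \<in> {0, 1} \<and> inc (snd top_state) j \<in> {0, 1}" if "j \<in> {1..n}" for j
    using inc_top[of j] that by (simp add: top_state_def)
  then show ?thesis using i by (auto simp: top_state_def states_def excess_def)
qed

lemma level_le_top:
  assumes "T \<in> states"
  shows "level T \<le> level top_state"
proof -
  obtain a b where Tab: "T = (a, b)" by (cases T)
  have *: "a j \<le> int (min j i)" "0 \<le> b j" if "j \<le> n" for j
    using states_bounds[of a b j] assms that by (auto simp: Tab)
  have "fst T j - snd T j \<le> fst top_state j - snd top_state j" if "j \<in> {1..<n}" for j
    using *[of j] that by (simp add: Tab top_state_def)
  moreover have "fst T n \<le> fst top_state n" using *[of n] by (simp add: Tab top_state_def)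
  ultimately show ?thesis unfolding level_def by (intro add_mono sum_mono)
qed

lemma level_lowering:
  assumes j: "j \<in> {1..n}" and c: "lower_coeff j \<mu> T \<noteq> 0"
  shows "level (lowering j \<mu> T) = level T - 1"
proof -
  obtain a b where Tab: "T = (a, b)" by (cases T)
  have m: "j = n \<Longrightarrow> \<mu>" using c by (auto simp: lower_coeff_def Tab split: if_splits)
  show ?thesis
  proof (cases "j = n")
    case True
    then have "(\<Sum>k=1..<n. fst (lowering j \<mu> T) k - snd (lowering j \<mu> T) k) = (\<Sum>k=1..<n. fst T k - snd T k)"
      by (intro sum.cong) (auto simp: Tab lowering_def)
    then show ?thesis using True m by (simp add: level_def Tab lowering_def)
  next
    case False
    then have "j \<in> {1..<n}" using j by simp
    have "(\<Sum>k=1..<n. fst (lowering j \<mu> T) k - snd (lowering j \<mu> T) k)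
        = (\<Sum>k=1..<n. (fst T k - snd T k) - (if k = j then 1 else 0))"
      by (intro sum.cong) (use False in \<open>auto simp: Tab lowering_def\<close>)
    also have "\<dots> = (\<Sum>k=1..<n. fst T k - snd T k) - 1"
      unfolding sum_subtractf using \<open>j \<in> {1..<n}\<close> by simp
    finally show ?thesis using False by (auto simp: level_def Tab lowering_def)
  qed
qed

lemma depth_lowering:
  assumes "T \<in> states" "j \<in> {1..n}" "lower_coeff j \<mu> T \<noteq> 0"
  shows "depth (lowering j \<mu> T) = Suc (depth T)"
  using level_lowering[OF assms(2,3)] level_le_top[OF assms(1)] by (simp add: depth_def)

text \<open>Without \<open>True\<close> moves the positive letters form an initial segment. Without
  \<open>False\<close> moves a letter \<open>-j\<close> would force \<open>-(j + 1)\<close> and so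
  on up to \<open>-n\<close>, which the move at \<open>n\<close> rules out.\<close>

lemma extremal_is_top:
  assumes T: "T \<in> states" and no: "\<And>j \<mu>. j \<in> {1..n} \<Longrightarrow> raise_coeff j \<mu> T = 0"
  shows "T = top_state"
proof -
  obtain a b where Tab: "T = (a, b)" by (cases T)
  have S: "(a, b) \<in> states" using T Tab by simp
  have a01: "inc a j \<in> {0, 1}" "inc b j \<in> {0, 1}" if "j \<in> {1..n}" for j using states_inc[OF S, of j] that by auto
  have last: "inc a n + inc b n \<le> 1" by (rule states_last[OF S])
  have out: "a j = 0" "b j = 0" if "j > n" for j using S that by (auto simp: states_def)
  have sum: "a n + b n = int i" and 0: "a 0 = 0" "b 0 = 0" using S by (auto simp: states_def)
  have dec: "inc a (Suc j) \<le> inc a j" if "j \<in> {1..n}" "j < n" for j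
    using no[of j True] that a01[of j] a01[of "Suc j"] by (auto simp: Tab raise_coeff_def split: if_splits)
  have bn: "inc b n = 0"
    using no[of n True] a01[of n] last n_ge_2 by (auto simp: Tab raise_coeff_def split: if_splits)
  have b_up: "inc b (Suc j) = 1" if j: "j \<in> {1..n}" "j < n" and b: "inc b j = 1" for j
  proof (rule ccontr)
    assume "inc b (Suc j) \<noteq> 1"
    then have b2: "inc b (Suc j) = 0" using a01[of "Suc j"] j by auto
    \<comment> \<open>A value 0 of \<open>rho\<close> requires excess 0: with \<open>e = 1\<close>,
      or with \<open>e = -1\<close> through division by 0. The first contradicts the decrease of
      \<open>inc a\<close>, the second the bound on the excess at \<open>j + 1\<close>.\<close>
    have r: "rho (excess (a, b) j) (inc a (Suc j) - inc a j) = 0"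
      using no[of j False] j b b2 by (simp add: Tab raise_coeff_def)
    have "0 \<le> excess (a, b) (Suc j)" using excess_nonneg[OF S, of "Suc j"] j by simp
    then have "1 \<le> excess (a, b) j \<or> inc a (Suc j) = 1" using excess_Suc[OF j(2), of a b] b2 a01[of "Suc j"] j by auto
    moreover have "inc a (Suc j) - inc a j \<in> {0, - 1}" using dec[OF j] a01[of j] a01[of "Suc j"] j by auto
    moreover have "0 \<le> excess (a, b) j" using excess_nonneg[OF S, of j] j by simp
    moreover have "inc a (Suc j) = 1 \<Longrightarrow> inc a (Suc j) - inc a j = 0" using dec[OF j] a01[of j] j by auto
    ultimately show False using r by (auto simp: rho_def split: if_splits)
  qed
  have inc_b: "inc b j = 0" if "j \<in> {1..n}" for j
  proof (rule ccontr)
    assume "inc b j \<noteq> 0"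
    then have "inc b j = 1" using a01[OF that] by auto
    have "inc b k = 1" if "j \<le> k" "k \<le> n" for k using that
    proof (induction k rule: dec_induct)
      case (step k)
      then show ?case using b_up[of k] \<open>j \<in> {1..n}\<close> by auto
    qed (simp add: \<open>inc b j = 1\<close>)
    from this[of n] show False using bn that by simp
  qed
  have b0: "b j = 0" for j
  proof (cases "j \<le> n")
    case True
    then show ?thesis
    proof (induction j)
      case (Suc j)
      then show ?case using inc_b[of "Suc j"] by (simp add: inc_def)
    qed (simp add: 0)
  qed (use out in auto)
  have an: "a n = int i" using sum b0 by simp
  have dec': "inc a k \<le> inc a j" if "j \<le> k" "1 \<le> j" "k \<le> n" for j k
    using that
  proof (induction k rule: dec_induct)
    case (step k)
    then show ?case using dec[of k] by force
  qed simp
  have up: "a j = int (min j i)" if "j \<le> n" for j using that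
  proof (induction j)
    case (Suc j)
    have a: "a (Suc j) = int (min j i) + inc a (Suc j)" using Suc by (simp add: inc_def)
    show ?case
    proof (cases "j < i")
      case True
      have "inc a (Suc j) = 1"
      proof (rule ccontr)
        assume "inc a (Suc j) \<noteq> 1"
        then have z: "inc a (Suc j) = 0" using a01[of "Suc j"] Suc by auto
        have "a k = a j" if "j \<le> k" "k \<le> n" for k using that
        proof (induction k rule: dec_induct)
          case (step k)
          then have "inc a (Suc k) \<le> 0" using dec'[of "Suc j" "Suc k"] z by auto
          then have "inc a (Suc k) = 0" using a01[of "Suc k"] step by auto
          then show ?case using step by (simp add: inc_def)
        qed simp
        from this[of n] an Suc True show False by simp
      qed
      then show ?thesis using a True by simp
    next
      case False
      have "a (Suc j) \<le> int i" using states_bounds[OF S Suc.prems] by simp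
      then show ?thesis using a False a01[of "Suc j"] Suc.prems by auto
    qed
  qed (use 0 in simp)
  show ?thesis
    unfolding Tab top_state_def using up out b0 by (auto simp: fun_eq_iff)
qed

lemma raise_coeff_top: "j \<in> {1..n} \<Longrightarrow> raise_coeff j \<mu> top_state = 0"
  using inc_top[of j] inc_top[of "Suc j"] inc_top(2) by (auto simp: top_state_def raise_coeff_def inc_def[of _ "Suc n"])

text \<open>At \<open>j < n\<close> both pairs differ by twice the excess plus 2; at
  \<open>n\<close> they differ in parity.\<close>

lemma pole_exp_distinct:
  assumes T: "T \<in> states" and j: "j \<in> {1..n}"
  shows "pole_exp j True T \<noteq> pole_exp j False T" "pole_exp j True (raising j True T) \<noteq> pole_exp j False (raising j False T)"
proof -
  obtain a b where Tab: "T = (a, b)" by (cases T)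
  have "0 \<le> excess (a, b) j" using excess_nonneg[OF T, of j] j by (simp add: Tab)
  then have x: "j < n \<Longrightarrow> 0 \<le> int n - int j - int i + a j + b j" by (simp add: excess_def)
  have "a n + b n = int i" using T by (auto simp: Tab states_def)
  then have "pole_exp n True T = int n - int i + 2 * b n + 1" "pole_exp n False T = int n - int i + 2 * b n + 2"
    "pole_exp n True (raising n True T) = int n - int i + 2 * b n - 1" "pole_exp n False (raising n False T) = int n - int i + 2 * b n"
    by (simp_all add: Tab pole_exp_def raising_def)
  then show "pole_exp j True T \<noteq> pole_exp j False T" "pole_exp j True (raising j True T) \<noteq> pole_exp j False (raising j False T)"
    using x j by (cases "j = n"; force simp: Tab pole_exp_def raising_def)+
qed

lemma exp_range:
  assumes "T \<in> states" "j \<in> {1..n}"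
  shows "exp1 j T \<in> {-1, 0, 1}" "exp2 j T \<in> {-1, 0, 1}"
proof -
  obtain a b where Tab: "T = (a, b)" by (cases T)
  have "inc a j \<in> {0, 1}" "inc a (j + 1) \<in> {0, 1}" "inc b j \<in> {0, 1}" "inc b (j + 1) \<in> {0, 1}"
    using states_inc[of a b j] states_inc[of a b "j + 1"] assms by (auto simp: Tab)
  then show "exp1 j T \<in> {-1, 0, 1}" "exp2 j T \<in> {-1, 0, 1}"
    by (auto simp: Tab exp1_def exp2_def)
qed

lemma pole_powi: "q powi spec1 j T * qi n q j powi exp1 j T = q powi pole1 j T"
    "q powi spec2 j T * qi n q j powi exp2 j T = q powi pole2 j T"
  using q_nonzero by (simp_all add: pole1_def pole2_def qi_powi power_int_add)

text \<open>The value -1 compensates the shift by \<open>q\<close> in the eigenvalues of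
  \<open>P_elt\<close>, giving the parameter 1 of the module.\<close>

lemma exp_top:
  assumes "j \<in> {1..n}"
  shows "exp1 j top_state = (if j = i then 1 else 0)" "exp2 j top_state = 0" "spec1 i top_state = - 1"
  using assms i inc_top[of j] inc_top[of "Suc j"] inc_top(2)
  by (auto simp: exp1_def exp2_def spec1_def top_state_def inc_def[of _ "Suc n"])

end

locale type_C_fund_module = type_C_fund n q scale act i
  for n q and scale :: "complex \<Rightarrow> 'v::ab_group_add \<Rightarrow> 'v" and act i +
  fixes v0 :: 'v
  assumes type_one: "type_one n q scale act" and irreducible: "uq_irreducible n q scale act"
    and v0_nonzero: "v0 \<noteq> 0"
    and v0_weight: "\<And>j. j \<in> {1..n} \<Longrightarrow> K Plus j v0 = scale (qi n q j powi (if j = i then 1 else 0)) v0"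
    and v0_killed: "\<And>j r. j \<in> {1..n} \<Longrightarrow> X Plus j r v0 = 0"
    and v0_P: "\<And>j s k. j \<in> {1..n} \<Longrightarrow> opr (P_elt n q s j k) v0 = scale (fps_nth (if j = i then lin 1 else 1) k) v0"
begin

lemma v0_H:
  assumes j: "j \<in> {1..n}" and m: "m \<noteq> 0"
  shows "H j m v0 = scale (h_eigenvalue (qi n q j) (exp1 j top_state) (q powi spec1 j top_state) (exp2 j top_state) (q powi spec2 j top_state) m) v0"
proof (rule H_if_P_elt[OF j _ _ _ m])
  show "exp1 j top_state \<in> {-1, 0, 1}" "exp2 j top_state \<in> {-1, 0, 1}" using exp_range[OF top_states j] by auto
  fix s k
  have "q * q powi - 1 = 1" using q_nonzero by simp
  then have "signed_power (exp1 j top_state) (lin ((q * q powi spec1 j top_state) powi sg s))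
      * signed_power (exp2 j top_state) (lin ((q * q powi spec2 j top_state) powi sg s)) = (if j = i then lin 1 else 1)"
    using exp_top[OF j] by (auto simp: signed_power_def)
  then show "opr (P_elt n q s j k) v0 = scale (fps_nth (signed_power (exp1 j top_state) (lin ((q * q powi spec1 j top_state) powi sg s))
      * signed_power (exp2 j top_state) (lin ((q * q powi spec2 j top_state) powi sg s))) k) v0"
    using v0_P[OF j] by simp
qed

sublocale thin_model n q scale act states top_state depth lowering raising lower_coeff raise_coeff
  "\<lambda>j \<mu> T. q powi pole_exp j \<mu> T" exp1 exp2 "\<lambda>j T. q powi spec1 j T" "\<lambda>j T. q powi spec2 j T" v0
proof unfold_locales
  show "2 \<le> n" by (rule n_ge_2)
  show "finite states" by (rule finite_states)
  show "top_state \<in> states" by (rule top_states)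
  show "depth top_state = 0" by (simp add: depth_def)
  fix j \<mu> T assume j: "j \<in> {1..n}"
  show "raise_coeff j \<mu> top_state = 0" by (rule raise_coeff_top[OF j])
  show "K Plus j v0 = scale (qi n q j powi (exp1 j top_state + exp2 j top_state)) v0"
    using v0_weight[OF j] exp_top[OF j] by simp
  show "X Plus j r v0 = 0" for r by (rule v0_killed[OF j])
  show "H j m v0 = scale (h_eigenvalue (qi n q j) (exp1 j top_state) (q powi spec1 j top_state) (exp2 j top_state) (q powi spec2 j top_state) m) v0"
    if "m \<noteq> 0" for m using v0_H[OF j that] .
  assume T: "T \<in> states"
  show "exp1 j T \<in> {-1, 0, 1} \<and> exp2 j T \<in> {-1, 0, 1}" using exp_range[OF T j] by simp
  show "q powi spec1 j T * qi n q j powi exp1 j T \<noteq> q powi spec2 j T * qi n q j powi exp2 j T"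
    unfolding pole_powi using poles_distinct[OF T j] by (simp add: q_powi_eq_iff)
  show "q powi pole_exp j \<mu> T \<noteq> q powi pole_exp j (\<not> \<mu>) T"
    using pole_exp_distinct(1)[OF T j] by (cases \<mu>) (auto simp: q_powi_eq_iff)
  show "q powi pole_exp j \<mu> (raising j \<mu> T) \<noteq> q powi pole_exp j (\<not> \<mu>) (raising j (\<not> \<mu>) T)"
    using pole_exp_distinct(2)[OF T j] by (cases \<mu>) (auto simp: q_powi_eq_iff)
  show "psi_residues (qi n q j) (exp1 j T) (q powi spec1 j T * qi n q j powi exp1 j T) (exp2 j T) (q powi spec2 j T * qi n q j powi exp2 j T) m
        = (qi n q j - inverse (qi n q j)) *
          ((lower_coeff j True T * raise_coeff j True (lowering j True T) - raise_coeff j True T * lower_coeff j True (raising j True T))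
             * (q powi spec1 j T * qi n q j powi exp1 j T) powi m
           + (lower_coeff j False T * raise_coeff j False (lowering j False T) - raise_coeff j False T * lower_coeff j False (raising j False T))
             * (q powi spec2 j T * qi n q j powi exp2 j T) powi m)" for m
    unfolding pole_powi by (rule model_residues[OF T j])
  show "lowering j \<mu> T \<in> states \<and> depth (lowering j \<mu> T) = Suc (depth T) \<and> raising j \<mu> (lowering j \<mu> T) = T"
    if "lower_coeff j \<mu> T \<noteq> 0"
    using lowering_states[OF T j that] depth_lowering[OF T j that] raising_lowering by simp
  show "raising j \<mu> T \<in> states \<and> lowering j \<mu> (raising j \<mu> T) = T \<and> lower_coeff j \<mu> (raising j \<mu> T) \<noteq> 0"
    if "raise_coeff j \<mu> T \<noteq> 0"
    using raising_states[OF T j that] raising_lowering raise_then_lower_coeff[OF T j that] by simp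
  show "q powi pole_exp j \<mu> T = (if \<mu> then q powi spec1 j T * qi n q j powi exp1 j T else q powi spec2 j T * qi n q j powi exp2 j T)"
    if "lower_coeff j \<mu> T \<noteq> 0"
    unfolding pole_powi lower_coeff_pole[OF T j that] by simp
  show "q powi pole_exp j \<mu> (raising j \<mu> T) = (if \<mu> then q powi spec1 j T * qi n q j powi exp1 j T else q powi spec2 j T * qi n q j powi exp2 j T)"
    if "raise_coeff j \<mu> T \<noteq> 0"
    unfolding pole_powi raise_coeff_pole[OF T j that] by simp
  fix k assume k: "k \<in> {1..n}"
  show "lower_coeff j \<mu> T * raise_coeff k \<nu> (lowering j \<mu> T) = raise_coeff k \<nu> T * lower_coeff j \<mu> (raising k \<nu> T)"
    if "(j, \<mu>) \<noteq> (k, \<nu>)" for \<nu> by (rule coeffs_commute[OF T j k that])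
  show "raising k \<nu> (lowering j \<mu> T) = lowering j \<mu> (raising k \<nu> T) \<and>
      q powi pole_exp k \<nu> (lowering j \<mu> (raising k \<nu> T)) = q powi pole_exp k \<nu> (raising k \<nu> T) \<and>
      q powi pole_exp j \<mu> (raising k \<nu> T) = q powi pole_exp j \<mu> T"
    if "(j, \<mu>) \<noteq> (k, \<nu>)" "lower_coeff j \<mu> T \<noteq> 0" "raise_coeff k \<nu> (lowering j \<mu> T) \<noteq> 0" for \<nu>
    using moves_commute[OF j k that] by simp
  assume c: "lower_coeff j \<mu> T \<noteq> 0"
  show "exp1 k (lowering j \<mu> T) + exp2 k (lowering j \<mu> T) = exp1 k T + exp2 k T - cartan n k j"
    by (rule model_weights[OF j k c])
  show "h_eigenvalue (qi n q k) (exp1 k (lowering j \<mu> T)) (q powi spec1 k (lowering j \<mu> T))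
            (exp2 k (lowering j \<mu> T)) (q powi spec2 k (lowering j \<mu> T)) m
        = h_eigenvalue (qi n q k) (exp1 k T) (q powi spec1 k T) (exp2 k T) (q powi spec2 k T) m
          - 1 / of_int m * qint (qi n q k) (m * cartan n k j) * (q powi pole_exp j \<mu> T) powi m" for m
    by (rule model_h_eigenvalues[OF T j k c])
next
  show "q powi spec1 j T \<noteq> 0" "q powi spec2 j T \<noteq> 0" for j T using q_nonzero by simp_all
  show "\<exists>j\<in>{1..n}. \<exists>\<mu>. raise_coeff j \<mu> T \<noteq> 0" if "T \<in> states" "T \<noteq> top_state" for T
    using extremal_is_top that by blast
qed (fact type_one irreducible v0_nonzero)+

end

section \<open>Rational functions and \<open>\<ell>\<close>-weights\<close>

definition ell_series :: "sign \<Rightarrow> ratfun \<Rightarrow> complex fps" where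
  "ell_series s f = Abs_fps (ell_coeff s f)"

text \<open>All entries of elements of \<open>ell_lattice n\<close> have this form. On it both
  expansions are multiplicative, the normalisation of the one for \<open>Minus\<close> being a
  quotient of leading coefficients.\<close>

definition normalized_ratfun :: "ratfun \<Rightarrow> bool" where
  "normalized_ratfun f \<longleftrightarrow> (\<exists>a b. coeff a 0 = 1 \<and> coeff b 0 = 1 \<and> f = Fraction_Field.Fract a b)"

definition poly_series :: "sign \<Rightarrow> complex poly \<Rightarrow> complex fps" where
  "poly_series s a = (case s of Plus \<Rightarrow> fps_of_poly a
     | Minus \<Rightarrow> fps_const (inverse (lead_coeff a)) * fps_of_poly (reflect_poly a))"

lemma poly_series_mult: "poly_series s (a * b) = poly_series s a * poly_series s b"
  by (cases s) (simp_all add: poly_series_def fps_of_poly_mult reflect_poly_mult lead_coeff_mult mult_ac flip: fps_const_mult)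

lemma poly_series_0: "coeff a 0 = 1 \<Longrightarrow> fps_nth (poly_series s a) 0 = 1"
  by (cases s; cases "a = 0") (auto simp: poly_series_def)

lemma ell_series_Fract:
  assumes a: "coeff a 0 = 1" and b: "coeff b 0 = 1"
  shows "ell_series s (Fraction_Field.Fract a b) = poly_series s a * inverse (poly_series s b)"
proof (cases s)
  case Plus
  have "ratfun_series (Fraction_Field.Fract a b) = fps_of_poly a * inverse (fps_of_poly b)"
    using b by (simp add: ratfun_series_Fract fps_divide_unit)
  then show ?thesis using Plus by (intro fps_ext) (simp add: ell_series_def poly_series_def)
next
  case Minus
  have nz: "a \<noteq> 0" "b \<noteq> 0" using a b by auto
  define F where "F = fps_of_poly (reflect_poly a) * inverse (fps_of_poly (reflect_poly b))"
  have r: "ratfun_series (ratfun_reflect (Fraction_Field.Fract a b)) = F"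
    using nz by (simp add: F_def ratfun_reflect_Fract ratfun_series_Fract fps_divide_unit)
  have "fps_nth F 0 = lead_coeff a * inverse (lead_coeff b)" by (simp add: F_def)
  then have "ell_series s (Fraction_Field.Fract a b) = fps_const (inverse (lead_coeff a) * lead_coeff b) * F"
    using Minus nz by (intro fps_ext) (simp add: ell_series_def r divide_inverse mult_ac)
  also have "\<dots> = poly_series s a * inverse (poly_series s b)"
    using Minus nz by (simp add: F_def poly_series_def fps_inverse_mult fps_const_inverse mult_ac flip: fps_const_mult)
  finally show ?thesis .
qed

lemma normalized_ratfun_one: "normalized_ratfun 1"
  by (auto simp: normalized_ratfun_def One_fract_def intro!: exI[of _ 1])

lemma normalized_ratfun_mult:
  assumes "normalized_ratfun f" "normalized_ratfun g"
  shows "normalized_ratfun (f * g)" "ell_series s (f * g) = ell_series s f * ell_series s g"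
proof -
  obtain a b where f: "coeff a 0 = 1" "coeff b 0 = 1" "f = Fraction_Field.Fract a b"
    using assms by (auto simp: normalized_ratfun_def)
  obtain c d where g: "coeff c 0 = 1" "coeff d 0 = 1" "g = Fraction_Field.Fract c d"
    using assms by (auto simp: normalized_ratfun_def)
  have fg: "f * g = Fraction_Field.Fract (a * c) (b * d)" "coeff (a * c) 0 = 1" "coeff (b * d) 0 = 1"
    using f g by (simp_all add: coeff_mult_0)
  then show "normalized_ratfun (f * g)" unfolding normalized_ratfun_def by blast
  show "ell_series s (f * g) = ell_series s f * ell_series s g"
    using ell_series_Fract[OF f(1,2), of s, folded f(3)] ell_series_Fract[OF g(1,2), of s, folded g(3)]
      ell_series_Fract[OF fg(2,3), of s, folded fg(1)]
    by (simp add: poly_series_mult fps_inverse_mult mult_ac)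
qed

lemma normalized_ratfun_inverse:
  assumes "normalized_ratfun f"
  shows "normalized_ratfun (inverse f)" "ell_series s (inverse f) = inverse (ell_series s f)"
proof -
  obtain a b where f: "coeff a 0 = 1" "coeff b 0 = 1" "f = Fraction_Field.Fract a b"
    using assms by (auto simp: normalized_ratfun_def)
  have i: "inverse f = Fraction_Field.Fract b a" using f by simp
  then show "normalized_ratfun (inverse f)" using f unfolding normalized_ratfun_def by blast
  show "ell_series s (inverse f) = inverse (ell_series s f)"
    using ell_series_Fract[OF f(1,2), of s, folded f(3)] ell_series_Fract[OF f(2,1), of s, folded i]
      poly_series_0[OF f(1), of s] poly_series_0[OF f(2), of s]
    by (simp add: fps_inverse_mult fps_inverse_idempotent mult_ac)
qed

lemma normalized_ratfun_eqI:
  assumes "normalized_ratfun f" "normalized_ratfun g" "ell_series Plus f = ell_series Plus g"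
  shows "f = g"
proof -
  obtain a b where f: "coeff a 0 = 1" "coeff b 0 = 1" "f = Fraction_Field.Fract a b"
    using assms by (auto simp: normalized_ratfun_def)
  obtain c d where g: "coeff c 0 = 1" "coeff d 0 = 1" "g = Fraction_Field.Fract c d"
    using assms by (auto simp: normalized_ratfun_def)
  have inv: "inverse (fps_of_poly b) * fps_of_poly b = 1" "inverse (fps_of_poly d) * fps_of_poly d = 1"
    using f g by (auto intro!: inverse_mult_eq_1)
  have "fps_of_poly a * inverse (fps_of_poly b) = fps_of_poly c * inverse (fps_of_poly d)"
    using assms(3) unfolding f(3) g(3) ell_series_Fract[OF f(1,2)] ell_series_Fract[OF g(1,2)]
    by (simp add: poly_series_def)
  then have "fps_of_poly a * (inverse (fps_of_poly b) * fps_of_poly b) * fps_of_poly d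
      = fps_of_poly c * (inverse (fps_of_poly d) * fps_of_poly d) * fps_of_poly b"
    by (metis (no_types, lifting) mult.assoc mult.commute)
  then have "fps_of_poly (a * d) = fps_of_poly (c * b)" unfolding inv by (simp add: fps_of_poly_mult)
  then have "a * d = c * b" by (simp only: fps_of_poly_eq_iff)
  moreover have "b \<noteq> 0" "d \<noteq> 0" using f g by auto
  ultimately show ?thesis using f(3) g(3) by (simp add: eq_fract)
qed

lemma ell_fund_same: "k \<noteq> 0 \<Longrightarrow> ell_fund k z k = Fraction_Field.Fract [:1, - z:] 1"
  by (simp add: ell_fund_def)

lemma ell_fund_other: "k \<noteq> j \<or> j = 0 \<Longrightarrow> ell_fund j z k = 1"
  by (auto simp: ell_fund_def)

lemma normalized_ell_fund: "normalized_ratfun (ell_fund j z k)"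
proof (cases "k = j \<and> j \<noteq> 0")
  case True
  then have "coeff [:1, - z:] 0 = 1" "coeff 1 0 = (1 :: complex)" "ell_fund j z k = Fraction_Field.Fract [:1, - z:] 1"
    by (simp_all add: ell_fund_def)
  then show ?thesis unfolding normalized_ratfun_def by blast
next
  case False
  then show ?thesis using ell_fund_other[of k j z] normalized_ratfun_one by auto
qed

lemma ell_series_one: "ell_series s 1 = 1"
proof -
  have "(1 :: ratfun) = Fraction_Field.Fract 1 1" by (simp add: One_fract_def)
  then have "ell_series s 1 = poly_series s 1 * inverse (poly_series s 1)"
    using ell_series_Fract[of 1 1 s] by simp
  then show ?thesis by (cases s) (simp_all add: poly_series_def)
qed

lemma ell_series_ell_fund:
  assumes "k \<noteq> 0" "z \<noteq> 0"
  shows "ell_series s (ell_fund k z k) = lin (z powi sg s)"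
proof -
  have one: "poly_series s 1 = 1" by (cases s) (simp_all add: poly_series_def)
  have r: "reflect_poly [:1, - z:] = [:- z, 1:]" using assms by (simp add: reflect_poly_pCons' monom_altdef)
  have "poly_series s [:1, - z:] = lin (z powi sg s)"
    using assms by (cases s) (auto simp: poly_series_def lin_nth r coeff_pCons fps_eq_iff split: nat.splits)
  then show ?thesis
    unfolding ell_fund_same[OF assms(1)] using one by (subst ell_series_Fract) simp_all
qed

lemma normalized_signed_power:
  assumes "normalized_ratfun f"
  shows "normalized_ratfun (signed_power e f)" "ell_series s (signed_power e f) = signed_power e (ell_series s f)"
  using assms normalized_ratfun_inverse normalized_ratfun_one by (auto simp: signed_power_def ell_series_one)

lemma ell_lattice_normalized:
  assumes "f \<in> ell_lattice n"
  shows "normalized_ratfun (f k) \<and> (k \<notin> {1..n} \<longrightarrow> f k = 1)"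
  using assms
proof induction
  case (fund i a)
  then show ?case using normalized_ell_fund ell_fund_other[of k i a] by auto
qed (auto simp: normalized_ratfun_one normalized_ratfun_mult normalized_ratfun_inverse)

lemma ell_lattice_prod:
  "(\<And>x. x \<in> A \<Longrightarrow> f x \<in> ell_lattice n) \<Longrightarrow> (\<lambda>k. \<Prod>x\<in>A. f x k) \<in> ell_lattice n"
proof (induction A rule: infinite_finite_induct)
  case (insert x A)
  then show ?case using ell_lattice.mult[of "f x" n "\<lambda>k. \<Prod>x\<in>A. f x k"] by simp
qed (auto intro: ell_lattice.one)

section \<open>Simultaneous eigenvectors and valuations of rational functions\<close>

context uq_rep
begin

lemma span_image_sum:
  assumes "finite S" "x \<in> vs.span (v ` S)"
  obtains c where "x = (\<Sum>T\<in>S. scale (c T) (v T))"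
proof -
  have "\<exists>c. x = (\<Sum>T\<in>S. scale (c T) (v T))" using assms(2)
  proof (induction rule: vs.span_induct_alt)
    case base
    show ?case by (intro exI[of _ "\<lambda>_. 0"]) simp
  next
    case (step a y x)
    then obtain c T where c: "x = (\<Sum>T\<in>S. scale (c T) (v T))" and T: "T \<in> S" "y = v T" by blast
    have "(\<Sum>T'\<in>S. scale (if T' = T then a else 0) (v T')) = scale a y"
      using assms(1) T by (subst sum.remove[OF assms(1) T(1)]) (simp add: sum.neutral)
    then have "scale a y + x = (\<Sum>T'\<in>S. scale ((if T' = T then a else 0) + c T') (v T'))"
      unfolding vs.scale_left_distrib sum.distrib by (simp add: c)
    then show ?case by (intro exI[of _ "\<lambda>T'. (if T' = T then a else 0) + c T'"])
  qed
  then show ?thesis using that by blast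
qed

text \<open>The usual elimination for distinct eigenvalues, except that the operator separating
  \<open>T\<close> from \<open>T0\<close> may depend on \<open>T\<close>.\<close>

lemma eigenvectors_independent:
  assumes "finite S" and G: "\<And>f. f \<in> G \<Longrightarrow> f \<in> carrier (free_alg n)"
    and eig: "\<And>f T. f \<in> G \<Longrightarrow> T \<in> S \<Longrightarrow> opr f (v T) = scale (\<chi> f T) (v T)"
    and nz: "\<And>T. T \<in> S \<Longrightarrow> v T \<noteq> 0"
    and sep: "\<And>T T'. T \<in> S \<Longrightarrow> T' \<in> S \<Longrightarrow> T \<noteq> T' \<Longrightarrow> \<exists>f\<in>G. \<chi> f T \<noteq> \<chi> f T'"
    and "(\<Sum>T\<in>S. scale (c T) (v T)) = 0"
  shows "\<forall>T\<in>S. c T = 0"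
  using assms(1,3-6)
proof (induction S arbitrary: c)
  case (insert T0 S)
  have c0: "c T = 0" if T: "T \<in> S" for T
  proof -
    have "T \<noteq> T0" using T insert.hyps by blast
    then obtain f where f: "f \<in> G" "\<chi> f T \<noteq> \<chi> f T0" using insert.prems(3)[of T T0] T by auto
    note lin = opr_linear_simps[OF G[OF f(1)]]
    have "0 = opr f (\<Sum>T\<in>insert T0 S. scale (c T) (v T)) - scale (\<chi> f T0) (\<Sum>T\<in>insert T0 S. scale (c T) (v T))"
      by (simp only: insert.prems(4) lin vs.scale_zero_right diff_zero)
    also have "\<dots> = (\<Sum>T\<in>insert T0 S. scale (c T * (\<chi> f T - \<chi> f T0)) (v T))"
      unfolding lin vs.scale_sum_right sum_subtractf[symmetric]
      using insert.prems(1)[OF f(1)]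
      by (intro sum.cong refl) (simp add: right_diff_distrib vs.scale_left_diff_distrib mult.commute)
    also have "\<dots> = (\<Sum>T\<in>S. scale (c T * (\<chi> f T - \<chi> f T0)) (v T))"
      using insert.hyps by simp
    finally have "\<forall>T\<in>S. c T * (\<chi> f T - \<chi> f T0) = 0"
      by (intro insert.IH) (use insert.prems in auto)
    then show "c T = 0" using T f by auto
  qed
  then have "scale (c T0) (v T0) = 0" using insert.prems(4) insert.hyps by simp
  then show ?case using c0 insert.prems(2)[of T0] by auto
qed simp

lemma funpow_eigen_sum:
  assumes f: "f \<in> carrier (free_alg n)" and eig: "\<And>T. T \<in> S \<Longrightarrow> opr f (v T) = scale (\<chi> T) (v T)"
  shows "((\<lambda>w. opr f w - scale \<mu> w) ^^ N) (\<Sum>T\<in>S. scale (c T) (v T)) = (\<Sum>T\<in>S. scale (c T * (\<chi> T - \<mu>) ^ N) (v T))"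
proof (induction N)
  case (Suc N)
  show ?case
    unfolding funpow.simps comp_def Suc opr_linear_simps[OF f] vs.scale_sum_right sum_subtractf[symmetric]
    using eig by (intro sum.cong refl) (simp add: algebra_simps flip: vs.scale_left_diff_distrib)
qed simp

end

text \<open>A valuation induced by a function on polynomials. It is a relation because independence
  of the representative needs additivity; it is used with the degree and with the order at a
  point.\<close>

definition fract_val :: "(complex poly \<Rightarrow> nat) \<Rightarrow> ratfun \<Rightarrow> int \<Rightarrow> bool" where
  "fract_val \<nu> f d \<longleftrightarrow> (\<exists>a b. a \<noteq> 0 \<and> b \<noteq> 0 \<and> f = Fraction_Field.Fract a b \<and> d = int (\<nu> a) - int (\<nu> b))"

lemma fract_val_unique:
  assumes \<nu>: "\<And>a b. a \<noteq> 0 \<Longrightarrow> b \<noteq> 0 \<Longrightarrow> \<nu> (a * b) = \<nu> a + \<nu> b"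
    and "fract_val \<nu> f d" "fract_val \<nu> f d'"
  shows "d = d'"
proof -
  obtain a b where f: "a \<noteq> 0" "b \<noteq> 0" "f = Fraction_Field.Fract a b" "d = int (\<nu> a) - int (\<nu> b)"
    using assms(2) by (auto simp: fract_val_def)
  obtain a' b' where f': "a' \<noteq> 0" "b' \<noteq> 0" "f = Fraction_Field.Fract a' b'" "d' = int (\<nu> a') - int (\<nu> b')"
    using assms(3) by (auto simp: fract_val_def)
  have "a * b' = a' * b" using f f' by (simp add: eq_fract)
  then have "\<nu> a + \<nu> b' = \<nu> a' + \<nu> b" using \<nu> f f' by metis
  then show ?thesis using f(4) f'(4) by simp
qed

lemma fract_val_mult:
  assumes "\<And>a b. a \<noteq> 0 \<Longrightarrow> b \<noteq> 0 \<Longrightarrow> \<nu> (a * b) = \<nu> a + \<nu> b" "fract_val \<nu> f d" "fract_val \<nu> g e"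
  shows "fract_val \<nu> (f * g) (d + e)"
proof -
  obtain a b where f: "a \<noteq> 0" "b \<noteq> 0" "f = Fraction_Field.Fract a b" "d = int (\<nu> a) - int (\<nu> b)"
    using assms(2) by (auto simp: fract_val_def)
  obtain a' b' where g: "a' \<noteq> 0" "b' \<noteq> 0" "g = Fraction_Field.Fract a' b'" "e = int (\<nu> a') - int (\<nu> b')"
    using assms(3) by (auto simp: fract_val_def)
  have "f * g = Fraction_Field.Fract (a * a') (b * b')" using f g by simp
  moreover have "d + e = int (\<nu> (a * a')) - int (\<nu> (b * b'))" using f g assms(1) by simp
  ultimately show ?thesis unfolding fract_val_def using f g by (metis mult_eq_0_iff)
qed

lemma fract_val_inverse:
  assumes "fract_val \<nu> f d"
  shows "fract_val \<nu> (inverse f) (- d)"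
proof -
  obtain a b where f: "a \<noteq> 0" "b \<noteq> 0" "f = Fraction_Field.Fract a b" "d = int (\<nu> a) - int (\<nu> b)"
    using assms by (auto simp: fract_val_def)
  have "inverse f = Fraction_Field.Fract b a" "- d = int (\<nu> b) - int (\<nu> a)" using f by simp_all
  then show ?thesis using f unfolding fract_val_def by blast
qed

lemma fract_val_signed_power:
  assumes \<nu>: "\<nu> 1 = 0" and z: "z \<noteq> 0" "k \<noteq> 0" and e: "e \<in> {-1, 0, 1}"
  shows "fract_val \<nu> (signed_power e (ell_fund k z k)) (e * int (\<nu> [:1, - z:]))"
proof -
  have F: "fract_val \<nu> (ell_fund k z k) (int (\<nu> [:1, - z:]))"
    unfolding fract_val_def ell_fund_same[OF z(2)] using \<nu>
    by (intro exI[of _ "[:1, - z:]"] exI[of _ 1]) auto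
  have "fract_val \<nu> 1 0" unfolding fract_val_def One_fract_def using \<nu>
    by (intro exI[of _ 1]) auto
  then show ?thesis using e F fract_val_inverse[OF F] by (auto simp: signed_power_def)
qed

section \<open>Different columns have different \<ell>-weights\<close>

context type_C_fund
begin

text \<open>The summand 1 in the exponents converts the parameter of Y into that of
  \<open>ell_fund\<close>.\<close>

definition ell_weight :: "state \<Rightarrow> nat \<Rightarrow> ratfun" where
  "ell_weight T k = (if k \<in> {1..n} then signed_power (exp1 k T) (ell_fund k (q powi (spec1 k T + 1)) k)
     * signed_power (exp2 k T) (ell_fund k (q powi (spec2 k T + 1)) k) else 1)"

lemma ell_weight_normalized: "normalized_ratfun (ell_weight T k)"
  by (simp add: ell_weight_def normalized_ratfun_mult normalized_signed_power normalized_ell_fund normalized_ratfun_one)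

lemma ell_weight_lattice: "ell_weight T \<in> ell_lattice n"
proof -
  have lat: "(\<lambda>k. signed_power e (ell_fund j (q powi x) k)) \<in> ell_lattice n" if "j \<in> {1..n}" for e j x
  proof -
    have F: "ell_fund j (q powi x) \<in> ell_lattice n" using that q_nonzero by (intro ell_lattice.fund) auto
    consider "e = 1" | "e = - 1" | "e \<noteq> 1" "e \<noteq> - 1" by blast
    then show ?thesis by cases (simp_all add: signed_power_def F ell_lattice.inv ell_lattice.one)
  qed
  define f where "f = (\<lambda>j k. signed_power (exp1 j T) (ell_fund j (q powi (spec1 j T + 1)) k)
     * signed_power (exp2 j T) (ell_fund j (q powi (spec2 j T + 1)) k))"
  have other: "f j k = 1" if "j \<noteq> k" for j k
    using that by (simp add: f_def ell_fund_other signed_power_def)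
  have "ell_weight T k = (\<Prod>j\<in>{1..n}. f j k)" for k
  proof (cases "k \<in> {1..n}")
    case True
    then have "(\<Prod>j\<in>{1..n}. f j k) = f k k * (\<Prod>j\<in>{1..n} - {k}. f j k)" by (intro prod.remove) auto
    also have "(\<Prod>j\<in>{1..n} - {k}. f j k) = 1" using other by (intro prod.neutral) auto
    finally show ?thesis using True by (simp add: ell_weight_def f_def)
  next
    case False
    then have "(\<Prod>j\<in>{1..n}. f j k) = 1" using other by (intro prod.neutral) auto
    then show ?thesis using False by (auto simp: ell_weight_def)
  qed
  then have "ell_weight T = (\<lambda>k. \<Prod>j\<in>{1..n}. f j k)" by blast
  also have "\<dots> \<in> ell_lattice n"
    unfolding f_def by (intro ell_lattice_prod ell_lattice.mult lat)
  finally show ?thesis .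
qed

lemma ell_weight_series:
  assumes "k \<in> {1..n}"
  shows "ell_series s (ell_weight T k) = signed_power (exp1 k T) (lin ((q * q powi spec1 k T) powi sg s))
    * signed_power (exp2 k T) (lin ((q * q powi spec2 k T) powi sg s))"
proof -
  have "q powi (x + 1) = q * q powi x" for x using q_nonzero by (simp add: power_int_add)
  moreover have "q * q powi x \<noteq> 0" for x using q_nonzero by simp
  ultimately show ?thesis using assms
    by (simp add: ell_weight_def normalized_ratfun_mult normalized_signed_power normalized_ell_fund ell_series_ell_fund)
qed

lemma fract_val_ell_weight:
  assumes \<nu>: "\<And>a b. a \<noteq> 0 \<Longrightarrow> b \<noteq> 0 \<Longrightarrow> \<nu> (a * b) = \<nu> a + \<nu> b" "\<nu> 1 = 0"
    and "T \<in> states" "k \<in> {1..n}"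
  shows "fract_val \<nu> (ell_weight T k) (exp1 k T * int (\<nu> [:1, - (q powi (spec1 k T + 1)):]) + exp2 k T * int (\<nu> [:1, - (q powi (spec2 k T + 1)):]))"
proof -
  have "fract_val \<nu> (signed_power (exp1 k T) (ell_fund k (q powi (spec1 k T + 1)) k)) (exp1 k T * int (\<nu> [:1, - (q powi (spec1 k T + 1)):]))"
    "fract_val \<nu> (signed_power (exp2 k T) (ell_fund k (q powi (spec2 k T + 1)) k)) (exp2 k T * int (\<nu> [:1, - (q powi (spec2 k T + 1)):]))"
    using assms(2-4) exp_range[OF assms(3,4)] q_nonzero by (auto intro!: fract_val_signed_power)
  from fract_val_mult[OF \<nu>(1) this] show ?thesis using assms(4) by (simp add: ell_weight_def)
qed

text \<open>The degree forgets the parameters and leaves the sum of the exponents.\<close>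

lemma ell_weight_imp_weight:
  assumes "T \<in> states" "T' \<in> states" "k \<in> {1..n}" "ell_weight T k = ell_weight T' k"
  shows "exp1 k T + exp2 k T = exp1 k T' + exp2 k T'"
proof -
  have deg: "degree (a * b) = degree a + degree b" if "a \<noteq> 0" "b \<noteq> 0" for a b :: "complex poly"
    using that by (rule degree_mult_eq)
  have "degree [:1, - (q powi x):] = 1" for x using q_nonzero by simp
  then show ?thesis
    using fract_val_unique[OF deg fract_val_ell_weight[OF deg _ assms(1,3)] fract_val_ell_weight[OF deg _ assms(2,3), folded assms(4)]]
    by simp
qed

text \<open>The order at the zero of the first factor isolates its exponent, since the second factor
  does not vanish there.\<close>

lemma ell_weight_imp_exp1:
  assumes "T \<in> states" "T' \<in> states" "k \<in> {1..n}" "ell_weight T k = ell_weight T' k"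
    and "spec1 k T = spec1 k T'" "spec2 k T = spec2 k T'" "spec1 k T \<noteq> spec2 k T"
  shows "exp1 k T = exp1 k T'"
proof -
  define x where "x = inverse (q powi (spec1 k T + 1))"
  have x: "x * q powi (spec1 k T + 1) = 1" using q_nonzero by (simp add: x_def)
  have ord: "Polynomial.order x (a * b) = Polynomial.order x a + Polynomial.order x b" if "a \<noteq> 0" "b \<noteq> 0" for a b
    using that by (intro order_mult) simp
  have "[:1, - (q powi (spec1 k T + 1)):] = smult (- (q powi (spec1 k T + 1))) [:- x, 1:]"
    using x by (simp add: mult.commute)
  moreover have "Polynomial.order x [:- x, 1:] = 1" using order_power_n_n[of x 1] by simp
  ultimately have o1: "Polynomial.order x [:1, - (q powi (spec1 k T + 1)):] = 1"
    using q_nonzero by (simp only: order_smult neg_equal_0_iff_equal power_int_eq_0_iff simp_thms)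
  have "q powi (spec2 k T + 1) \<noteq> q powi (spec1 k T + 1)" using assms(7) by (simp add: q_powi_eq_iff)
  then have "x * q powi (spec2 k T + 1) \<noteq> 1" using x q_nonzero by (metis mult.commute mult_left_cancel mult_not_zero zero_neq_one)
  then have o2: "Polynomial.order x [:1, - (q powi (spec2 k T + 1)):] = 0"
    by (intro order_0I) (simp add: mult.commute)
  show ?thesis
    using fract_val_unique[OF ord fract_val_ell_weight[OF ord _ assms(1,3)] fract_val_ell_weight[OF ord _ assms(2,3), folded assms(4)]]
      o1 o2 assms(5,6) by simp
qed

text \<open>The weight coordinates are differences of consecutive values, which are recovered
  downwards from \<open>n + 1\<close>.\<close>

lemma weight_imp_inc_diff:
  assumes "\<And>k. k \<in> {1..n} \<Longrightarrow> exp1 k (a, b) + exp2 k (a, b) = c k - c (Suc k)" "c (Suc n) = 0"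
    and "1 \<le> k" "k \<le> Suc n"
  shows "inc a k - inc b k = c k"
  using assms(4,3)
proof (induction k rule: inc_induct)
  case base
  then show ?case using assms(2) by (simp add: inc_def)
next
  case (step k)
  then show ?case using assms(1)[of k] weight_coord[of k a b] by auto
qed

text \<open>The weight determines \<open>a - b\<close>. Counts are then recovered from
  \<open>n\<close> downwards: those at \<open>j\<close> fix both parameters at node
  \<open>j\<close>, so \<open>exp1 j\<close> can be read off, which yields \<open>inc a j\<close>
  and the counts at \<open>j - 1\<close>. At \<open>n\<close> the difference alone decides, since
  \<open>n\<close> and \<open>-n\<close> exclude each other.\<close>

lemma ell_weight_inj:
  assumes T: "T \<in> states" "T' \<in> states" and eq: "\<And>k. k \<in> {1..n} \<Longrightarrow> ell_weight T k = ell_weight T' k"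
  shows "T = T'"
proof -
  obtain a b where Tab: "T = (a, b)" by (cases T)
  obtain a' b' where T'ab: "T' = (a', b')" by (cases T')
  have S: "(a, b) \<in> states" "(a', b') \<in> states" using T Tab T'ab by simp_all
  have d: "inc a k - inc b k = inc a' k - inc b' k" if "1 \<le> k" "k \<le> Suc n" for k
  proof (rule weight_imp_inc_diff[OF _ _ that])
    show "inc a' (Suc n) - inc b' (Suc n) = 0" by (simp add: inc_def)
    show "exp1 k (a, b) + exp2 k (a, b) = inc a' k - inc b' k - (inc a' (Suc k) - inc b' (Suc k))" if "k \<in> {1..n}" for k
      using ell_weight_imp_weight[OF T that eq[OF that]] weight_coord[of k a' b'] that by (simp add: Tab T'ab)
  qed
  have 0: "a 0 = 0" "b 0 = 0" "a' 0 = 0" "b' 0 = 0" and n: "a n + b n = int i" "a' n + b' n = int i"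
    and out: "\<And>k. k > n \<Longrightarrow> a k = 0 \<and> b k = 0 \<and> a' k = 0 \<and> b' k = 0"
    using S by (auto simp: states_def)
  have diff: "a k - b k = a' k - b' k" if "k \<le> n" for k using that
  proof (induction k)
    case (Suc k)
    then show ?case using d[of "Suc k"] by (simp add: inc_def)
  qed (simp add: 0)
  have "\<forall>m\<in>{k..n}. a m = a' m \<and> b m = b' m" if "k \<le> n" for k using that
  proof (induction k rule: inc_induct)
    case base
    then show ?case using diff[of n] n by auto
  next
    case (step k)
    define j where "j = Suc k"
    have j: "j \<in> {1..n}" "a j = a' j" "b j = b' j" using step by (auto simp: j_def)
    have "inc a j = inc a' j \<and> inc b j = inc b' j"
    proof (cases "j = n")
      case True
      then show ?thesis
        using d[of j] states_last[OF S(1)] states_last[OF S(2)] states_inc[OF S(1), of n] states_inc[OF S(2), of n] n_ge_2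
        by auto
    next
      case False
      then have jn: "j < n" using j by simp
      then have "Suc j \<in> {Suc k..n}" by (simp add: j_def)
      then have next_eq: "inc a (Suc j) = inc a' (Suc j)" using step.IH j(2) by (auto simp: inc_def j_def)
      have spec: "spec1 j T = spec1 j T'" "spec2 j T = spec2 j T'"
        using j jn by (simp_all add: Tab T'ab spec1_def spec2_def)
      have "spec2 j T = spec1 j T + 2 * (excess T j + 1)"
        using jn by (simp add: Tab spec1_def spec2_def excess_def)
      then have "spec1 j T \<noteq> spec2 j T" using excess_nonneg[OF T(1), of j] jn by simp
      then have "exp1 j T = exp1 j T'"
        using ell_weight_imp_exp1[OF T j(1) eq[OF j(1)] spec] by simp
      then have "inc a j = inc a' j" using next_eq jn by (simp add: Tab T'ab exp1_def)
      then show ?thesis using d[of j] j by simp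
    qed
    then have "a k = a' k \<and> b k = b' k" using j by (simp add: inc_def j_def)
    then show ?case using step.IH by (metis atLeastAtMost_iff not_less_eq_eq le_antisym)
  qed
  from this[of 0] have "a k = a' k \<and> b k = b' k" if "k \<le> n" for k using that by simp
  then show ?thesis unfolding Tab T'ab using out by (metis ext leI prod.inject)
qed

end


context type_C_fund_module
begin

lemma ell_weight_space_iff:
  "x \<in> ell_weight_space n q scale act \<omega> \<longleftrightarrow> (\<forall>k\<in>{1..n}. \<forall>r s. \<exists>N.
     ((\<lambda>w. opr (P_elt n q s k r) w - scale (ell_coeff s (\<omega> k) r) w) ^^ N) x = 0)"
  by (simp add: ell_weight_space_def opr_def)

definition P_gens :: "uq_free set" where
  "P_gens = {P_elt n q s k r | s k r. k \<in> {1..n}}"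

lemma ell_weight_module:
  obtains v where "\<And>T. T \<in> states \<Longrightarrow> v T \<noteq> 0" "\<And>T. T \<in> states \<Longrightarrow> v T \<in> W (wt T)"
    "\<And>T k s r. T \<in> states \<Longrightarrow> k \<in> {1..n} \<Longrightarrow> opr (P_elt n q s k r) (v T) = scale (ell_coeff s (ell_weight T k) r) (v T)"
    "\<And>x. \<exists>c. x = (\<Sum>T\<in>states. scale (c T) (v T))"
    "\<And>c. (\<Sum>T\<in>states. scale (c T) (v T)) = 0 \<Longrightarrow> \<forall>T\<in>states. c T = 0"
proof -
  obtain v where v: "\<And>T. T \<in> states \<Longrightarrow> v T \<noteq> 0" "\<And>T. T \<in> states \<Longrightarrow> v T \<in> W (wt T)"
    "\<And>T j m. T \<in> states \<Longrightarrow> j \<in> {1..n} \<Longrightarrow> m \<noteq> 0 \<Longrightarrow> H j m (v T) = scale (chi j m T) (v T)"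
    "vs.span (v ` states) = UNIV"
    using realization by metis
  have P: "opr (P_elt n q s k r) (v T) = scale (ell_coeff s (ell_weight T k) r) (v T)"
    if T: "T \<in> states" and k: "k \<in> {1..n}" for T k s r
  proof -
    have "opr (P_elt n q s k r) (v T) = scale (fps_nth (signed_power (exp1 k T) (lin ((q * q powi spec1 k T) powi sg s))
        * signed_power (exp2 k T) (lin ((q * q powi spec2 k T) powi sg s))) r) (v T)"
      by (rule opr_P_elt[OF k exp_range[OF T k] v(3)[OF T k]])
    also have "\<dots> = scale (fps_nth (ell_series s (ell_weight T k)) r) (v T)"
      by (simp only: ell_weight_series[OF k])
    finally show ?thesis by (simp add: ell_series_def)
  qed
  \<comment> \<open>An element may be a \<open>P_elt\<close> for several indices; choosing its
    eigenvalue on \<open>v T\<close> gives a function of the element alone, unambiguous because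
    \<open>v T\<close> is nonzero.\<close>
  define \<chi> where "\<chi> = (\<lambda>f T. SOME c. opr f (v T) = scale c (v T))"
  have eig: "opr f (v T) = scale (\<chi> f T) (v T)" if fT: "f \<in> P_gens" "T \<in> states" for f T
  proof -
    obtain s k r where "f = P_elt n q s k r" "k \<in> {1..n}" using fT(1) unfolding P_gens_def by blast
    then have "\<exists>c. opr f (v T) = scale c (v T)" using P[OF fT(2)] by blast
    then show ?thesis unfolding \<chi>_def by (rule someI_ex)
  qed
  have \<chi>: "\<chi> (P_elt n q s k r) T = ell_coeff s (ell_weight T k) r" if "T \<in> states" "k \<in> {1..n}" for T k s r
  proof -
    have "P_elt n q s k r \<in> P_gens" using that by (auto simp: P_gens_def)
    then have "scale (\<chi> (P_elt n q s k r) T) (v T) = scale (ell_coeff s (ell_weight T k) r) (v T)"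
      using eig P that by metis
    then show ?thesis using v(1)[OF that(1)] by (simp add: vs.scale_right_imp_eq)
  qed
  have sep: "\<exists>f\<in>P_gens. \<chi> f T \<noteq> \<chi> f T'" if T: "T \<in> states" "T' \<in> states" "T \<noteq> T'" for T T'
  proof -
    obtain k where k: "k \<in> {1..n}" "ell_weight T k \<noteq> ell_weight T' k" using ell_weight_inj T by blast
    then have "ell_series Plus (ell_weight T k) \<noteq> ell_series Plus (ell_weight T' k)"
      using normalized_ratfun_eqI ell_weight_normalized by blast
    then obtain r where "ell_coeff Plus (ell_weight T k) r \<noteq> ell_coeff Plus (ell_weight T' k) r"
      by (auto simp: ell_series_def fps_eq_iff simp del: ell_coeff.simps)
    then have "\<chi> (P_elt n q Plus k r) T \<noteq> \<chi> (P_elt n q Plus k r) T'" using \<chi> T k by simp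
    then show ?thesis using k by (auto simp: P_gens_def)
  qed
  show ?thesis
  proof (rule that[of v, OF v(1,2) P])
    show "\<exists>c. x = (\<Sum>T\<in>states. scale (c T) (v T))" for x
      using span_image_sum[OF finite_states, of x v] v(4) by auto
    show "\<forall>T\<in>states. c T = 0" if "(\<Sum>T\<in>states. scale (c T) (v T)) = 0" for c
    proof (rule eigenvectors_independent[OF finite_states _ eig v(1) sep that])
      show "f \<in> P_gens \<Longrightarrow> f \<in> carrier (free_alg n)" for f
        by (auto simp: P_gens_def intro: free_alg_P_elt)
    qed
  qed
qed

theorem ell_weight_spaces:
  shows "\<mu> \<in> weight_lattice n \<Longrightarrow> wt_ell n q scale act (W \<mu>) = {ell_weight T | T. T \<in> states \<and> (\<forall>k\<in>{1..n}. exp1 k T + exp2 k T = \<mu> k)}"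
    and "T \<in> states \<Longrightarrow> vs.dim (ell_weight_space n q scale act (ell_weight T)) = 1"
proof -
  obtain v where v: "\<And>T. T \<in> states \<Longrightarrow> v T \<noteq> 0" "\<And>T. T \<in> states \<Longrightarrow> v T \<in> W (wt T)"
    and P: "\<And>T k s r. T \<in> states \<Longrightarrow> k \<in> {1..n} \<Longrightarrow> opr (P_elt n q s k r) (v T) = scale (ell_coeff s (ell_weight T k) r) (v T)"
    and span: "\<And>x. \<exists>c. x = (\<Sum>T\<in>states. scale (c T) (v T))"
    and indep: "\<And>c. (\<Sum>T\<in>states. scale (c T) (v T)) = 0 \<Longrightarrow> \<forall>T\<in>states. c T = 0"
    using ell_weight_module by blast
  \<comment> \<open>On the basis the powers act by powers of numbers, so by independence every
    column with nonzero coefficient has the eigenvalues of \<omega>. Generalised eigenvectors are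
    thus ordinary ones.\<close>
  have same: "\<omega> k = ell_weight T k" if \<omega>: "\<omega> \<in> ell_lattice n" and c: "(\<Sum>T\<in>states. scale (c T) (v T)) \<in> ell_weight_space n q scale act \<omega>"
    and T: "T \<in> states" "c T \<noteq> 0" for \<omega> c T k
  proof (cases "k \<in> {1..n}")
    case True
    have "ell_coeff Plus (ell_weight T k) r = ell_coeff Plus (\<omega> k) r" for r
    proof -
      obtain N where "((\<lambda>w. opr (P_elt n q Plus k r) w - scale (ell_coeff Plus (\<omega> k) r) w) ^^ N) (\<Sum>T\<in>states. scale (c T) (v T)) = 0"
        using c[unfolded ell_weight_space_iff, THEN bspec, OF True, THEN spec[of _ r], THEN spec[of _ Plus]] ..
      then have "\<forall>T\<in>states. c T * (ell_coeff Plus (ell_weight T k) r - ell_coeff Plus (\<omega> k) r) ^ N = 0"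
        by (intro indep) (subst (asm) funpow_eigen_sum[OF free_alg_P_elt[OF True], where \<chi> = "\<lambda>T. ell_coeff Plus (ell_weight T k) r"],
            use P[OF _ True] in auto)
      then show ?thesis using T by auto
    qed
    then have "ell_series Plus (\<omega> k) = ell_series Plus (ell_weight T k)"
      by (intro fps_ext) (simp add: ell_series_def del: ell_coeff.simps)
    then show ?thesis using ell_lattice_normalized[OF \<omega>] ell_weight_normalized normalized_ratfun_eqI by blast
  next
    case False
    then show ?thesis using ell_lattice_normalized[OF \<omega>, of k] by (auto simp: ell_weight_def)
  qed
  have mem: "v T \<in> ell_weight_space n q scale act (ell_weight T)" if "T \<in> states" for T
  proof -
    have "((\<lambda>w. opr (P_elt n q e k r) w - scale (ell_coeff e (ell_weight T k) r) w) ^^ 1) (v T) = 0" if "k \<in> {1..n}" for k r e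
      using P[OF \<open>T \<in> states\<close> that] by simp
    then show ?thesis unfolding ell_weight_space_iff by (intro ballI allI exI)
  qed
  note lattice = ell_weight_lattice
  show "wt_ell n q scale act (W \<mu>) = {ell_weight T | T. T \<in> states \<and> (\<forall>k\<in>{1..n}. exp1 k T + exp2 k T = \<mu> k)}"
    if \<mu>: "\<mu> \<in> weight_lattice n"
  proof (intro Set.set_eqI iffI)
    fix \<omega> assume "\<omega> \<in> wt_ell n q scale act (W \<mu>)"
    then have \<omega>: "\<omega> \<in> ell_lattice n" and ne: "ell_weight_space n q scale act \<omega> \<inter> W \<mu> \<noteq> {0}" by (auto simp: wt_ell_def)
    have "0 \<in> ell_weight_space n q scale act \<omega>"
      unfolding ell_weight_space_iff by (auto intro!: exI[of _ 0])
    moreover have "0 \<in> W \<mu>" by (rule vs.subspace_0[OF W_subspace])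
    ultimately obtain x where x: "x \<in> ell_weight_space n q scale act \<omega>" "x \<in> W \<mu>" "x \<noteq> 0" using ne by blast
    obtain c where c: "x = (\<Sum>T\<in>states. scale (c T) (v T))" using span by blast
    have "\<exists>T\<in>states. c T \<noteq> 0"
    proof (rule ccontr)
      assume "\<not> (\<exists>T\<in>states. c T \<noteq> 0)"
      then have "x = 0" unfolding c by (intro sum.neutral) simp
      then show False using x(3) by simp
    qed
    then obtain T where T: "T \<in> states" "c T \<noteq> 0" by blast
    have "\<omega> = ell_weight T" using same[OF \<omega> x(1)[unfolded c] T] by blast
    moreover have "exp1 k T + exp2 k T = \<mu> k" if k: "k \<in> {1..n}" for k
    proof -
      have "K Plus k x = scale (qi n q k powi \<mu> k) x" using x(2) k by (simp add: W_iff)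
      moreover have "K Plus k x = (\<Sum>T\<in>states. scale (c T * qi n q k powi wt T k) (v T))"
        unfolding c using k v(2) by (simp add: K_linear W_iff)
      ultimately have "(\<Sum>T\<in>states. scale (c T * (qi n q k powi wt T k - qi n q k powi \<mu> k)) (v T)) = 0"
        by (simp add: c vs.scale_sum_right right_diff_distrib vs.scale_left_diff_distrib sum_subtractf mult.commute)
      then have "\<forall>T\<in>states. c T * (qi n q k powi wt T k - qi n q k powi \<mu> k) = 0" by (rule indep)
      then have "qi n q k powi wt T k = qi n q k powi \<mu> k" using T by auto
      then show ?thesis using k by (simp add: qi_powi_eq_iff wt_def)
    qed
    ultimately show "\<omega> \<in> {ell_weight T | T. T \<in> states \<and> (\<forall>k\<in>{1..n}. exp1 k T + exp2 k T = \<mu> k)}" using T by blast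
  next
    fix \<omega> assume "\<omega> \<in> {ell_weight T | T. T \<in> states \<and> (\<forall>k\<in>{1..n}. exp1 k T + exp2 k T = \<mu> k)}"
    then obtain T where T: "\<omega> = ell_weight T" "T \<in> states" "\<forall>k\<in>{1..n}. exp1 k T + exp2 k T = \<mu> k" by blast
    have wt: "wt T = \<mu>" using T(3) \<mu> by (auto simp: wt_def weight_lattice_def)
    have "v T \<in> ell_weight_space n q scale act \<omega> \<inter> W \<mu>"
      using mem[OF T(2)] v(2)[OF T(2)] unfolding T(1) wt by (rule IntI)
    then have "ell_weight_space n q scale act \<omega> \<inter> W \<mu> \<noteq> {0}" using v(1)[OF T(2)] by (metis singletonD)
    moreover have "\<omega> \<in> ell_lattice n" unfolding T(1) by (rule lattice)
    ultimately show "\<omega> \<in> wt_ell n q scale act (W \<mu>)" by (simp add: wt_ell_def)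
  qed
  assume T: "T \<in> states"
  have "ell_weight_space n q scale act (ell_weight T) = vs.span {v T}"
  proof (intro Set.set_eqI iffI)
    fix x assume x: "x \<in> ell_weight_space n q scale act (ell_weight T)"
    obtain c where c: "x = (\<Sum>T\<in>states. scale (c T) (v T))" using span by blast
    have c0: "c T' = 0" if T': "T' \<in> states" "T' \<noteq> T" for T'
    proof (rule ccontr)
      assume "c T' \<noteq> 0"
      then have "ell_weight T k = ell_weight T' k" for k
        using same[OF lattice x[unfolded c] T'(1)] by blast
      then show False using ell_weight_inj[OF T T'(1)] T'(2) by blast
    qed
    have "x = scale (c T) (v T) + (\<Sum>T'\<in>states - {T}. scale (c T') (v T'))"
      unfolding c by (rule sum.remove[OF finite_states T])
    also have "(\<Sum>T'\<in>states - {T}. scale (c T') (v T')) = 0"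
      by (rule sum.neutral) (simp add: c0)
    finally have "x = scale (c T) (v T)" by simp
    then show "x \<in> vs.span {v T}" by (auto intro: vs.span_scale vs.span_base)
  next
    fix x assume "x \<in> vs.span {v T}"
    then obtain a where x: "x = scale a (v T)" by (auto simp: vs.span_singleton)
    have "((\<lambda>w. opr (P_elt n q e k r) w - scale (ell_coeff e (ell_weight T k) r) w) ^^ 1) x = 0" if "k \<in> {1..n}" for k r e
      using P[OF T that] free_alg_P_elt[OF that] by (simp add: x opr_linear_simps mult.commute)
    then show "x \<in> ell_weight_space n q scale act (ell_weight T)" unfolding ell_weight_space_iff by (intro ballI allI exI)
  qed
  moreover have "vs.dim (vs.span {v T}) = 1"
    using v(1)[OF T] by (subst vs.dim_span, subst vs.dim_eq_card_independent) (auto simp: vs.dependent_single)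
  ultimately show "vs.dim (ell_weight_space n q scale act (ell_weight T)) = 1" by simp
qed

end

section \<open>Dominant \<open>\<ell>\<close>-weights\<close>

definition count_le :: "nat list \<Rightarrow> nat \<Rightarrow> nat" where
  "count_le js j = card {x \<in> set js. x \<le> j}"

lemma count_le_eq_0:
  assumes "\<And>x. x \<in> set js \<Longrightarrow> j < x"
  shows "count_le js j = 0"
proof -
  have "{x \<in> set js. x \<le> j} = {}" using assms by (auto simp: not_le)
  then show ?thesis unfolding count_le_def by (simp only: card.empty)
qed

lemma count_le_0: "0 \<notin> set js \<Longrightarrow> count_le js 0 = 0"
  by (intro count_le_eq_0) (metis gr0I)

lemma count_le_Suc: "count_le js (Suc j) = count_le js j + (if Suc j \<in> set js then 1 else 0)"
proof (cases "Suc j \<in> set js")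
  case True
  then have "{x \<in> set js. x \<le> Suc j} = insert (Suc j) {x \<in> set js. x \<le> j}" by auto
  then show ?thesis using True by (simp add: count_le_def)
next
  case False
  then have "{x \<in> set js. x \<le> Suc j} = {x \<in> set js. x \<le> j}" using le_Suc_eq by auto
  then show ?thesis using False by (simp add: count_le_def)
qed

lemma strict_sorted_distinct: "sorted_wrt (<) js \<Longrightarrow> distinct js" for js :: "nat list"
  by (simp add: strict_sorted_iff)

lemma count_le_nth:
  assumes js: "sorted_wrt (<) js" and t: "t < length js"
  shows "count_le js (js ! t) = Suc t"
proof -
  have "{x \<in> set js. x \<le> js ! t} = (!) js ` {..t}"
  proof (intro equalityI subsetI)
    fix x assume "x \<in> {x \<in> set js. x \<le> js ! t}"
    then obtain u where u: "u < length js" "x = js ! u" "js ! u \<le> js ! t" by (auto simp: in_set_conv_nth)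
    then have "u \<le> t" using sorted_wrt_nth_less[OF js, of t u] t by (meson not_less)
    then show "x \<in> (!) js ` {..t}" using u by blast
  next
    fix x assume "x \<in> (!) js ` {..t}"
    then obtain u where u: "u \<le> t" "x = js ! u" by blast
    then have "x \<le> js ! t" using sorted_wrt_nth_less[OF js, of u t] t by (cases "u = t") auto
    then show "x \<in> {x \<in> set js. x \<le> js ! t}" using u t by auto
  qed
  moreover have "inj_on ((!) js) {..t}"
    using strict_sorted_distinct[OF js] t by (auto simp: inj_on_def nth_eq_iff_index_eq)
  ultimately show ?thesis by (simp add: count_le_def card_image)
qed

lemma count_le_max:
  assumes "sorted_wrt (<) js" "\<And>x. x \<in> set js \<Longrightarrow> x \<le> j"
  shows "count_le js j = length js"
proof -
  have "{x \<in> set js. x \<le> j} = set js" using assms(2) by auto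
  then show ?thesis using strict_sorted_distinct[OF assms(1)] by (simp add: count_le_def distinct_card)
qed

lemma count_le_less_nth:
  assumes js: "sorted_wrt (<) js" and "count_le js j < length js"
  shows "j < js ! count_le js j"
proof (rule ccontr)
  assume "\<not> j < js ! count_le js j"
  then have "{x \<in> set js. x \<le> js ! count_le js j} \<subseteq> {x \<in> set js. x \<le> j}" by auto
  then have "count_le js (js ! count_le js j) \<le> count_le js j" by (simp add: count_le_def card_mono)
  then show False using count_le_nth[OF js assms(2)] by simp
qed

lemma pi_step_other: "j \<noteq> k \<or> k = 0 \<Longrightarrow> pi_step n q i r j s k = 1"
  by (auto simp: pi_step_def ell_fund_def)

text \<open>At node \<open>k\<close> only the entries \<open>k + 1\<close> and \<open>k\<close> of
  \<open>js\<close> contribute. Their second arguments s - 1 and s both equal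
  \<open>count_le js k\<close>, so the contributions cancel when both are present.\<close>

lemma pi_ell_eq:
  assumes js: "sorted_wrt (<) js" "length js = MM i r" "\<And>x. x \<in> set js \<Longrightarrow> r < x" and k: "1 \<le> k"
  shows "pi_ell n q i r js k = ell_fund r (q powi (int i - int r)) k *
    ((if Suc k \<in> set js then pi_step n q i r k (count_le js k) k else 1) *
     (if k \<in> set js then inverse (pi_step n q i r k (count_le js k) k) else 1))"
proof -
  let ?M = "MM i r"
  have up: "(\<Prod>s = 1..?M. pi_step n q i r (js ! (s - 1) - 1) (s - 1) k) =
      (if Suc k \<in> set js then pi_step n q i r k (count_le js k) k else 1)"
  proof (cases "Suc k \<in> set js")
    case True
    then obtain t where t: "t < length js" "js ! t = Suc k" by (auto simp: in_set_conv_nth)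
    have c: "count_le js k = t" using count_le_nth[OF js(1) t(1)] True by (simp add: t(2) count_le_Suc)
    have "pi_step n q i r (js ! (s - 1) - 1) (s - 1) k = (if s = Suc t then pi_step n q i r k t k else 1)"
      if s: "s \<in> {1..?M}" for s
    proof (cases "s = Suc t")
      case True
      then show ?thesis using t by simp
    next
      case False
      have "js ! (s - 1) \<noteq> js ! t"
        using strict_sorted_distinct[OF js(1)] s t(1) js(2) False by (subst nth_eq_iff_index_eq) auto
      moreover have "js ! (s - 1) \<in> set js" using s js(2) by (intro nth_mem) auto
      then have "0 < js ! (s - 1)" using js(3) by (metis not_less_zero gr0I)
      ultimately have "js ! (s - 1) - 1 \<noteq> k" using t(2) by auto
      then show ?thesis using False by (simp add: pi_step_other)
    qed
    then have "(\<Prod>s = 1..?M. pi_step n q i r (js ! (s - 1) - 1) (s - 1) k) = (\<Prod>s = 1..?M. if s = Suc t then pi_step n q i r k t k else 1)"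
      by (intro prod.cong) auto
    also have "\<dots> = pi_step n q i r k t k" using t(1) js(2) by simp
    finally show ?thesis using True c by simp
  next
    case False
    have "pi_step n q i r (js ! (s - 1) - 1) (s - 1) k = 1" if s: "s \<in> {1..?M}" for s
    proof -
      have "js ! (s - 1) \<in> set js" using s js(2) by (intro nth_mem) auto
      then have "js ! (s - 1) - 1 \<noteq> k" using False js(3)[of "js ! (s - 1)"] by auto
      then show ?thesis by (simp add: pi_step_other)
    qed
    then show ?thesis using False by simp
  qed
  have down: "(\<Prod>s = 1..?M. inverse (pi_step n q i r (js ! (s - 1)) s k)) =
      (if k \<in> set js then inverse (pi_step n q i r k (count_le js k) k) else 1)"
  proof (cases "k \<in> set js")
    case True
    then obtain t where t: "t < length js" "js ! t = k" by (auto simp: in_set_conv_nth)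
    have c: "count_le js k = Suc t" using count_le_nth[OF js(1) t(1)] t(2) by simp
    have "inverse (pi_step n q i r (js ! (s - 1)) s k) = (if s = Suc t then inverse (pi_step n q i r k (Suc t) k) else 1)"
      if s: "s \<in> {1..?M}" for s
    proof (cases "s = Suc t")
      case True
      then show ?thesis using t by simp
    next
      case False
      have "js ! (s - 1) \<noteq> js ! t"
        using strict_sorted_distinct[OF js(1)] s t(1) js(2) False by (subst nth_eq_iff_index_eq) auto
      then show ?thesis using False t(2) by (simp add: pi_step_other)
    qed
    then have "(\<Prod>s = 1..?M. inverse (pi_step n q i r (js ! (s - 1)) s k)) = (\<Prod>s = 1..?M. if s = Suc t then inverse (pi_step n q i r k (Suc t) k) else 1)"
      by (intro prod.cong) auto
    also have "\<dots> = inverse (pi_step n q i r k (Suc t) k)" using t(1) js(2) by simp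
    finally show ?thesis using True c by simp
  next
    case False
    have "pi_step n q i r (js ! (s - 1)) s k = 1" if s: "s \<in> {1..?M}" for s
    proof -
      have "js ! (s - 1) \<in> set js" using s js(2) by (intro nth_mem) auto
      then have "js ! (s - 1) \<noteq> k" using False by auto
      then show ?thesis by (simp add: pi_step_other)
    qed
    then show ?thesis using False by simp
  qed
  show ?thesis unfolding pi_ell_def prod.distrib up down ..
qed

lemma J_setD:
  assumes "js \<in> J_set n i r"
  shows "sorted_wrt (<) js" "length js = MM i r" "\<And>x. x \<in> set js \<Longrightarrow> r < x \<and> x \<le> n"
    "\<And>t. t < MM i r \<Longrightarrow> int (js ! t) \<le> int n - int i + int r + 2 * int t + 1"
proof -
  show "sorted_wrt (<) js" "length js = MM i r" "\<And>x. x \<in> set js \<Longrightarrow> r < x \<and> x \<le> n"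
    using assms by (auto simp: J_set_def)
  fix t assume "t < MM i r"
  then have "Suc t \<in> {1..MM i r}" by simp
  then have "int (js ! (Suc t - 1)) \<le> int n - int i + int r + 2 * int (Suc t) - 1"
    using assms unfolding J_set_def by blast
  then show "int (js ! t) \<le> int n - int i + int r + 2 * int t + 1" by simp
qed

context type_C_fund
begin

text \<open>The states of weight \<open>\<omega>\<^sub>r\<close> are the columns \<open>1, \<dots>, r, j\<^sub>1, \<dots>, j\<^sub>M, -j\<^sub>M, \<dots>, -j\<^sub>1\<close>.\<close>

definition describes :: "nat \<Rightarrow> nat list \<Rightarrow> state \<Rightarrow> bool" where
  "describes r js T \<longleftrightarrow> (\<forall>j\<in>{1..n}. inc (snd T) j = (if j \<in> set js then 1 else 0)
      \<and> inc (fst T) j = (if j \<le> r then 1 else 0) + (if j \<in> set js then 1 else 0))"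

lemma describes_counts:
  assumes "describes r js T" "T \<in> states" "0 \<notin> set js" "j \<le> n"
  shows "snd T j = int (count_le js j)" "fst T j = int (min j r) + int (count_le js j)"
proof -
  have 0: "fst T 0 = 0" "snd T 0 = 0" using assms(2) by (auto simp: states_def)
  have "snd T j = int (count_le js j) \<and> fst T j = int (min j r) + int (count_le js j)" using assms(4)
  proof (induction j)
    case 0
    then show ?case using \<open>fst T 0 = 0\<close> \<open>snd T 0 = 0\<close> count_le_0[OF assms(3)] by simp
  next
    case (Suc j)
    have "inc (snd T) (Suc j) = (if Suc j \<in> set js then 1 else 0)"
      "inc (fst T) (Suc j) = (if Suc j \<le> r then 1 else 0) + (if Suc j \<in> set js then 1 else 0)"
      using assms(1) Suc.prems by (auto simp: describes_def)
    moreover have "int (min (Suc j) r) = int (min j r) + (if Suc j \<le> r then 1 else 0)" by auto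
    ultimately show ?case using Suc
      by (cases "Suc j \<le> r"; cases "Suc j \<in> set js") (auto simp: inc_def count_le_Suc)
  qed
  then show "snd T j = int (count_le js j)" "fst T j = int (min j r) + int (count_le js j)" by auto
qed

lemma describes_weight:
  assumes "describes r js T" "r \<le> n" "\<And>x. x \<in> set js \<Longrightarrow> r < x" "k \<in> {1..n}"
  shows "exp1 k T + exp2 k T = fund_weight r k"
proof -
  obtain a b where Tab: "T = (a, b)" by (cases T)
  have d: "inc a j - inc b j = (if j \<le> r then 1 else 0)" if "j \<in> {1..n}" for j
    using assms(1) that by (auto simp: describes_def Tab)
  have "inc a (k + 1) - inc b (k + 1) = (if k + 1 \<le> r then 1 else 0)"
  proof (cases "k < n")
    case True
    then show ?thesis using d[of "k + 1"] by simp
  next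
    case False
    then show ?thesis using assms(2,4) by (simp add: inc_def)
  qed
  then show ?thesis
    using weight_coord[of k a b] d[OF assms(4)] assms(4) by (auto simp: Tab fund_weight_def)
qed

text \<open>For r \<le> k < n the parameters of the column at \<open>k\<close> are those of
  \<open>pi_step\<close> at \<open>count_le js k\<close>. No entry of \<open>js\<close> is at most
  \<open>r\<close>, so node \<open>r\<close> carries the extra factor with exponent i - r. At
  \<open>n\<close> the letter \<open>n\<close> cannot belong to \<open>js\<close>, as
  \<open>-n\<close> would occur with it.\<close>

lemma describes_ell_weight:
  assumes D: "describes r js T" and T: "T \<in> states" and r: "r \<le> i"
    and js: "sorted_wrt (<) js" "length js = MM i r" "\<And>x. x \<in> set js \<Longrightarrow> r < x \<and> x \<le> n"
  shows "ell_weight T = pi_ell n q i r js"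
proof
  fix k
  obtain a b where Tab: "T = (a, b)" by (cases T)
  have z: "0 \<notin> set js" using js(3) by auto
  show "ell_weight T k = pi_ell n q i r js k"
  proof (cases "k \<in> {1..n}")
    case False
    have "pi_step n q i r (js ! (s - 1) - 1) (s - 1) k = 1" "pi_step n q i r (js ! (s - 1)) s k = 1" if "s \<in> {1..MM i r}" for s
    proof -
      have "js ! (s - 1) \<in> set js" using that js(2) by (intro nth_mem) auto
      then have "js ! (s - 1) \<le> n" using js(3) by blast
      then have "js ! (s - 1) - 1 \<noteq> k \<or> k = 0" "js ! (s - 1) \<noteq> k \<or> k = 0" using False by auto
      then show "pi_step n q i r (js ! (s - 1) - 1) (s - 1) k = 1" "pi_step n q i r (js ! (s - 1)) s k = 1"
        by - (rule pi_step_other, assumption)+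
    qed
    then have "pi_ell n q i r js k = ell_fund r (q powi (int i - int r)) k" by (simp add: pi_ell_def)
    also have "\<dots> = 1" using False r i by (auto simp: ell_fund_def)
    finally show ?thesis using False by (auto simp: ell_weight_def)
  next
    case True
    define c where "c = int (count_le js k)"
    have k: "1 \<le> k" "k \<le> n" using True by auto
    have pi: "pi_ell n q i r js k = ell_fund r (q powi (int i - int r)) k *
      ((if Suc k \<in> set js then pi_step n q i r k (count_le js k) k else 1) *
       (if k \<in> set js then inverse (pi_step n q i r k (count_le js k) k) else 1))"
      by (rule pi_ell_eq) (use js k in auto)
    have ab: "b k = c" "a k = int (min k r) + c"
      using describes_counts[OF D T z k(2)] by (simp_all add: Tab c_def)
    have inck: "inc b k = (if k \<in> set js then 1 else 0)" "inc a k = (if k \<le> r then 1 else 0) + (if k \<in> set js then 1 else 0)"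
      using D True by (auto simp: describes_def Tab)
    have kr: "k \<in> set js \<Longrightarrow> r < k" "Suc k \<in> set js \<Longrightarrow> r \<le> k \<and> k < n" using js(3)[of k] js(3)[of "Suc k"] by auto
    define Z1 Z2 where Z: "Z1 = ell_fund k (q powi (int i + int k - 2 * c - 2 * int r)) k"
      "Z2 = ell_fund k (q powi (2 * int n + 2 - int i - int k + 2 * c)) k"
    have step: "pi_step n q i r k (count_le js k) k = inverse Z1 * Z2"
      by (simp add: pi_step_def Z c_def)
    have nz: "Z1 \<noteq> 0" "Z2 \<noteq> 0" using k by (auto simp: Z ell_fund_def Zero_fract_def eq_fract)
    show ?thesis
    proof (cases "k = n")
      case False
      then have kn: "k < n" using k by simp
      have incS: "inc b (Suc k) = (if Suc k \<in> set js then 1 else 0)"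
        "inc a (Suc k) = (if Suc k \<le> r then 1 else 0) + (if Suc k \<in> set js then 1 else 0)"
        using D kn by (auto simp: describes_def Tab)
      have spec: "spec1 k T + 1 = int i + int k - 2 * a k" "spec2 k T + 1 = 2 * int n + 2 - int i - int k + 2 * c"
        "exp1 k T = inc a k - inc a (Suc k)" "exp2 k T = inc b (Suc k) - inc b k"
        using kn by (simp_all add: Tab exp1_def exp2_def spec1_def spec2_def ab(1))
      have L: "ell_weight T k = signed_power (inc a k - inc a (Suc k)) (ell_fund k (q powi (int i + int k - 2 * a k)) k)
          * signed_power (inc b (Suc k) - inc b k) Z2"
        unfolding ell_weight_def spec Z using True by simp
      have Z1: "ell_fund k (q powi (int i + int k - 2 * a k)) k = Z1" if "r \<le> k"
        using that by (simp add: Z ab min_def algebra_simps)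
      consider "k < r" | "k = r" | "r < k" by linarith
      then show ?thesis
      proof cases
        case 1
        then have "k \<notin> set js" "Suc k \<notin> set js" using kr by auto
        then show ?thesis unfolding L pi using 1 inck incS by (simp add: signed_power_def ell_fund_other)
      next
        case 2
        then have "k \<notin> set js" using kr by auto
        moreover have "ell_fund r (q powi (int i - int r)) k = Z1"
        proof -
          have "c = 0" using 2 js(3) count_le_eq_0[of js k] by (simp add: c_def)
          then show ?thesis using 2 by (simp add: Z)
        qed
        ultimately show ?thesis unfolding L pi step using 2 inck incS Z1 nz by (simp add: signed_power_def)
      next
        case 3
        then have "ell_fund r (q powi (int i - int r)) k = 1" by (simp add: ell_fund_other)
        moreover have "inverse Z1 * Z2 * (Z1 * inverse Z2) = 1" using nz by (simp add: field_simps)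
        ultimately show ?thesis unfolding L pi step using 3 inck incS Z1 nz by (simp add: signed_power_def)
      qed
    next
      case True
      have "Suc k \<notin> set js" using kr True by auto
      have L: "ell_weight T k = signed_power (inc a n - inc b n) (ell_fund n (q powi (int n - int i + 2 * b n + 2 * inc b n)) n)"
      proof -
        have spec: "spec1 k T + 1 = int n - int i + 2 * b n + 2 * inc b n" "exp1 k T = inc a n - inc b n" "exp2 k T = 0"
          using True by (simp_all add: Tab exp1_def exp2_def spec1_def)
        have one: "signed_power 0 x = 1" for x :: ratfun by (simp add: signed_power_def)
        show ?thesis unfolding ell_weight_def spec one using k True by simp
      qed
      have last: "inc a n + inc b n \<le> 1" using states_last T Tab by simp
      have nj: "k \<notin> set js" using last inck True kr by (auto split: if_splits)
      show ?thesis
      proof (cases "r = n")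
        case True
        then have "i = n" using r i by simp
        moreover have "js = []" using js(3)[of "hd js"] True by (cases js) auto
        ultimately show ?thesis
          unfolding L pi using \<open>k = n\<close> True inck ab
          by (simp add: signed_power_def c_def count_le_def)
      next
        case False
        then have "r < n" using r i by simp
        then show ?thesis
          unfolding L pi using \<open>k = n\<close> nj \<open>Suc k \<notin> set js\<close> inck by (simp add: signed_power_def ell_fund_other)
      qed
    qed
  qed
qed

text \<open>Beyond \<open>r\<close> the excess rises by 1 at members of \<open>js\<close> and falls
  by 1 elsewhere. Its minima lie just before a member, where the bound in \<open>J_set\<close> makes
  it nonnegative, or at \<open>n\<close>, where it is 0.\<close>

lemma J_set_state:
  assumes js: "js \<in> J_set n i r" and r: "r \<le> i" "r mod 2 = i mod 2"
  obtains T where "T \<in> states" "describes r js T"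
proof -
  note J = J_setD[OF js]
  define M where "M = MM i r"
  \<comment> \<open>Equal parity makes the division by 2 in \<open>MM\<close> exact.\<close>
  have M: "r + 2 * M = i" using r unfolding M_def MM_def by presburger
  define a b where "a = (\<lambda>j. if j \<le> n then int (min j r) + int (count_le js j) else 0)"
    "b = (\<lambda>j. if j \<le> n then int (count_le js j) else 0)"
  have z: "0 \<notin> set js" using J(3) by auto
  have rn: "r \<le> n" using r i by simp
  have incs: "inc b j = (if j \<in> set js then 1 else 0)" "inc a j = (if j \<le> r then 1 else 0) + (if j \<in> set js then 1 else 0)"
    if jn: "j \<in> {1..n}" for j
  proof -
    obtain l where l: "j = Suc l" using jn by (cases j) auto
    show "inc b j = (if j \<in> set js then 1 else 0)" "inc a j = (if j \<le> r then 1 else 0) + (if j \<in> set js then 1 else 0)"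
      using jn by (auto simp: l inc_def a_b_def count_le_Suc min_def split: if_splits)
  qed
  have cn: "count_le js n = M" using count_le_max[OF J(1)] J(2,3) by (simp add: M_def)
  have low: "count_le js j = 0" if "j \<le> r" for j
    using J(3) that by (intro count_le_eq_0) (meson le_less_trans)
  have excess: "0 \<le> excess (a, b) j" if "j \<le> n" for j
  proof (cases "j \<le> r")
    case True
    then show ?thesis using that low i by (simp add: excess_def a_b_def)
  next
    case False
    have e: "excess (a, b) j = int n - int j - int i + int r + 2 * int (count_le js j)"
      using False that by (simp add: excess_def a_b_def)
    have "{x \<in> set js. x \<le> j} \<subseteq> set js" by auto
    then have "count_le js j \<le> M"
      using strict_sorted_distinct[OF J(1)] J(2) unfolding count_le_def M_def by (metis card_mono distinct_card finite_set)
    then consider "count_le js j = M" | "count_le js j < M" by linarith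
    then show ?thesis
    proof cases
      case 1
      then show ?thesis unfolding e using M that by simp
    next
      case 2
      then have "j < js ! count_le js j" using count_le_less_nth[OF J(1)] J(2) by (simp add: M_def)
      moreover have "int (js ! count_le js j) \<le> int n - int i + int r + 2 * int (count_le js j) + 1"
        using J(4) 2 by (simp add: M_def)
      ultimately show ?thesis unfolding e by linarith
    qed
  qed
  have "inc a j \<in> {0, 1} \<and> inc b j \<in> {0, 1}" if "j \<in> {1..n}" for j
    using incs[OF that] J(3)[of j] by auto
  moreover have "a n + b n = int i" using M rn by (simp add: a_b_def cn min_def)
  moreover have "a 0 = 0" "b 0 = 0" using count_le_0[OF z] by (simp_all add: a_b_def)
  ultimately have "(a, b) \<in> states" using excess by (auto simp: states_def) (auto simp: a_b_def)
  then show ?thesis using that[of "(a, b)"] incs by (simp add: describes_def)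
qed

text \<open>This weight forces \<open>j\<close> to occur without \<open>-j\<close> for j \<le> r,
  and \<open>j\<close> and \<open>-j\<close> to occur together or not at all beyond
  \<open>r\<close>.\<close>

lemma state_J_set:
  assumes T: "T \<in> states" and r: "r \<le> i" and w: "\<And>k. k \<in> {1..n} \<Longrightarrow> exp1 k T + exp2 k T = fund_weight r k"
  obtains js where "js \<in> J_set n i r" "describes r js T"
proof -
  obtain a b where Tab: "T = (a, b)" by (cases T)
  have S: "(a, b) \<in> states" using T Tab by simp
  have rn: "r \<le> n" using r i by simp
  have d: "inc a k - inc b k = (if k \<le> r then 1 else 0)" if "k \<in> {1..n}" for k
  proof (rule weight_imp_inc_diff[where c = "\<lambda>k. if k \<le> r then 1 else 0"])
    show "exp1 k (a, b) + exp2 k (a, b) = (if k \<le> r then 1 else 0) - (if Suc k \<le> r then 1 else 0)" if "k \<in> {1..n}" for k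
      using w[OF that] that by (auto simp: Tab fund_weight_def)
    show "(if Suc n \<le> r then 1 else 0) = (0 :: int)" using rn by simp
  qed (use that in auto)
  define js where "js = sorted_list_of_set {j \<in> {1..n}. inc b j = 1}"
  have set_js: "set js = {j \<in> {1..n}. inc b j = 1}" by (simp add: js_def)
  have sorted: "sorted_wrt (<) js" by (simp add: js_def)
  have a01: "inc a j \<in> {0, 1}" "inc b j \<in> {0, 1}" if "j \<in> {1..n}" for j using states_inc[OF S, of j] that by auto
  have D: "describes r js T"
    unfolding describes_def Tab fst_conv snd_conv
  proof
    fix j assume j: "j \<in> {1..n}"
    have "inc b j = (if j \<in> set js then 1 else 0)" using a01(2)[OF j] j by (auto simp: set_js)
    moreover have "inc a j = (if j \<le> r then 1 else 0) + inc b j" using d[OF j] by simp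
    ultimately show "inc b j = (if j \<in> set js then 1 else 0)
        \<and> inc a j = (if j \<le> r then 1 else 0) + (if j \<in> set js then 1 else 0)" by simp
  qed
  have rj: "r < x \<and> x \<le> n" if "x \<in> set js" for x
    using that d[of x] a01[of x] by (auto simp: set_js split: if_splits)
  have z: "0 \<notin> set js" by (simp add: set_js)
  note counts = describes_counts[OF D T z, unfolded Tab fst_conv snd_conv]
  have "int r + 2 * int (length js) = int i"
  proof -
    have "a n + b n = int i" using S by (simp add: states_def)
    moreover have "count_le js n = length js" using count_le_max[OF sorted, of n] rj by blast
    moreover have "min n r = r" using rn by simp
    ultimately show ?thesis using counts[of n] by simp
  qed
  then have len: "length js = MM i r" by (simp add: MM_def)
  have "int (js ! (s - 1)) \<le> int n - int i + int r + 2 * int s - 1" if s: "s \<in> {1..MM i r}" for s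
  proof -
    define t where "t = s - 1"
    have t: "t < length js" "s = Suc t" using s len by (auto simp: t_def)
    define j where "j = js ! t"
    have "j \<in> set js" using t by (simp add: j_def)
    then have j: "r < j" "j \<le> n" using rj by auto
    \<comment> \<open>Admissibility is used at the position just before the entry; there it is the
      bound required by \<open>J_set\<close>.\<close>
    then obtain l where l: "j = Suc l" by (cases j) auto
    have "count_le js l = t" using count_le_nth[OF sorted t(1)] \<open>j \<in> set js\<close> by (simp add: j_def[symmetric] l count_le_Suc)
    moreover have "0 \<le> excess (a, b) l" using excess_nonneg[OF S, of l] j l by simp
    ultimately have bound: "0 \<le> int n - int l - int i + int r + 2 * int t"
      using counts[of l] j l min_absorb2[of r l] by (simp add: excess_def)
    have "int (js ! (s - 1)) = int l + 1" using l unfolding j_def t_def by simp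
    moreover have "int s = int t + 1" unfolding t(2) by simp
    ultimately show ?thesis using bound by linarith
  qed
  then have "js \<in> J_set n i r" using sorted rj len by (auto simp: J_set_def)
  then show ?thesis using that D by blast
qed

end

lemma ell_coeff_ell_fund_one:
  assumes "j \<noteq> 0"
  shows "ell_coeff s (ell_fund i 1 j) k = fps_nth (if j = i then lin 1 else 1) k"
proof -
  have "ell_series s (ell_fund i 1 j) = (if j = i then lin 1 else 1)"
    using assms by (simp add: ell_series_ell_fund ell_fund_other ell_series_one)
  then show ?thesis by (metis ell_series_def fps_nth_Abs_fps)
qed

theorem proposition3p4:
  fixes n i r :: nat
    and q :: complex
    and scale :: "complex \<Rightarrow> 'v::ab_group_add \<Rightarrow> 'v"
    and act :: "uq_free set \<Rightarrow> 'v \<Rightarrow> 'v"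
  assumes "q \<noteq> 0" and "\<forall>m::nat. 0 < m \<longrightarrow> q ^ m \<noteq> 1"
    and "1 < i" and "i \<le> n"
    and "is_fund_module n q i 1 scale act"
    and "r \<le> i" and "r mod 2 = i mod 2"
  shows "wt_ell n q scale act (weight_space n q scale act (fund_weight r))
           = {pi_ell n q i r js | js. js \<in> J_set n i r}
       \<and> (\<forall>js \<in> J_set n i r.
            vector_space.dim scale (ell_weight_space n q scale act (pi_ell n q i r js)) = 1)"
proof -
  interpret uq_rep n q scale act
    using assms by unfold_locales (auto simp: is_fund_module_def)
  interpret type_C_fund n q scale act i
    using assms by unfold_locales
  obtain v0 where v0: "v0 \<noteq> 0"
    "\<And>j k. j \<in> {1..n} \<Longrightarrow> act (cls n q (gx Plus j k)) v0 = 0"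
    "\<And>j s k. j \<in> {1..n} \<Longrightarrow> act (cls n q (P_elt n q s j k)) v0 = scale (ell_coeff s (ell_fund i 1 j) k) v0"
    "\<And>j. j \<in> {1..n} \<Longrightarrow> act (cls n q (gK Plus j)) v0 = scale (qi n q j powi (if j = i then 1 else 0)) v0"
    using assms(5) unfolding is_fund_module_def by blast
  interpret type_C_fund_module n q scale act i v0
  proof
    show "type_one n q scale act" "uq_irreducible n q scale act"
      using assms(5) by (simp_all add: is_fund_module_def)
    show "opr (P_elt n q s j k) v0 = scale (fps_nth (if j = i then lin 1 else 1) k) v0" if "j \<in> {1..n}" for j s k
      using v0(3)[OF that, of s k] ell_coeff_ell_fund_one[of j s i k] that by (simp only: opr_def) simp
    show "v0 \<noteq> 0" by (rule v0(1))
    show "K Plus j v0 = scale (qi n q j powi (if j = i then 1 else 0)) v0" if "j \<in> {1..n}" for j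
      unfolding opr_def by (rule v0(4)[OF that])
    show "X Plus j k v0 = 0" if "j \<in> {1..n}" for j k
      unfolding opr_def by (rule v0(2)[OF that])
  qed
  have rn: "r \<le> n" using assms(4,6) by simp
  have \<mu>: "fund_weight r \<in> weight_lattice n"
    using rn by (auto simp: weight_lattice_def fund_weight_def)
  have pi: "ell_weight T = pi_ell n q i r js" if "js \<in> J_set n i r" "describes r js T" "T \<in> states" for js T
    by (rule describes_ell_weight[OF that(2,3) assms(6) J_setD(1-3)[OF that(1)]])
  show ?thesis
  proof (intro conjI ballI)
    show "wt_ell n q scale act (W (fund_weight r)) = {pi_ell n q i r js | js. js \<in> J_set n i r}"
      unfolding ell_weight_spaces(1)[OF \<mu>]
    proof (intro Set.set_eqI iffI)
      fix \<omega> assume "\<omega> \<in> {ell_weight T | T. T \<in> states \<and> (\<forall>k\<in>{1..n}. exp1 k T + exp2 k T = fund_weight r k)}"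
      then obtain T where T: "\<omega> = ell_weight T" "T \<in> states" "\<And>k. k \<in> {1..n} \<Longrightarrow> exp1 k T + exp2 k T = fund_weight r k" by blast
      obtain js where "js \<in> J_set n i r" "describes r js T" by (rule state_J_set[OF T(2) assms(6) T(3)])
      then show "\<omega> \<in> {pi_ell n q i r js | js. js \<in> J_set n i r}" using pi T by blast
    next
      fix \<omega> assume "\<omega> \<in> {pi_ell n q i r js | js. js \<in> J_set n i r}"
      then obtain js where js: "\<omega> = pi_ell n q i r js" "js \<in> J_set n i r" by blast
      obtain T where T: "T \<in> states" "describes r js T" by (rule J_set_state[OF js(2) assms(6,7)])
      have "exp1 k T + exp2 k T = fund_weight r k" if "k \<in> {1..n}" for k
        using describes_weight[OF T(2) rn _ that] J_setD(3)[OF js(2)] by blast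
      then show "\<omega> \<in> {ell_weight T | T. T \<in> states \<and> (\<forall>k\<in>{1..n}. exp1 k T + exp2 k T = fund_weight r k)}"
        using T(1) js(1) pi[OF js(2) T(2,1)] unfolding mem_Collect_eq by (intro exI[of _ T] conjI ballI) simp_all
    qed
  next
    fix js assume js: "js \<in> J_set n i r"
    obtain T where T: "T \<in> states" "describes r js T" by (rule J_set_state[OF js assms(6,7)])
    show "vs.dim (ell_weight_space n q scale act (pi_ell n q i r js)) = 1"
      using ell_weight_spaces(2)[OF T(1)] pi[OF js T(2,1)] by simp
  qed
qed

end
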